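(* Let $n\ge 1$, $\alpha>0$, and let $\mu$ be a positive Borel measure on $\mathbb{C}^n$ such that $\int_{\mathbb{C}^n}|K_{ph,\alpha}(z,w)|^2e^{-|w|^2/\alpha}\,d\mu(w)<\infty$ for every $z\in\mathbb{C}^n$. Then the Toeplitz operator $T_\mu$ is a compact operator on $\mathcal{PH}^2_\alpha(\mathbb{C}^n)$ if and only if $\mu$ is a vanishing $2$-Carleson measure.
   Context: $dA$ is Lebesgue measure on $\mathbb{C}^n$, and $z\bar w=\sum_{j=1}^n z_j\overline{w_j}$. A function $f:\mathbb{C}^n\to\mathbb{C}$ is pluriharmonic if $\partial^2 f/\partial z_j\partial\bar z_k=0$ for all $j,k$; equivalently $f=g+\bar h$ with $g,h$ entire. For $p>0$, $L^p_\alpha$ is the space of measurable $f$ on $\mathbb{C}^n$ with $\|f\|_{p,\alpha}^p=\frac{p^n}{(2\pi\alpha)^n}\int_{\mathbb{C}^n}|f(z)e^{-|z|^2/(2\alpha)}|^p\,dA(z)<\infty$, and $\mathcal{PH}^p_\alpha(\mathbb{C}^n)$ is the subspace of pluriharmonic functions in $L^p_\alpha$. $\mathcal{PH}^2_\alpha(\mathbb{C}^n)$ is a Hilbert space with inner product $\langle f,g\rangle=\frac{1}{(\alpha\pi)^n}\int f\bar g\,e^{-|z|^2/\alpha}\,dA$ and reproducing kernel $K_{ph,\alpha}(z,w)=e^{z\bar w/\alpha}+e^{\bar z w/\alpha}-1$. The Toeplitz operator with symbol $\mu$ is $T_\mu f(z)=\int_{\mathbb{C}^n}K_{ph,\alpha}(z,w)f(w)e^{-|w|^2/\alpha}\,d\mu(w)$,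 which is defined at least for $f$ in the linear span of the kernels $K_{ph,\alpha}(\cdot,w)$, $w\in\mathbb{C}^n$ (a dense subspace of $\mathcal{PH}^2_\alpha(\mathbb{C}^n)$); it is called bounded (resp. compact) if it extends to a bounded (resp. compact) operator on $\mathcal{PH}^2_\alpha(\mathbb{C}^n)$. For $1\le p<\infty$, $\mu$ is a vanishing $p$-Carleson measure if $\lim_{m\to\infty}\int_{\mathbb{C}^n}|f_m(z)e^{-|z|^2/(2\alpha)}|^p\,d\mu(z)=0$ for every sequence $(f_m)$ that is bounded in $\mathcal{PH}^p_\alpha(\mathbb{C}^n)$ and converges to $0$ uniformly on compact subsets of $\mathbb{C}^n$. *)

theory Defs
  imports "HOL-Analysis.Analysis"
begin

text \<open>
  Complex n-space is the type \<^typ>\<open>complex ^ 'n\<close>, with n = \<open>CARD('n)\<close>; its norm is the Euclidean one.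
\<close>

subsection \<open>Pluriharmonic functions\<close>

text \<open>
  Derivatives are real Frechet derivatives. The operators below are only meaningful at points of
  differentiability, which is why pluriharmonicity explicitly demands twice continuous
  (real) differentiability.
\<close>

definition wirtinger :: "'n::finite \<Rightarrow> (complex ^ 'n \<Rightarrow> complex) \<Rightarrow> complex ^ 'n \<Rightarrow> complex" where
  "wirtinger j f z =
     (frechet_derivative f (at z) (axis j 1) - \<i> * frechet_derivative f (at z) (axis j \<i>)) / 2"

definition wirtinger_bar :: "'n::finite \<Rightarrow> (complex ^ 'n \<Rightarrow> complex) \<Rightarrow> complex ^ 'n \<Rightarrow> complex" where
  "wirtinger_bar j f z =
     (frechet_derivative f (at z) (axis j 1) + \<i> * frechet_derivative f (at z) (axis j \<i>)) / 2"

definition C1 :: "(complex ^ 'n::finite \<Rightarrow> complex) \<Rightarrow> bool" where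
  "C1 f \<longleftrightarrow> (\<forall>z. f differentiable (at z)) \<and>
     (\<forall>v. continuous_on UNIV (\<lambda>z. frechet_derivative f (at z) v))"

definition C2 :: "(complex ^ 'n::finite \<Rightarrow> complex) \<Rightarrow> bool" where
  "C2 f \<longleftrightarrow> C1 f \<and> (\<forall>v. C1 (\<lambda>z. frechet_derivative f (at z) v))"

definition pluriharmonic :: "(complex ^ 'n::finite \<Rightarrow> complex) \<Rightarrow> bool" where
  "pluriharmonic f \<longleftrightarrow> C2 f \<and> (\<forall>j k z. wirtinger j (wirtinger_bar k f) z = 0)"


subsection \<open>The spaces \<open>L\<^sup>p\<close> with Gaussian weight and their pluriharmonic subspaces\<close>

definition weighted_pow :: "real \<Rightarrow> real \<Rightarrow> (complex ^ 'n::finite \<Rightarrow> complex) \<Rightarrow> complex ^ 'n \<Rightarrow> real" where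
  "weighted_pow p \<alpha> f z = cmod (f z * of_real (exp (- (norm z)\<^sup>2 / (2 * \<alpha>)))) powr p"

definition Lp_space :: "real \<Rightarrow> real \<Rightarrow> (complex ^ 'n::finite \<Rightarrow> complex) set" where
  "Lp_space p \<alpha> = {f \<in> borel_measurable lebesgue. integrable lebesgue (weighted_pow p \<alpha> f)}"

definition Lp_norm :: "real \<Rightarrow> real \<Rightarrow> (complex ^ 'n::finite \<Rightarrow> complex) \<Rightarrow> real" where
  "Lp_norm p \<alpha> f =
     (p ^ CARD('n) / (2 * pi * \<alpha>) ^ CARD('n) * (LINT z|lebesgue. weighted_pow p \<alpha> f z)) powr (1 / p)"

text \<open>
  Elements are functions, not almost-everywhere classes: pluriharmonic functions
  are continuous, so \<^const>\<open>Lp_norm\<close> separates them.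
\<close>

definition PH :: "real \<Rightarrow> real \<Rightarrow> (complex ^ 'n::finite \<Rightarrow> complex) set" where
  "PH p \<alpha> = {f \<in> Lp_space p \<alpha>. pluriharmonic f}"


subsection \<open>Kernel and Toeplitz operator\<close>

definition herm :: "complex ^ 'n::finite \<Rightarrow> complex ^ 'n \<Rightarrow> complex" where
  "herm z w = (\<Sum>j\<in>UNIV. z $ j * cnj (w $ j))"

definition K_ph :: "real \<Rightarrow> complex ^ 'n::finite \<Rightarrow> complex ^ 'n \<Rightarrow> complex" where
  "K_ph \<alpha> z w = exp (herm z w / of_real \<alpha>) + exp (herm w z / of_real \<alpha>) - 1"

definition kernel_span :: "real \<Rightarrow> (complex ^ 'n::finite \<Rightarrow> complex) set" where
  "kernel_span \<alpha> = {(\<lambda>z. \<Sum>w\<in>F. c w * K_ph \<alpha> z w) |F c. finite F}"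

definition toeplitz ::
  "real \<Rightarrow> (complex ^ 'n::finite) measure \<Rightarrow> (complex ^ 'n \<Rightarrow> complex) \<Rightarrow> complex ^ 'n \<Rightarrow> complex" where
  "toeplitz \<alpha> \<mu> f z = (LINT w|\<mu>. K_ph \<alpha> z w * f w * of_real (exp (- (norm w)\<^sup>2 / \<alpha>)))"

text \<open>
  Operators on \<^term>\<open>PH 2 \<alpha>\<close> are functions whose values outside that carrier are irrelevant.
\<close>

definition linear_operator_PH2 ::
  "real \<Rightarrow> ((complex ^ 'n::finite \<Rightarrow> complex) \<Rightarrow> (complex ^ 'n \<Rightarrow> complex)) \<Rightarrow> bool" where
  "linear_operator_PH2 \<alpha> T \<longleftrightarrow>
     (\<forall>f\<in>PH 2 \<alpha>. T f \<in> PH 2 \<alpha>) \<and>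
     (\<forall>f\<in>PH 2 \<alpha>. \<forall>g\<in>PH 2 \<alpha>. T (\<lambda>z. f z + g z) = (\<lambda>z. T f z + T g z)) \<and>
     (\<forall>f\<in>PH 2 \<alpha>. \<forall>c. T (\<lambda>z. c * f z) = (\<lambda>z. c * T f z))"

definition compact_operator_PH2 ::
  "real \<Rightarrow> ((complex ^ 'n::finite \<Rightarrow> complex) \<Rightarrow> (complex ^ 'n \<Rightarrow> complex)) \<Rightarrow> bool" where
  "compact_operator_PH2 \<alpha> T \<longleftrightarrow> linear_operator_PH2 \<alpha> T \<and>
     (\<forall>f. (\<forall>m. f m \<in> PH 2 \<alpha>) \<and> (\<exists>C. \<forall>m::nat. Lp_norm 2 \<alpha> (f m) \<le> C) \<longrightarrow>
       (\<exists>r. \<exists>g\<in>PH 2 \<alpha>. strict_mono (r :: nat \<Rightarrow> nat) \<and>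
          (\<lambda>m. Lp_norm 2 \<alpha> (\<lambda>z. T (f (r m)) z - g z)) \<longlonglongrightarrow> 0))"

definition toeplitz_compact :: "real \<Rightarrow> (complex ^ 'n::finite) measure \<Rightarrow> bool" where
  "toeplitz_compact \<alpha> \<mu> \<longleftrightarrow>
     (\<exists>T. compact_operator_PH2 \<alpha> T \<and> (\<forall>f\<in>kernel_span \<alpha>. T f = toeplitz \<alpha> \<mu> f))"


subsection \<open>Vanishing Carleson measures\<close>

text \<open>The nonnegative integral takes the value \<open>\<infinity>\<close> where the Bochner integral would be 0.\<close>

definition vanishing_carleson :: "real \<Rightarrow> real \<Rightarrow> (complex ^ 'n::finite) measure \<Rightarrow> bool" where
  "vanishing_carleson p \<alpha> \<mu> \<longleftrightarrow>
     (\<forall>f :: nat \<Rightarrow> complex ^ 'n \<Rightarrow> complex.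
        (\<forall>m. f m \<in> PH p \<alpha>) \<and> (\<exists>C. \<forall>m. Lp_norm p \<alpha> (f m) \<le> C) \<and>
        (\<forall>S. compact S \<longrightarrow> uniform_limit S f (\<lambda>_. 0) sequentially) \<longrightarrow>
        (\<lambda>m. \<integral>\<^sup>+ z. ennreal (weighted_pow p \<alpha> (f m) z) \<partial>\<mu>) \<longlonglongrightarrow> 0)"

end

theory Submission
  imports Defs "HOL-Complex_Analysis.Great_Picard" "HOL-Probability.Distributions"
begin

text \<open>
  Both properties are equivalent to \<open>\<mu> (ball w 1) \<rightarrow> 0\<close> as \<open>|w| \<rightarrow> \<infinity>\<close>. Each of them, tested on
  the normalized kernels \<open>k\<^sub>w\<close>, gives \<open>\<integral> |k\<^sub>w(u)|\<^sup>2 exp(-|u|\<^sup>2/\<alpha>) d\<mu>(u) \<rightarrow> 0\<close>; the kernel is real and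
  has zeros near \<open>w\<close>, but its values for \<open>w\<close> and a slightly shifted \<open>w'\<close> are never small at the same
  time, which yields the decay of \<open>\<mu> (ball w 1)\<close>. Conversely, the reproducing formula and the bound
  \<open>|K(z,w)| exp(-|z|\<^sup>2/2\<alpha>) exp(-|w|\<^sup>2/2\<alpha>) \<le> kap z w\<close> by a pair of Gaussians give, by Cauchy-Schwarz,
  \<open>\<integral> |f|\<^sup>2 exp(-|u|\<^sup>2/\<alpha>) d\<mu> \<le> D \<integral> M(w) |f(w)|\<^sup>2 exp(-|w|\<^sup>2/\<alpha>) dA(w)\<close> with \<open>M(w) = \<integral> kap u w d\<mu>(u)\<close>,
  and the same estimate bounds \<open>T f\<close> by the \<open>L\<^sup>2(\<mu>)\<close> norm of \<open>f\<close>. Since \<open>M\<close> is bounded and tends to \<open>0\<close>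
  at infinity, pointwise convergence of a bounded sequence is enough in both properties.
\<close>

subsection \<open>Gaussian integrals and isometries\<close>

text \<open>For the holomorphic kernel the weighted square of a normalized kernel is itself a
  Gaussian about \<open>w\<close>, so ball masses could be read off directly. The real kernel
  destroys this, which is why a second point \<open>w'\<close> enters. The second Gaussian in
  \<open>kap\<close>, centred at \<open>- w\<close>, is the price of the constant \<open>- 1\<close>
  in the kernel where \<open>z\<close> and \<open>w\<close> point in opposite directions.

  Hilbert space geometry enters through the reproducing formula, which is derived from mean values
  along complex lines. The norm estimates after it are Schur tests with weight \<open>kap\<close>,
  carried out in extended nonnegative integrals. Tonelli then asks for sigma-finiteness of
  \<open>\<mu>\<close>, which comes from the kernel hypothesis at \<open>z = 0\<close>, where the
  kernel is 1. Compactness is tested by evaluating the image of the kernel at \<open>w\<close> in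
  the point \<open>w\<close> itself, which stands for an inner product with the same kernel.
  Pointwise convergence suffices because point evaluations bound a norm-bounded sequence on every
  ball, while \<open>M\<close> is small outside a large one.\<close>

abbreviation (input) gauss :: "real \<Rightarrow> 'a::real_normed_vector \<Rightarrow> real" where
  "gauss a z \<equiv> exp (- (norm z)\<^sup>2 / a)"

lemma gaussian_nn_integral_finite:
  fixes a :: real
  assumes "a > 0"
  shows "(\<integral>\<^sup>+ x. ennreal (exp (- a * (norm x)\<^sup>2)) \<partial>(lborel :: 'a::euclidean_space measure)) < \<infinity>"
proof -
  \<comment> \<open>The deviation for which \<open>exp (- a * t\<^sup>2)\<close> is a multiple of a
    normal density.\<close>
  define \<sigma> where "\<sigma> = sqrt (1 / (2 * a))"
  have \<sigma>: "\<sigma> > 0" "\<sigma>\<^sup>2 = 1 / (2 * a)"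
    using assms by (auto simp: \<sigma>_def)
  have eq: "exp (- a * t\<^sup>2) = sqrt (2 * pi * \<sigma>\<^sup>2) * normal_density 0 \<sigma> t" for t
    using assms by (simp add: normal_density_def \<sigma>(2) field_simps)
  have "integrable lborel (\<lambda>t. exp (- a * t\<^sup>2))"
    unfolding eq using \<sigma> by (intro integrable_mult_right integrable_normal_density) auto
  then have fin: "(\<integral>\<^sup>+ t. ennreal (exp (- a * t\<^sup>2)) \<partial>lborel) < \<infinity>"
    unfolding integrable_iff_bounded by simp
  have "(norm x)\<^sup>2 = (\<Sum>b\<in>Basis. (x \<bullet> b)\<^sup>2)" for x :: 'a
    using euclidean_inner[of x x] by (simp only: power2_norm_eq_inner, simp only: power2_eq_square)
  then have "ennreal (exp (- a * (norm x)\<^sup>2)) = (\<Prod>b\<in>Basis. ennreal (exp (- a * (x \<bullet> b)\<^sup>2)))" for x :: 'a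
    by (simp add: sum_distrib_left sum_negf[symmetric] exp_sum prod_ennreal)
  then have "(\<integral>\<^sup>+ x. ennreal (exp (- a * (norm x)\<^sup>2)) \<partial>(lborel :: 'a measure))
      = (\<Prod>b\<in>(Basis :: 'a set). (\<integral>\<^sup>+ t. ennreal (exp (- a * t\<^sup>2)) \<partial>lborel))"
    by (simp only:) (rule nn_integral_lborel_prod, auto)
  also have "\<dots> < \<infinity>"
    using fin by (simp add: less_top power_less_top_ennreal)
  finally show ?thesis .
qed

text \<open>Half of the quadratic term pays for the linear one, and the other half keeps integrals
  convergent. The difference of the two sides is a perfect square.\<close>

lemma linear_minus_quadratic_le:
  fixes a r t :: real
  assumes "a > 0"
  shows "r * t - a * t\<^sup>2 \<le> r\<^sup>2 / (2 * a) - a / 2 * t\<^sup>2"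
proof -
  have "r\<^sup>2 / (2 * a) - a / 2 * t\<^sup>2 - (r * t - a * t\<^sup>2) = (r - a * t)\<^sup>2 / (2 * a)"
    using assms by (simp add: power2_eq_square field_simps)
  also have "\<dots> \<ge> 0" using assms by simp
  finally show ?thesis by simp
qed

lemma exp_linear_gaussian_nn_integral_finite:
  fixes a r :: real
  assumes "a > 0"
  shows "(\<integral>\<^sup>+ x. ennreal (exp (r * norm x - a * (norm x)\<^sup>2)) \<partial>(lborel :: 'a::euclidean_space measure)) < \<infinity>"
proof -
  have "(\<integral>\<^sup>+ x. ennreal (exp (r * norm x - a * (norm x)\<^sup>2)) \<partial>(lborel :: 'a measure))
     \<le> (\<integral>\<^sup>+ x. ennreal (exp (r\<^sup>2 / (2 * a))) * ennreal (exp (- (a/2) * (norm x)\<^sup>2)) \<partial>(lborel :: 'a measure))"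
    using linear_minus_quadratic_le[OF assms, of r]
    by (intro nn_integral_mono) (simp add: ennreal_mult[symmetric] exp_add[symmetric])
  also have "\<dots> = ennreal (exp (r\<^sup>2 / (2 * a))) * (\<integral>\<^sup>+ x. ennreal (exp (- (a/2) * (norm x)\<^sup>2)) \<partial>(lborel :: 'a measure))"
    by (intro nn_integral_cmult) auto
  also have "\<dots> < \<infinity>"
    using gaussian_nn_integral_finite[of "a/2", where ?'a = 'a] assms by (simp add: ennreal_mult_less_top)
  finally show ?thesis .
qed

lemma nn_integral_lborel_translate:
  fixes c :: "'a::euclidean_space"
  assumes [measurable]: "f \<in> borel_measurable borel"
  shows "(\<integral>\<^sup>+ x. f (c + x) \<partial>lborel) = (\<integral>\<^sup>+ x. f x \<partial>lborel)"
proof -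
  have "(\<integral>\<^sup>+ x. f x \<partial>lborel) = (\<integral>\<^sup>+ x. f x \<partial>distr lborel borel ((+) c))"
    by (simp add: lborel_distr_plus)
  also have "\<dots> = (\<integral>\<^sup>+ x. f (c + x) \<partial>lborel)"
    by (subst nn_integral_distr) auto
  finally show ?thesis ..
qed

text \<open>
  Uniqueness of translation invariant measures, by the Fubini argument in which
  \<open>\<integral>f(R x) dx \<integral>g(y) dy\<close> is rewritten with a Gaussian \<open>g\<close>, which is invariant under \<open>R\<close>.
\<close>

lemma nn_integral_lborel_isometry:
  fixes R S :: "'a::euclidean_space \<Rightarrow> 'a"
  assumes "linear R" and norm_R: "\<And>x. norm (R x) = norm x" and RS: "\<And>y. R (S y) = y"
    and [measurable]: "f \<in> borel_measurable borel"
  shows "(\<integral>\<^sup>+ x. f (R x) \<partial>lborel) = (\<integral>\<^sup>+ x. f x \<partial>lborel)"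
proof -
  interpret R: linear R by fact
  have [measurable]: "R \<in> borel_measurable borel"
    using \<open>linear R\<close> by (intro borel_measurable_continuous_onI linear_continuous_on linear_conv_bounded_linear[THEN iffD1])
  define g :: "'a \<Rightarrow> ennreal" where "g x = ennreal (exp (- 1 * (norm x)\<^sup>2))" for x
  have [measurable]: "g \<in> borel_measurable borel" unfolding g_def by measurable
  define c where "c = (\<integral>\<^sup>+ x. g x \<partial>lborel)"
  have c_fin: "c < \<infinity>"
    unfolding c_def g_def by (rule gaussian_nn_integral_finite) simp
  have c_pos: "c \<noteq> 0"
  proof
    assume "c = 0"
    then have "AE x in (lborel :: 'a measure). g x = 0" unfolding c_def by (subst (asm) nn_integral_0_iff_AE) auto
    then have "AE x in (lborel :: 'a measure). False" by (simp add: g_def)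
    then show False using ae_filter_eq_bot_iff[of "lborel :: 'a measure"] by (simp add: trivial_limit_def)
  qed
  \<comment> \<open>The right inverse gives \<open>R x + y = R (S y + x)\<close>, so a translation
    after \<open>R\<close> is a translation before it.\<close>
  have inv: "(\<integral>\<^sup>+ x. h (R x + y) \<partial>lborel) = (\<integral>\<^sup>+ x. h (R x) \<partial>lborel)"
    if [measurable]: "h \<in> borel_measurable borel" for h :: "'a \<Rightarrow> ennreal" and y
  proof -
    have "(\<integral>\<^sup>+ x. h (R x) \<partial>lborel) = (\<integral>\<^sup>+ x. h (R (S y + x)) \<partial>lborel)"
      by (rule nn_integral_lborel_translate[symmetric]) measurable
    then show ?thesis by (simp add: R.add RS add.commute)
  qed
  have sym: "g (R x - y) = g (y - R x)" for x y
    by (simp add: g_def norm_minus_commute)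
  have "(\<integral>\<^sup>+ x. f (R x) \<partial>lborel) * c = (\<integral>\<^sup>+ y. (\<integral>\<^sup>+ x. f (R x) \<partial>lborel) * g y \<partial>lborel)"
    unfolding c_def by (rule nn_integral_cmult[symmetric]) measurable
  also have "\<dots> = (\<integral>\<^sup>+ y. (\<integral>\<^sup>+ x. f (R x + y) * g y \<partial>lborel) \<partial>lborel)"
    by (intro nn_integral_cong) (simp add: nn_integral_multc inv)
  also have "\<dots> = (\<integral>\<^sup>+ x. (\<integral>\<^sup>+ y. f (R x + y) * g y \<partial>lborel) \<partial>lborel)"
    by (rule lborel_pair.Fubini') measurable
  also have "\<dots> = (\<integral>\<^sup>+ x. (\<integral>\<^sup>+ y. f y * g (R x - y) \<partial>lborel) \<partial>lborel)"
  proof (rule nn_integral_cong)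
    fix x
    have "(\<integral>\<^sup>+ y. f (R x + y) * g y \<partial>lborel) = (\<integral>\<^sup>+ y. f (R x + y) * g (y + R x - R x) \<partial>lborel)" by simp
    also have "\<dots> = (\<integral>\<^sup>+ y. (\<lambda>v. f v * g (v - R x)) (R x + y) \<partial>lborel)" by (simp add: add.commute)
    also have "\<dots> = (\<integral>\<^sup>+ y. f y * g (y - R x) \<partial>lborel)" by (rule nn_integral_lborel_translate) measurable
    finally show "(\<integral>\<^sup>+ y. f (R x + y) * g y \<partial>lborel) = (\<integral>\<^sup>+ y. f y * g (R x - y) \<partial>lborel)"
      by (simp add: sym)
  qed
  also have "\<dots> = (\<integral>\<^sup>+ y. (\<integral>\<^sup>+ x. f y * g (R x - y) \<partial>lborel) \<partial>lborel)"
    by (rule lborel_pair.Fubini') measurable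
  also have "\<dots> = (\<integral>\<^sup>+ y. f y * (\<integral>\<^sup>+ x. g (R x + (- y)) \<partial>lborel) \<partial>lborel)"
    by (intro nn_integral_cong) (simp add: nn_integral_cmult)
  also have "\<dots> = (\<integral>\<^sup>+ y. f y * c \<partial>lborel)"
    by (subst inv, measurable) (simp add: c_def g_def norm_R)
  also have "\<dots> = (\<integral>\<^sup>+ y. f y \<partial>lborel) * c"
    by (rule nn_integral_multc) measurable
  finally show ?thesis
    using c_fin c_pos by (auto simp: mult.commute[of _ c] ennreal_mult_cancel_left)
qed

lemma lborel_distr_isometry:
  fixes R S :: "'a::euclidean_space \<Rightarrow> 'a"
  assumes "linear R" "\<And>x. norm (R x) = norm x" "\<And>y. R (S y) = y"
  shows "distr lborel borel R = lborel"
proof (rule measure_eqI)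
  have [measurable]: "R \<in> borel_measurable borel"
    using \<open>linear R\<close> by (intro borel_measurable_continuous_onI linear_continuous_on linear_conv_bounded_linear[THEN iffD1])
  fix A assume "A \<in> sets (distr lborel borel R)"
  then have A[measurable]: "A \<in> sets borel" by simp
  have "emeasure (distr lborel borel R) A = (\<integral>\<^sup>+ x. indicator A x \<partial>distr lborel borel R)"
    using A by (subst nn_integral_indicator) auto
  also have "\<dots> = (\<integral>\<^sup>+ x. indicator A (R x) \<partial>lborel)"
    by (rule nn_integral_distr) auto
  also have "\<dots> = (\<integral>\<^sup>+ x. indicator A x \<partial>lborel)"
    by (rule nn_integral_lborel_isometry[OF assms]) measurable
  finally show "emeasure (distr lborel borel R) A = emeasure lborel A"
    using A by (subst (asm) nn_integral_indicator) auto
qed simp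

subsection \<open>Slices and mean values of pluriharmonic functions\<close>

lemma linear_vec_scale: "linear (\<lambda>l. l *s (u :: complex ^ 'n::finite))"
  by (rule linearI) (auto simp: vec_eq_iff algebra_simps)

lemma linear_scale_vec: "linear (\<lambda>u :: complex ^ 'n::finite. l *s u)"
  by (rule linearI) (auto simp: vec_eq_iff algebra_simps)

lemma norm_vec_scale: "norm (l *s z) = cmod l * norm z" for z :: "complex ^ 'n::finite"
  by (simp add: norm_vec_def norm_mult L2_set_right_distrib)

text \<open>A real linear map is a complex linear one plus an antilinear one; the two coefficients
  are the expressions that define \<open>wirtinger\<close> and \<open>wirtinger_bar\<close>.\<close>

lemma linear_wirtinger_expansion:
  fixes D :: "complex ^ 'n::finite \<Rightarrow> complex"
  assumes "linear D"
  shows "D u = (\<Sum>j\<in>UNIV. u $ j * ((D (axis j 1) - \<i> * D (axis j \<i>)) / 2)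
              + cnj (u $ j) * ((D (axis j 1) + \<i> * D (axis j \<i>)) / 2))"
proof -
  interpret linear D by fact
  have "u = (\<Sum>j\<in>UNIV. Re (u $ j) *\<^sub>R axis j 1 + Im (u $ j) *\<^sub>R axis j \<i>)"
    by (simp add: vec_eq_iff axis_def if_distrib complex_eq_iff cong: if_cong)
  then have "D u = D (\<Sum>j\<in>UNIV. Re (u $ j) *\<^sub>R axis j 1 + Im (u $ j) *\<^sub>R axis j \<i>)"
    by (rule arg_cong)
  also have "\<dots> = (\<Sum>j\<in>UNIV. Re (u $ j) *\<^sub>R D (axis j 1) + Im (u $ j) *\<^sub>R D (axis j \<i>))"
    by (simp only: sum add scale)
  also have "\<dots> = (\<Sum>j\<in>UNIV. u $ j * ((D (axis j 1) - \<i> * D (axis j \<i>)) / 2)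
              + cnj (u $ j) * ((D (axis j 1) + \<i> * D (axis j \<i>)) / 2))"
    by (intro sum.cong) (auto simp: complex_eq_iff field_simps)
  finally show ?thesis .
qed

lemma frechet_derivative_wirtinger:
  fixes f :: "complex ^ 'n::finite \<Rightarrow> complex"
  assumes "f differentiable (at z)"
  shows "frechet_derivative f (at z) u = (\<Sum>j\<in>UNIV. u $ j * wirtinger j f z + cnj (u $ j) * wirtinger_bar j f z)"
  unfolding wirtinger_def wirtinger_bar_def
  by (rule linear_wirtinger_expansion[OF linear_frechet_derivative[OF assms]])

lemma C2_differentiable_wirtinger_bar:
  assumes "C2 f"
  shows "wirtinger_bar k f differentiable (at z)"
proof -
  have "(\<lambda>z. frechet_derivative f (at z) v) differentiable (at z)" for v
    using assms by (auto simp: C2_def C1_def)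
  then show ?thesis
    unfolding wirtinger_bar_def[abs_def] by (intro differentiable_add differentiable_mult derivative_intros) auto
qed

text \<open>Working on one complex line at a time replaces the decomposition in several variables by
  a primitive in one variable. Since the mixed derivatives vanish, the antiholomorphic derivative of
  \<open>f\<close> along the line has an antilinear differential, so its conjugate \<open>Q\<close>
  is entire. A primitive \<open>B\<close> of \<open>Q\<close> then carries the antiholomorphic part
  of the slice.\<close>

lemma pluriharmonic_slice:
  fixes f :: "complex ^ 'n::finite \<Rightarrow> complex"
  assumes "pluriharmonic f"
  obtains A B where "A holomorphic_on UNIV" "B holomorphic_on UNIV"
    "\<And>l. f (z + l *s u) = A l + cnj (B l)"
proof -
  have C2: "C2 f" and wb0: "wirtinger j (wirtinger_bar k f) \<zeta> = 0" for j k \<zeta>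
    using assms by (auto simp: pluriharmonic_def)
  have df: "f differentiable (at \<zeta>)" for \<zeta>
    using C2 by (auto simp: C2_def C1_def)
  define S where "S l = z + l *s u" for l
  have S: "(S has_derivative (\<lambda>h. h *s u)) (at l)" for l
    unfolding S_def using linear_vec_scale[of u]
    by (auto intro!: derivative_eq_intros bounded_linear_imp_has_derivative simp: linear_conv_bounded_linear)
  define Q where "Q l = cnj (\<Sum>k\<in>UNIV. cnj (u $ k) * wirtinger_bar k f (S l))" for l
  have "(Q has_field_derivative cnj (\<Sum>k\<in>UNIV. cnj (u $ k) * (\<Sum>j\<in>UNIV. cnj (u $ j) * wirtinger_bar j (wirtinger_bar k f) (S l)))) (at l)" for l
  proof -
    have "((\<lambda>l. wirtinger_bar k f (S l)) has_derivative
        (\<lambda>h. frechet_derivative (wirtinger_bar k f) (at (S l)) (h *s u))) (at l)" for k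
      using has_derivative_compose[OF S frechet_derivative_works[THEN iffD1, OF C2_differentiable_wirtinger_bar[OF C2]]]
      by simp
    then have "((\<lambda>l. wirtinger_bar k f (S l)) has_derivative
        (\<lambda>h. cnj h * (\<Sum>j\<in>UNIV. cnj (u $ j) * wirtinger_bar j (wirtinger_bar k f) (S l)))) (at l)" for k
      by (simp add: frechet_derivative_wirtinger C2_differentiable_wirtinger_bar[OF C2] wb0 sum_distrib_left mult.assoc)
    then have "(Q has_derivative (\<lambda>h. cnj (\<Sum>k\<in>UNIV. cnj (u $ k) *
         (cnj h * (\<Sum>j\<in>UNIV. cnj (u $ j) * wirtinger_bar j (wirtinger_bar k f) (S l)))))) (at l)"
      unfolding Q_def[abs_def]
      by (intro has_derivative_cnj has_derivative_sum has_derivative_mult_right)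
    then show ?thesis
      unfolding has_field_derivative_def
      by (rule has_derivative_eq_rhs) (auto simp: sum_distrib_left sum_distrib_right mult_ac)
  qed
  then have "Q field_differentiable (at l)" for l
    by (auto simp: field_differentiable_def)
  moreover from this have "continuous_on UNIV Q"
    by (intro continuous_at_imp_continuous_on) (auto simp: field_differentiable_imp_continuous_at)
  ultimately obtain B where B: "\<And>l. (B has_field_derivative Q l) (at l)"
    using holomorphic_convex_primitive[of UNIV "{}" Q] by auto
  \<comment> \<open>The antilinear part of the derivative of \<open>f\<close> along the line is
    \<open>cnj (Q l * h)\<close>, which is also the derivative of \<open>cnj (B l)\<close>; what
    remains is complex linear in \<open>h\<close>.\<close>
  define A where "A l = f (S l) - cnj (B l)" for l
  have "(A has_field_derivative (\<Sum>j\<in>UNIV. u $ j * wirtinger j f (S l))) (at l)" for l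
  proof -
    have "(A has_derivative (\<lambda>h. frechet_derivative f (at (S l)) (h *s u) - cnj (Q l * h))) (at l)"
      unfolding A_def[abs_def]
      using has_derivative_compose[OF S frechet_derivative_works[THEN iffD1, OF df]] B[of l]
      by (intro has_derivative_diff has_derivative_cnj) (auto simp: has_field_derivative_def)
    then show ?thesis
      unfolding has_field_derivative_def
      by (rule has_derivative_eq_rhs)
         (auto simp: frechet_derivative_wirtinger[OF df] Q_def sum.distrib sum_distrib_left sum_distrib_right mult_ac)
  qed
  then have "A holomorphic_on UNIV" "B holomorphic_on UNIV"
    using B by (auto simp: holomorphic_on_def field_differentiable_def)
  then show ?thesis
    by (rule that) (simp add: A_def S_def)
qed

lemma pluriharmonic_continuous:
  assumes "pluriharmonic f"
  shows "continuous_on UNIV f"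
  using assms by (auto simp: pluriharmonic_def C2_def C1_def intro!: differentiable_imp_continuous_on differentiable_at_imp_differentiable_on)

lemma holomorphic_circle_mean:
  assumes "A holomorphic_on UNIV"
  shows "((\<lambda>t. A (exp (2 * of_real pi * \<i> * of_real t))) has_integral A 0) {0..1}"
proof -
  have "((\<lambda>u. A u / (u - 0)) has_contour_integral (2 * of_real pi * \<i> * A 0)) (circlepath 0 1)"
    by (rule Cauchy_integral_circlepath_simple) (use assms in \<open>auto intro: holomorphic_on_subset\<close>)
  then have "((\<lambda>t. A (circlepath 0 1 t) / circlepath 0 1 t * (2 * pi * \<i> * 1 * exp (2 * of_real pi * \<i> * t)))
      has_integral (2 * of_real pi * \<i> * A 0)) {0..1}"
    unfolding has_contour_integral_def
    by (rule has_integral_eq[rotated]) (auto simp: vector_derivative_circlepath01)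
  then have "((\<lambda>t. 2 * of_real pi * \<i> * A (exp (2 * of_real pi * \<i> * of_real t)))
      has_integral (2 * of_real pi * \<i> * A 0)) {0..1}"
    by (rule has_integral_eq[rotated]) (auto simp: circlepath_def part_circlepath_def linepath_def algebra_simps)
  then have "((\<lambda>t. 1 / (2 * of_real pi * \<i>) * (2 * of_real pi * \<i> * A (exp (2 * of_real pi * \<i> * of_real t))))
      has_integral 1 / (2 * of_real pi * \<i>) * (2 * of_real pi * \<i> * A 0)) {0..1}"
    by (rule has_integral_mult_right)
  then show ?thesis by simp
qed

text \<open>The vector \<open>u\<close> carries both the complex line and the radius, so Cauchy's
  formula on the unit circle about 0 covers all these circles.\<close>

lemma pluriharmonic_circle_mean:
  assumes "pluriharmonic f"
  shows "((\<lambda>t. f (z + exp (2 * of_real pi * \<i> * of_real t) *s u)) has_integral f z) {0..1}"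
proof -
  obtain A B where *: "A holomorphic_on UNIV" "B holomorphic_on UNIV" "\<And>l. f (z + l *s u) = A l + cnj (B l)"
    using pluriharmonic_slice[OF assms] by blast
  have "((\<lambda>t. cnj (B (exp (2 * of_real pi * \<i> * of_real t)))) has_integral cnj (B 0)) {0..1}"
    using holomorphic_circle_mean[OF *(2)] by (simp add: has_integral_cnj[unfolded o_def])
  from has_integral_add[OF holomorphic_circle_mean[OF *(1)] this] *(3)[of 0]
  show ?thesis by (simp add: *(3))
qed

text \<open>Lebesgue measure and the Gaussian are invariant under multiplication of \<open>u\<close>
  by a unimodular scalar. The integral may therefore be averaged over all these rotations, and
  Fubini moves the average inside, where it is a circle mean equal to \<open>f z\<close>.\<close>

lemma pluriharmonic_gaussian_mean:
  fixes f :: "complex ^ 'n::finite \<Rightarrow> complex"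
  assumes f: "pluriharmonic f"
    and int: "integrable lborel (\<lambda>u. f (z + u) * of_real (exp (- a * (norm u)\<^sup>2)))"
  shows "(LINT u|lborel. f (z + u) * of_real (exp (- a * (norm u)\<^sup>2)))
     = f z * (LINT u|(lborel :: (complex ^ 'n) measure). of_real (exp (- a * (norm u)\<^sup>2)))"
proof -
  have cf: "continuous_on UNIV f" by (rule pluriharmonic_continuous[OF f])
  then have [measurable]: "f \<in> borel_measurable borel" by (rule borel_measurable_continuous_onI)
  define e where "e t = exp (2 * of_real pi * \<i> * complex_of_real t)" for t
  define R where "R t u = e t *s u" for t and u :: "complex ^ 'n"
  have ne: "cmod (e t) = 1" for t by (simp add: e_def)
  have distr: "distr lborel borel (R t) = lborel" for t
  proof (rule lborel_distr_isometry)
    show "linear (R t)" unfolding R_def by (rule linear_scale_vec)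
    show "norm (R t x) = norm x" for x
      by (simp add: R_def norm_vec_scale ne)
    show "R t (inverse (e t) *s y) = y" for y
      by (auto simp: R_def vec_eq_iff e_def)
  qed
  have contR: "continuous_on UNIV (\<lambda>p. R (fst p) (snd p))"
    unfolding R_def e_def vector_scalar_mult_def by (intro continuous_intros)
  then have [measurable]: "(\<lambda>p. R (fst p) (snd p)) \<in> borel_measurable (lborel \<Otimes>\<^sub>M lborel)"
    by (auto simp: lborel_prod intro: borel_measurable_continuous_onI)
  have [measurable]: "R t \<in> borel_measurable borel" for t
    using linear_scale_vec unfolding R_def
    by (intro borel_measurable_continuous_onI linear_continuous_on linear_conv_bounded_linear[THEN iffD1])
  define g where "g u = complex_of_real (exp (- a * (norm u)\<^sup>2))" for u :: "complex ^ 'n"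
  have [measurable]: "g \<in> borel_measurable borel" unfolding g_def by measurable
  have gR: "g (R t u) = g u" for t u
    by (simp add: g_def R_def norm_vec_scale ne)
  define I where "I = (LINT u|lborel. f (z + u) * g u)"
  have I: "(LINT u|lborel. f (z + R t u) * g u) = I" for t
  proof -
    have "I = (LINT u|distr lborel borel (R t). f (z + u) * g u)" by (simp add: distr I_def)
    also have "\<dots> = (LINT u|lborel. f (z + R t u) * g (R t u))" by (rule integral_distr) measurable
    finally show ?thesis by (simp add: gR)
  qed
  \<comment> \<open>Cutting \<open>t\<close> off to an interval of length one turns the average over
    rotations into an integral over the line, in a form to which Fubini for \<open>lborel\<close>
    applies.\<close>
  define F where "F t u = indicat_real {0..1} t *\<^sub>R (f (z + R t u) * g u)" for t u
  have [measurable]: "(\<lambda>p. F (fst p) (snd p)) \<in> borel_measurable (lborel \<Otimes>\<^sub>M lborel)"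
    unfolding F_def by measurable
  \<comment> \<open>By rotation invariance the inner integral is the same for all \<open>t\<close>
    in the interval, so joint integrability reduces to the given integrability in
    \<open>u\<close>.\<close>
  have bound: "(\<integral>\<^sup>+ u. ennreal (norm (F t u)) \<partial>lborel) = indicator {0..1} t * (\<integral>\<^sup>+ u. ennreal (norm (f (z + u) * g u)) \<partial>lborel)" for t
  proof -
    have "(\<integral>\<^sup>+ u. ennreal (norm (f (z + u) * g u)) \<partial>lborel) = (\<integral>\<^sup>+ u. ennreal (norm (f (z + u) * g u)) \<partial>distr lborel borel (R t))"
      by (simp add: distr)
    also have "\<dots> = (\<integral>\<^sup>+ u. ennreal (norm (f (z + R t u) * g (R t u))) \<partial>lborel)"
      by (rule nn_integral_distr) measurable
    finally show ?thesis
      by (auto simp: F_def gR indicator_def)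
  qed
  have fin: "(\<integral>\<^sup>+ u. ennreal (norm (f (z + u) * g u)) \<partial>lborel) < \<infinity>"
    using int by (simp add: integrable_iff_bounded g_def)
  have Fint: "integrable (lborel \<Otimes>\<^sub>M lborel) (\<lambda>(t, u). F t u)"
  proof (subst integrable_iff_bounded, intro conjI)
    have "(\<integral>\<^sup>+ p. ennreal (norm (F (fst p) (snd p))) \<partial>(lborel \<Otimes>\<^sub>M lborel)) = (\<integral>\<^sup>+ t. (\<integral>\<^sup>+ u. ennreal (norm (F t u)) \<partial>lborel) \<partial>lborel)"
      by (subst lborel.nn_integral_fst[symmetric]) auto
    also have "\<dots> = (\<integral>\<^sup>+ u. ennreal (norm (f (z + u) * g u)) \<partial>lborel)"
      unfolding bound by (subst nn_integral_multc) auto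
    finally show "(\<integral>\<^sup>+ p. ennreal (norm (case p of (t, u) \<Rightarrow> F t u)) \<partial>(lborel \<Otimes>\<^sub>M lborel)) < \<infinity>"
      using fin by (simp add: case_prod_beta)
  qed (simp add: case_prod_beta)
  have inner: "(LINT t|lborel. F t u) = f z * g u" for u
  proof -
    have cont: "continuous_on {0..1} (\<lambda>t. f (z + R t u))"
      unfolding R_def e_def vector_scalar_mult_def
      by (intro continuous_on_compose2[OF cf] continuous_intros) auto
    have "set_integrable lborel {0..1} (\<lambda>t. f (z + R t u))"
      unfolding set_integrable_def by (rule borel_integrable_compact[OF compact_Icc cont])
    then have "(LINT t:{0..1}|lborel. f (z + R t u)) = integral {0..1} (\<lambda>t. f (z + R t u))"
      by (rule set_borel_integral_eq_integral)
    also have "\<dots> = f z"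
      using pluriharmonic_circle_mean[OF f] unfolding R_def e_def by (rule integral_unique)
    finally show ?thesis
      by (simp add: F_def set_lebesgue_integral_def mult_scaleR_left[symmetric] del: mult_scaleR_left)
  qed
  have "I = (LINT t|lborel. indicat_real {0..1::real} t) *\<^sub>R I" by simp
  also have "\<dots> = (LINT t|lborel. indicat_real {0..1::real} t *\<^sub>R I)"
    by (rule integral_scaleR_left[symmetric]) (simp add: integrable_real_indicator)
  also have "\<dots> = (LINT t|lborel. (LINT u|lborel. F t u))"
    by (simp add: F_def I)
  also have "\<dots> = (LINT u|lborel. (LINT t|lborel. F t u))"
    using lborel_pair.Fubini_integral[OF Fint] by simp
  also have "\<dots> = f z * (LINT u|lborel. g u)"
    by (simp add: inner)
  finally show ?thesis by (simp add: I_def g_def)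
qed

subsection \<open>Exponential integrals\<close>

lemma norm_herm_le: "cmod (herm z w) \<le> norm z * norm w"
proof -
  have "cmod (herm z w) \<le> (\<Sum>j\<in>UNIV. \<bar>norm (z $ j)\<bar> * \<bar>norm (w $ j)\<bar>)"
    unfolding herm_def by (rule order_trans[OF norm_sum]) (simp add: norm_mult)
  also have "\<dots> \<le> norm z * norm w"
    unfolding norm_vec_def by (rule L2_set_mult_ineq)
  finally show ?thesis .
qed

lemma Re_herm: "Re (herm z w) = z \<bullet> w"
  by (simp add: herm_def inner_vec_def inner_complex_def)

lemma cnj_herm: "cnj (herm z w) = herm w z"
  by (simp add: herm_def mult.commute)

lemma herm_scale_left: "herm (l *s z) w = l * herm z w"
  by (simp add: herm_def sum_distrib_left mult_ac)

text \<open>\<open>herm\<close> is sesquilinear over the complex numbers, but derivatives here are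
  real, and over the reals it is bilinear. Flipping the arguments then covers the conjugate exponent
  too.\<close>

lemma bounded_bilinear_herm: "bounded_bilinear (\<lambda>z w :: complex ^ 'n::finite. herm z w / of_real \<alpha>)"
proof
  show "\<exists>K. \<forall>a b :: complex ^ 'n. cmod (herm a b / of_real \<alpha>) \<le> norm a * norm b * K"
    using norm_herm_le by (intro exI[of _ "1 / \<bar>\<alpha>\<bar>"]) (auto simp: norm_divide intro!: divide_right_mono)
  fix a b :: "complex ^ 'n" and r :: real
  show "herm (r *\<^sub>R a) b / of_real \<alpha> = r *\<^sub>R (herm a b / of_real \<alpha>)"
    "herm a (r *\<^sub>R b) / of_real \<alpha> = r *\<^sub>R (herm a b / of_real \<alpha>)"
    by (simp_all add: herm_def sum_distrib_left mult_ac scaleR_conv_of_real[where 'a = complex])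
qed (simp_all add: herm_def algebra_simps sum.distrib add_divide_distrib)

text \<open>A class stable under what differentiation below the integral produces, namely factors
  \<open>l v w\<close> and \<open>exp (l v w)\<close> with \<open>l\<close> bounded bilinear. Asking
  for all \<open>r\<close> makes the integrals converge at every parameter value.\<close>

definition exp_moments :: "('a::euclidean_space) measure \<Rightarrow> ('a \<Rightarrow> complex) \<Rightarrow> bool" where
  "exp_moments \<nu> h \<longleftrightarrow> sets \<nu> = sets borel \<and> h \<in> borel_measurable borel \<and>
     (\<forall>r. integrable \<nu> (\<lambda>w. exp (r * norm w) * cmod (h w)))"

lemma exp_moments_integrable:
  assumes h: "exp_moments \<nu> h" and g: "g \<in> borel_measurable borel"
    and le: "\<And>w. cmod (g w) \<le> K * (exp (r * norm w) * cmod (h w))"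
  shows "integrable \<nu> g"
proof -
  have "integrable \<nu> (\<lambda>w. K * (exp (r * norm w) * cmod (h w)))"
    using h by (auto simp: exp_moments_def)
  then show ?thesis
  proof (rule Bochner_Integration.integrable_bound)
    have [measurable_cong]: "sets \<nu> = sets borel" using h by (simp add: exp_moments_def)
    show "g \<in> borel_measurable \<nu>" using g by measurable
    show "AE w in \<nu>. norm (g w) \<le> norm (K * (exp (r * norm w) * cmod (h w)))"
      using order_trans[OF le abs_ge_self] by (intro AE_I2) simp
  qed
qed

lemma exp_moments_dominated:
  assumes h: "exp_moments \<nu> h" and g: "g \<in> borel_measurable borel"
    and le: "\<And>w. cmod (g w) \<le> K * (exp (s * norm w) * cmod (h w))"
  shows "exp_moments \<nu> g"
  unfolding exp_moments_def
proof (intro conjI allI)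
  show "sets \<nu> = sets borel" "g \<in> borel_measurable borel" using h g by (auto simp: exp_moments_def)
  fix r
  have "integrable \<nu> (\<lambda>w. of_real (exp (r * norm w) * cmod (g w)) :: complex)"
  proof (rule exp_moments_integrable[OF h])
    show "cmod (of_real (exp (r * norm w) * cmod (g w))) \<le> K * (exp ((r + s) * norm w) * cmod (h w))" for w
      using mult_left_mono[OF le[of w], of "exp (r * norm w)"]
      by (simp add: norm_mult exp_add ring_distribs mult_ac)
  qed (use g in measurable)
  then show "integrable \<nu> (\<lambda>w. exp (r * norm w) * cmod (g w))"
    using integrable_Re by fastforce
qed

lemma exp_moments_cong: "exp_moments \<nu> g \<Longrightarrow> (\<And>w. h w = g w) \<Longrightarrow> exp_moments \<nu> h"
  by (metis ext)

lemma exp_moments_lincomb: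
  assumes g: "exp_moments \<nu> g" and h: "exp_moments \<nu> h"
  shows "exp_moments \<nu> (\<lambda>w. a * g w + b * h w)"
  unfolding exp_moments_def
proof (intro conjI allI)
  have [measurable]: "g \<in> borel_measurable borel" "h \<in> borel_measurable borel" and [measurable_cong]: "sets \<nu> = sets borel"
    using g h by (auto simp: exp_moments_def)
  show "sets \<nu> = sets borel" by fact
  show "(\<lambda>w. a * g w + b * h w) \<in> borel_measurable borel" by measurable
  fix r
  have "integrable \<nu> (\<lambda>w. cmod a * (exp (r * norm w) * cmod (g w)) + cmod b * (exp (r * norm w) * cmod (h w)))"
    using g h by (auto simp: exp_moments_def)
  then show "integrable \<nu> (\<lambda>w. exp (r * norm w) * cmod (a * g w + b * h w))"
  proof (rule Bochner_Integration.integrable_bound)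
    have "exp (r * norm w) * cmod (a * g w + b * h w)
        \<le> exp (r * norm w) * (cmod a * cmod (g w) + cmod b * cmod (h w))" for w
      using norm_triangle_ineq[of "a * g w" "b * h w"] by (intro mult_left_mono) (auto simp: norm_mult)
    then show "AE w in \<nu>. norm (exp (r * norm w) * cmod (a * g w + b * h w))
        \<le> norm (cmod a * (exp (r * norm w) * cmod (g w)) + cmod b * (exp (r * norm w) * cmod (h w)))"
      by (simp add: algebra_simps)
  qed measurable
qed

lemma bounded_bilinear_measurable:
  assumes "bounded_bilinear l"
  shows "l v \<in> borel_measurable borel"
  by (intro borel_measurable_continuous_onI linear_continuous_on bounded_bilinear.bounded_linear_right[OF assms])

lemma exp_moments_mult:
  fixes l :: "'a::real_normed_vector \<Rightarrow> 'b::euclidean_space \<Rightarrow> complex"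
  assumes l: "bounded_bilinear l" and h: "exp_moments \<nu> h"
  shows "exp_moments \<nu> (\<lambda>w. l v w * h w)"
proof -
  obtain C where C: "C > 0" "\<And>a b. norm (l a b) \<le> norm a * norm b * C"
    using bounded_bilinear.pos_bounded[OF l] by blast
  show ?thesis
  proof (rule exp_moments_dominated[OF h])
    show "(\<lambda>w. l v w * h w) \<in> borel_measurable borel"
      using h bounded_bilinear_measurable[OF l] by (auto simp: exp_moments_def)
    fix w :: 'b
    have "norm w \<le> exp (norm w)"
      using exp_ge_add_one_self[of "norm w"] by linarith
    then have "norm v * norm w * C \<le> norm v * exp (norm w) * C"
      using C(1) by (intro mult_left_mono mult_right_mono) auto
    then have "norm (l v w) \<le> (norm v * C) * exp (norm w)"
      using C(2)[of v w] by (simp add: mult_ac)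
    then show "cmod (l v w * h w) \<le> (norm v * C) * (exp (1 * norm w) * cmod (h w))"
      by (simp add: norm_mult mult_right_mono mult.assoc[symmetric])
  qed
qed

lemma exp_moments_exp:
  fixes l :: "'a::real_normed_vector \<Rightarrow> 'b::euclidean_space \<Rightarrow> complex"
  assumes l: "bounded_bilinear l" and h: "exp_moments \<nu> h"
  shows "exp_moments \<nu> (\<lambda>w. exp (l v w) * h w)"
proof -
  obtain C where C: "C > 0" "\<And>a b. norm (l a b) \<le> norm a * norm b * C"
    using bounded_bilinear.pos_bounded[OF l] by blast
  show ?thesis
  proof (rule exp_moments_dominated[OF h])
    show "(\<lambda>w. exp (l v w) * h w) \<in> borel_measurable borel"
    proof -
      have [measurable]: "h \<in> borel_measurable borel" "l v \<in> borel_measurable borel"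
        using h bounded_bilinear_measurable[OF l] by (auto simp: exp_moments_def)
      show ?thesis by measurable
    qed
    fix w :: 'b
    have "cmod (exp (l v w)) \<le> exp (cmod (l v w))" by (rule norm_exp)
    also have "\<dots> \<le> exp (norm v * C * norm w)" using C(2)[of v w] by (simp add: mult_ac)
    finally show "cmod (exp (l v w) * h w) \<le> 1 * (exp (norm v * C * norm w) * cmod (h w))"
      by (simp add: norm_mult mult_right_mono)
  qed
qed

lemma exp_moments_imp_integrable: "exp_moments \<nu> h \<Longrightarrow> integrable \<nu> h"
  by (rule exp_moments_integrable[where K = 1 and r = 0]) (auto simp: exp_moments_def)

text \<open>A Laplace transform with general exponent. The exponents \<open>herm z w\<close> and
  \<open>herm w z\<close>, divided by \<open>\<alpha>\<close>, produce the kernel; the exponent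
  \<open>x * g w\<close> with complex \<open>x\<close> produces the entire functions used for
  analytic continuation.\<close>

definition laplace :: "'b measure \<Rightarrow> ('a \<Rightarrow> 'b \<Rightarrow> complex) \<Rightarrow> ('b \<Rightarrow> complex) \<Rightarrow> 'a \<Rightarrow> complex" where
  "laplace \<nu> l h z = (LINT w|\<nu>. exp (l z w) * h w)"

text \<open>The second order remainder of \<open>exp\<close> at \<open>d = l (y - z) w\<close> is at
  most \<open>exp (cmod d) * (cmod d)\<^sup>2\<close>. This gives an integrable bound for the
  remainder with the factor \<open>(norm (y - z))\<^sup>2\<close> in front.\<close>

lemma laplace_has_derivative:
  fixes l :: "'a::euclidean_space \<Rightarrow> 'b::euclidean_space \<Rightarrow> complex"
  assumes l: "bounded_bilinear l" and h: "exp_moments \<nu> h"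
  shows "(laplace \<nu> l h has_derivative (\<lambda>v. laplace \<nu> l (\<lambda>w. l v w * h w) z)) (at z)"
proof -
  interpret l: bounded_bilinear l by fact
  obtain C where C: "C > 0" "\<And>a b. norm (l a b) \<le> norm a * norm b * C"
    using l.pos_bounded by blast
  have int0: "integrable \<nu> (\<lambda>w. exp (l z w) * h w)" for z
    by (intro exp_moments_imp_integrable exp_moments_exp l h)
  have int1: "integrable \<nu> (\<lambda>w. exp (l z w) * (l v w * h w))" for v
    by (intro exp_moments_imp_integrable exp_moments_exp exp_moments_mult l h)
  have lin: "linear (\<lambda>v. laplace \<nu> l (\<lambda>w. l v w * h w) z)"
  proof (rule linearI)
    show "laplace \<nu> l (\<lambda>w. l (u + v) w * h w) z = laplace \<nu> l (\<lambda>w. l u w * h w) z + laplace \<nu> l (\<lambda>w. l v w * h w) z" for u v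
      unfolding laplace_def using Bochner_Integration.integral_add[OF int1[of u] int1[of v]]
      by (simp add: l.add_left distrib_left distrib_right)
    show "laplace \<nu> l (\<lambda>w. l (c *\<^sub>R v) w * h w) z = c *\<^sub>R laplace \<nu> l (\<lambda>w. l v w * h w) z" for c v
      unfolding laplace_def by (simp add: l.scaleR_left)
  qed
  \<comment> \<open>\<open>norm z * C\<close> comes from \<open>exp (l z w)\<close>, one more
    \<open>C\<close> from \<open>exp d\<close> with \<open>norm (y - z) \<le> 1\<close>, and the 2
    absorbs \<open>(norm w)\<^sup>2 \<le> exp (2 * norm w)\<close>.\<close>
  define r where "r = (norm z + 1) * C + 2"
  define H where "H w = C\<^sup>2 * (exp (r * norm w) * cmod (h w))" for w
  have H: "integrable \<nu> H" unfolding H_def using h by (auto simp: exp_moments_def)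
  have remainder: "cmod (exp (l y w) * h w - exp (l z w) * h w - exp (l z w) * (l (y - z) w * h w))
      \<le> (norm (y - z))\<^sup>2 * H w" if y: "dist y z < 1" for y w
  proof -
    define d where "d = l (y - z) w"
    have ny: "norm (y - z) \<le> 1" using y by (simp add: dist_norm)
    have d: "cmod d \<le> norm (y - z) * norm w * C" unfolding d_def by (rule C)
    also have "\<dots> \<le> 1 * norm w * C" using ny C(1) by (intro mult_right_mono) auto
    finally have d1: "cmod d \<le> C * norm w" by (simp add: mult.commute)
    have "cmod (exp d - 1 - d) \<le> exp (cmod d) * (cmod d)\<^sup>2"
      using Taylor_exp_field[of d 1] by (simp add: power2_eq_square diff_diff_eq)
    also have "\<dots> \<le> exp (C * norm w) * (norm (y - z) * norm w * C)\<^sup>2"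
      using d1 d by (intro mult_mono power_mono) auto
    finally have e1: "cmod (exp d - 1 - d) \<le> exp (C * norm w) * (norm (y - z) * norm w * C)\<^sup>2" .
    have "norm w \<le> exp (norm w)"
      using exp_ge_add_one_self[of "norm w"] by linarith
    then have "(norm w)\<^sup>2 \<le> exp (norm w) ^ 2" by (rule power_mono) simp
    then have e2: "(norm w)\<^sup>2 \<le> exp (2 * norm w)" by (simp add: exp_double)
    have "cmod (exp (l z w)) \<le> exp (cmod (l z w))" by (rule norm_exp)
    also have "\<dots> \<le> exp (norm z * C * norm w)" using C(2)[of z w] by (simp add: mult_ac)
    finally have e3: "cmod (exp (l z w)) \<le> exp (norm z * C * norm w)" .
    have "exp (l y w) * h w - exp (l z w) * h w - exp (l z w) * (l (y - z) w * h w)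
        = exp (l z w) * ((exp d - 1 - d) * h w)"
      by (simp add: d_def l.diff_left exp_diff field_simps)
    then have "cmod (exp (l y w) * h w - exp (l z w) * h w - exp (l z w) * (l (y - z) w * h w))
        = cmod (exp (l z w)) * (cmod (exp d - 1 - d) * cmod (h w))"
      by (simp add: norm_mult)
    also have "\<dots> \<le> exp (norm z * C * norm w) * ((exp (C * norm w) * (norm (y - z) * norm w * C)\<^sup>2) * cmod (h w))"
      using e1 e3 by (intro mult_mono mult_nonneg_nonneg) auto
    also have "\<dots> = (norm (y - z))\<^sup>2 * C\<^sup>2 * (exp ((norm z + 1) * C * norm w) * (norm w)\<^sup>2 * cmod (h w))"
      by (simp add: power_mult_distrib ring_distribs exp_add mult_ac)
    also have "\<dots> \<le> (norm (y - z))\<^sup>2 * C\<^sup>2 * (exp ((norm z + 1) * C * norm w) * exp (2 * norm w) * cmod (h w))"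
      using e2 by (intro mult_left_mono mult_right_mono) auto
    also have "\<dots> = (norm (y - z))\<^sup>2 * H w"
      by (simp add: H_def r_def ring_distribs exp_add mult_ac)
    finally show ?thesis .
  qed
  show ?thesis
  proof (rule has_derivativeI_sandwich[where e = 1 and H = "\<lambda>y. norm (y - z) * (LINT w|\<nu>. H w)"])
    show "bounded_linear (\<lambda>v. laplace \<nu> l (\<lambda>w. l v w * h w) z)"
      using lin by (simp add: linear_conv_bounded_linear)
    have "((\<lambda>y. norm (y - z) * (LINT w|\<nu>. H w)) \<longlongrightarrow> norm (z - z) * (LINT w|\<nu>. H w)) (at z)"
      by (intro tendsto_intros)
    then show "((\<lambda>y. norm (y - z) * (LINT w|\<nu>. H w)) \<longlongrightarrow> 0) (at z)" by simp
    fix y assume y: "y \<noteq> z" "dist y z < 1"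
    have "laplace \<nu> l h y - laplace \<nu> l h z - laplace \<nu> l (\<lambda>w. l (y - z) w * h w) z
       = (LINT w|\<nu>. exp (l y w) * h w - exp (l z w) * h w - exp (l z w) * (l (y - z) w * h w))"
      unfolding laplace_def using int0 int1 by (simp add: Bochner_Integration.integral_diff Bochner_Integration.integrable_diff)
    also have "cmod \<dots> \<le> (LINT w|\<nu>. cmod (exp (l y w) * h w - exp (l z w) * h w - exp (l z w) * (l (y - z) w * h w)))"
      by (rule integral_norm_bound)
    also have "\<dots> \<le> (LINT w|\<nu>. (norm (y - z))\<^sup>2 * H w)"
      by (rule integral_mono[OF integrable_norm integrable_mult_right[OF H]])
         (rule remainder[OF y(2)] Bochner_Integration.integrable_diff int0 int1)+
    also have "\<dots> = (norm (y - z))\<^sup>2 * (LINT w|\<nu>. H w)" by simp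
    finally show "norm (laplace \<nu> l h y - laplace \<nu> l h z - laplace \<nu> l (\<lambda>w. l (y - z) w * h w) z) / norm (y - z)
        \<le> norm (y - z) * (LINT w|\<nu>. H w)"
      using y(1) by (simp add: divide_le_eq power2_eq_square mult_ac)
  qed auto
qed

lemma laplace_frechet_derivative:
  fixes l :: "'a::euclidean_space \<Rightarrow> 'b::euclidean_space \<Rightarrow> complex"
  assumes "bounded_bilinear l" "exp_moments \<nu> h"
  shows "frechet_derivative (laplace \<nu> l h) (at z) v = laplace \<nu> l (\<lambda>w. l v w * h w) z"
  using frechet_derivative_at[OF laplace_has_derivative[OF assms]] by metis

lemma laplace_differentiable:
  fixes l :: "'a::euclidean_space \<Rightarrow> 'b::euclidean_space \<Rightarrow> complex"
  assumes "bounded_bilinear l" "exp_moments \<nu> h"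
  shows "laplace \<nu> l h differentiable (at z)"
  using laplace_has_derivative[OF assms] by (auto simp: differentiable_def)

lemma laplace_C1:
  assumes l: "bounded_bilinear l" and h: "exp_moments \<nu> h"
  shows "C1 (laplace \<nu> l h)"
  unfolding C1_def laplace_frechet_derivative[OF l h]
  using laplace_differentiable[OF l] h exp_moments_mult[OF l h]
  by (auto intro!: differentiable_imp_continuous_on differentiable_at_imp_differentiable_on)

lemma laplace_C2:
  assumes l: "bounded_bilinear l" and h: "exp_moments \<nu> h"
  shows "C2 (laplace \<nu> l h)"
  unfolding C2_def laplace_frechet_derivative[OF l h]
  using laplace_C1[OF l] h exp_moments_mult[OF l h] by auto

lemma laplace_lincomb:
  assumes "bounded_bilinear l" "exp_moments \<nu> g" "exp_moments \<nu> h"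
  shows "laplace \<nu> l g z + c * laplace \<nu> l h z = laplace \<nu> l (\<lambda>w. g w + c * h w) z"
proof -
  have "laplace \<nu> l g z + c * laplace \<nu> l h z = (LINT w|\<nu>. exp (l z w) * g w) + (LINT w|\<nu>. c * (exp (l z w) * h w))"
    by (simp add: laplace_def)
  also have "\<dots> = (LINT w|\<nu>. exp (l z w) * g w + c * (exp (l z w) * h w))"
    by (rule Bochner_Integration.integral_add[symmetric])
       (intro integrable_mult_right exp_moments_imp_integrable exp_moments_exp assms)+
  finally show ?thesis
    by (simp add: laplace_def distrib_left mult.left_commute[of c])
qed

lemma laplace_cmult: "laplace \<nu> l (\<lambda>w. c * h w) z = c * laplace \<nu> l h z"
  by (simp add: laplace_def mult.left_commute[of _ c])

lemma laplace_wirtinger: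
  fixes l :: "complex ^ 'n::finite \<Rightarrow> 'b::euclidean_space \<Rightarrow> complex"
  assumes l: "bounded_bilinear l" and h: "exp_moments \<nu> h"
  shows "wirtinger j (laplace \<nu> l h) = laplace \<nu> l (\<lambda>w. (l (axis j 1) w - \<i> * l (axis j \<i>) w) / 2 * h w)"
    and "wirtinger_bar j (laplace \<nu> l h) = laplace \<nu> l (\<lambda>w. (l (axis j 1) w + \<i> * l (axis j \<i>) w) / 2 * h w)"
proof -
  have *: "(laplace \<nu> l (\<lambda>w. l u w * h w) z + c * laplace \<nu> l (\<lambda>w. l v w * h w) z) / 2
      = laplace \<nu> l (\<lambda>w. (l u w + c * l v w) / 2 * h w) z" for u v c z
    unfolding laplace_lincomb[OF l exp_moments_mult[OF l h] exp_moments_mult[OF l h]]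
    using laplace_cmult[of \<nu> l "1/2" "\<lambda>w. l u w * h w + c * (l v w * h w)" z]
    by (simp add: distrib_right add_divide_distrib mult.assoc)
  show "wirtinger j (laplace \<nu> l h) = laplace \<nu> l (\<lambda>w. (l (axis j 1) w - \<i> * l (axis j \<i>) w) / 2 * h w)"
    using *[where c = "- \<i>"] by (intro ext) (simp add: wirtinger_def laplace_frechet_derivative[OF l h])
  show "wirtinger_bar j (laplace \<nu> l h) = laplace \<nu> l (\<lambda>w. (l (axis j 1) w + \<i> * l (axis j \<i>) w) / 2 * h w)"
    using *[where c = \<i>] by (intro ext) (simp add: wirtinger_bar_def laplace_frechet_derivative[OF l h])
qed

text \<open>The last hypothesis says that \<open>l\<close> is complex linear or antilinear in its
  first argument. In the linear case \<open>wirtinger_bar\<close> already yields 0; in the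
  antilinear case \<open>wirtinger\<close> annihilates what \<open>wirtinger_bar\<close>
  produced.\<close>

lemma laplace_pluriharmonic:
  fixes l :: "complex ^ 'n::finite \<Rightarrow> 'b::euclidean_space \<Rightarrow> complex"
  assumes l: "bounded_bilinear l" and h: "exp_moments \<nu> h"
    and l0: "(\<forall>j w. l (axis j \<i>) w = \<i> * l (axis j 1) w) \<or> (\<forall>j w. l (axis j \<i>) w = - \<i> * l (axis j 1) w)"
  shows "pluriharmonic (laplace \<nu> l h)"
  unfolding pluriharmonic_def
proof (intro conjI allI laplace_C2 l h)
  fix j k z
  let ?h = "\<lambda>w. (l (axis k 1) w + \<i> * l (axis k \<i>) w) / 2 * h w"
  have h': "exp_moments \<nu> ?h"
    using exp_moments_lincomb[OF exp_moments_mult[OF l h] exp_moments_mult[OF l h], of "1/2" "axis k 1" "\<i>/2" "axis k \<i>"]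
    by (rule exp_moments_cong) (simp add: algebra_simps add_divide_distrib)
  show "wirtinger j (wirtinger_bar k (laplace \<nu> l h)) z = 0"
    unfolding laplace_wirtinger(2)[OF l h] laplace_wirtinger(1)[OF l h'] laplace_def
    using l0 by (elim disjE) (simp_all add: algebra_simps)
qed

subsection \<open>The reproducing formula\<close>

text \<open>The inequality \<open>2 a b \<le> a\<^sup>2 + b\<^sup>2\<close> separates the
  exponential from \<open>f\<close>, and each square is covered by one hypothesis. The measure is
  left general because both Lebesgue measure and \<open>\<mu>\<close> are inserted later.\<close>

lemma weighted_square_exp_moments:
  fixes f :: "'a::euclidean_space \<Rightarrow> complex"
  assumes "sets \<nu> = sets borel" "f \<in> borel_measurable borel"
    and f2: "(\<integral>\<^sup>+ w. ennreal ((cmod (f w))\<^sup>2 * gauss \<alpha> w) \<partial>\<nu>) < \<infinity>"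
    and g: "\<And>r. (\<integral>\<^sup>+ w. ennreal (exp (r * norm w - (norm w)\<^sup>2 / \<alpha>)) \<partial>\<nu>) < \<infinity>"
  shows "exp_moments \<nu> (\<lambda>w. f w * of_real (gauss \<alpha> w))"
  unfolding exp_moments_def
proof (intro conjI allI)
  note [measurable_cong] = assms(1) and [measurable] = assms(2)
  show "sets \<nu> = sets borel" by fact
  show "(\<lambda>w. f w * of_real (gauss \<alpha> w)) \<in> borel_measurable borel" by measurable
  fix r
  have "integrable \<nu> (\<lambda>w. (cmod (f w))\<^sup>2 * gauss \<alpha> w + exp (2 * r * norm w - (norm w)\<^sup>2 / \<alpha>))"
    using f2 g[of "2 * r"] by (intro Bochner_Integration.integrable_add integrableI_bounded) auto
  then show "integrable \<nu> (\<lambda>w. exp (r * norm w) * cmod (f w * of_real (gauss \<alpha> w)))"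
  proof (rule Bochner_Integration.integrable_bound)
    have "exp (r * norm w) * cmod (f w) \<le> (cmod (f w))\<^sup>2 + exp (2 * r * norm w)" for w
    proof -
      have "2 * (exp (r * norm w) * cmod (f w)) \<le> (exp (r * norm w))\<^sup>2 + (cmod (f w))\<^sup>2"
        using sum_squares_bound[of "exp (r * norm w)" "cmod (f w)"] by simp
      moreover have "(exp (r * norm w))\<^sup>2 = exp (2 * r * norm w)"
        by (simp add: exp_double[symmetric] mult.assoc)
      moreover have "0 \<le> exp (r * norm w) * cmod (f w)" by simp
      ultimately show ?thesis by linarith
    qed
    from mult_right_mono[OF this, of "gauss \<alpha> w" for w]
    have "exp (r * norm w) * cmod (f w) * gauss \<alpha> w
       \<le> (cmod (f w))\<^sup>2 * gauss \<alpha> w + exp (2 * r * norm w - (norm w)\<^sup>2 / \<alpha>)" for w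
      by (simp add: distrib_right exp_diff exp_minus divide_inverse)
    then show "AE w in \<nu>. norm (exp (r * norm w) * cmod (f w * of_real (gauss \<alpha> w)))
        \<le> norm ((cmod (f w))\<^sup>2 * gauss \<alpha> w + exp (2 * r * norm w - (norm w)\<^sup>2 / \<alpha>))"
      by (intro AE_I2) (simp add: norm_mult mult.assoc)
  qed measurable
qed

section \<open>Sums of pluriharmonic functions and integrals of the kernel\<close>

lemma C1_add:
  assumes "C1 f" "C1 g"
  shows "C1 (\<lambda>z. f z + g z)"
    and "frechet_derivative (\<lambda>z. f z + g z) (at z) v = frechet_derivative f (at z) v + frechet_derivative g (at z) v"
proof -
  have fg: "f differentiable (at z)" "g differentiable (at z)" for z
    using assms by (auto simp: C1_def)
  have eq: "frechet_derivative (\<lambda>z. f z + g z) (at z) v = frechet_derivative f (at z) v + frechet_derivative g (at z) v" for z v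
    using frechet_derivative_at[OF has_derivative_add[OF fg[THEN frechet_derivative_works[THEN iffD1]]]]
    by (metis (no_types, lifting))
  then show "frechet_derivative (\<lambda>z. f z + g z) (at z) v = frechet_derivative f (at z) v + frechet_derivative g (at z) v" .
  show "C1 (\<lambda>z. f z + g z)"
    unfolding C1_def eq using assms by (auto simp: C1_def intro!: continuous_intros)
qed

lemma C2_add:
  assumes "C2 f" "C2 g"
  shows "C2 (\<lambda>z. f z + g z)"
  using assms by (auto simp: C2_def C1_add)

lemma pluriharmonic_add:
  assumes f: "pluriharmonic f" and g: "pluriharmonic g"
  shows "pluriharmonic (\<lambda>z. f z + g z)"
proof -
  have C: "C2 f" "C2 g" using f g by (auto simp: pluriharmonic_def)
  have "wirtinger_bar k (\<lambda>z. f z + g z) = (\<lambda>z. wirtinger_bar k f z + wirtinger_bar k g z)" for k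
    using C by (auto simp: wirtinger_bar_def C2_def C1_add algebra_simps add_divide_distrib)
  moreover have "wirtinger j (\<lambda>z. wirtinger_bar k f z + wirtinger_bar k g z) z
      = wirtinger j (wirtinger_bar k f) z + wirtinger j (wirtinger_bar k g) z" for j k z
  proof -
    have "frechet_derivative (\<lambda>z. wirtinger_bar k f z + wirtinger_bar k g z) (at z) v =
       frechet_derivative (wirtinger_bar k f) (at z) v + frechet_derivative (wirtinger_bar k g) (at z) v" for v
      using frechet_derivative_at[OF has_derivative_add[OF
         frechet_derivative_works[THEN iffD1, OF C2_differentiable_wirtinger_bar[OF C(1), of k]]
         frechet_derivative_works[THEN iffD1, OF C2_differentiable_wirtinger_bar[OF C(2), of k]]]]
      by (metis (no_types, lifting))
    then show ?thesis by (simp add: wirtinger_def field_simps)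
  qed
  ultimately show ?thesis
    using f g C2_add[OF C] by (simp add: pluriharmonic_def)
qed

lemma pluriharmonic_const: "pluriharmonic (\<lambda>z. c)"
  by (simp add: pluriharmonic_def C2_def C1_def wirtinger_def[abs_def] wirtinger_bar_def[abs_def])

lemma K_ph_integral:
  assumes h: "exp_moments \<nu> h"
  shows "(LINT w|\<nu>. K_ph \<alpha> z w * h w) =
     laplace \<nu> (\<lambda>z w. herm z w / of_real \<alpha>) h z + laplace \<nu> (\<lambda>z w. herm w z / of_real \<alpha>) h z - (LINT w|\<nu>. h w)"
    and "integrable \<nu> (\<lambda>w. K_ph \<alpha> z w * h w)"
proof -
  have bb: "bounded_bilinear (\<lambda>z w. herm z w / of_real \<alpha>)" by (rule bounded_bilinear_herm)
  note bb' = bounded_bilinear.flip[OF bb]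
  note i = exp_moments_imp_integrable[OF exp_moments_exp[OF bb h, of z]]
    exp_moments_imp_integrable[OF exp_moments_exp[OF bb' h, of z]] exp_moments_imp_integrable[OF h]
  have eq: "K_ph \<alpha> z w * h w = exp (herm z w / of_real \<alpha>) * h w + exp (herm w z / of_real \<alpha>) * h w - h w" for w
    by (simp add: K_ph_def algebra_simps)
  show "integrable \<nu> (\<lambda>w. K_ph \<alpha> z w * h w)"
    unfolding eq by (intro Bochner_Integration.integrable_diff Bochner_Integration.integrable_add i)
  show "(LINT w|\<nu>. K_ph \<alpha> z w * h w) =
     laplace \<nu> (\<lambda>z w. herm z w / of_real \<alpha>) h z + laplace \<nu> (\<lambda>z w. herm w z / of_real \<alpha>) h z - (LINT w|\<nu>. h w)"
    unfolding eq laplace_def using i by simp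
qed

lemma K_ph_continuous:
  assumes "continuous_on S f" "continuous_on S g"
  shows "continuous_on S (\<lambda>x. K_ph \<alpha> (f x) (g x))"
  unfolding K_ph_def
  by (intro continuous_on_add continuous_on_diff continuous_on_exp continuous_on_const assms
      bounded_bilinear.continuous_on[OF bounded_bilinear_herm])

lemma herm_axis:
  "herm (axis j \<i>) w = \<i> * herm (axis j 1) w" "herm w (axis j \<i>) = - \<i> * herm w (axis j 1)"
  by (simp_all add: herm_def axis_def if_distrib if_distribR sum_distrib_left cong: if_cong)

lemma K_ph_integral_pluriharmonic:
  fixes h :: "complex ^ 'n::finite \<Rightarrow> complex"
  assumes h: "exp_moments \<nu> h"
  shows "pluriharmonic (\<lambda>z. LINT w|\<nu>. K_ph \<alpha> z w * h w)"
proof -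
  have bb: "bounded_bilinear (\<lambda>z w :: complex ^ 'n. herm z w / of_real \<alpha>)" by (rule bounded_bilinear_herm)
  have "pluriharmonic (laplace \<nu> (\<lambda>z w. herm z w / of_real \<alpha>) h)"
    "pluriharmonic (laplace \<nu> (\<lambda>z w. herm w z / of_real \<alpha>) h)"
    by (rule laplace_pluriharmonic[OF bb h] laplace_pluriharmonic[OF bounded_bilinear.flip[OF bb] h], simp add: herm_axis)+
  from pluriharmonic_add[OF pluriharmonic_add[OF this] pluriharmonic_const[of "- (LINT w|\<nu>. h w)"]]
  show ?thesis by (simp add: K_ph_integral(1)[OF h])
qed

text \<open>The kernel is its own integral against the Dirac measure at \<open>w\<close>, so the
  result on kernel integrals contains it.\<close>

lemma K_ph_pluriharmonic: "pluriharmonic (\<lambda>z. K_ph \<alpha> z w)"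
proof -
  have m: "exp_moments (return borel w) (\<lambda>_. 1)"
    by (auto simp: exp_moments_def integrable_iff_bounded nn_integral_return)
  have "K_ph \<alpha> z \<in> borel_measurable borel" for z
    by (intro borel_measurable_continuous_onI K_ph_continuous continuous_intros)
  then have "(LINT w'|return borel w. K_ph \<alpha> z w' * 1) = K_ph \<alpha> z w" for z
    by (subst integral_return) auto
  with K_ph_integral_pluriharmonic[OF m, of \<alpha>] show ?thesis by simp
qed

section \<open>Entire functions of one variable for the analytic continuation\<close>

lemma bounded_bilinear_mult_linear:
  fixes g :: "'b::euclidean_space \<Rightarrow> real"
  assumes "bounded_linear g"
  shows "bounded_bilinear (\<lambda>x w. x * complex_of_real (g w))"
  by (rule bounded_bilinear.comp[OF bounded_bilinear_mult bounded_linear_ident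
        bounded_linear_compose[OF bounded_linear_of_real assms]])

lemma exp_moments_exp_linear:
  fixes g :: "'b::euclidean_space \<Rightarrow> real"
  assumes "bounded_linear g" "exp_moments \<nu> h"
  shows "exp_moments \<nu> (\<lambda>w. exp (x * complex_of_real (g w)) * h w)"
  by (rule exp_moments_exp[OF bounded_bilinear_mult_linear assms(2)]) fact

lemma exp_integral_holomorphic:
  fixes g :: "'b::euclidean_space \<Rightarrow> real"
  assumes g: "bounded_linear g" and h: "exp_moments \<nu> h"
  shows "(\<lambda>x. LINT w|\<nu>. exp (x * complex_of_real (g w)) * h w) holomorphic_on UNIV"
proof -
  let ?l = "\<lambda>x w. x * complex_of_real (g w)"
  have "(laplace \<nu> ?l h has_field_derivative laplace \<nu> ?l (\<lambda>w. complex_of_real (g w) * h w) x) (at x)" for x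
    using laplace_has_derivative[OF bounded_bilinear_mult_linear[OF g] h, of x]
    unfolding has_field_derivative_def
    by (rule has_derivative_eq_rhs) (simp only: fun_eq_iff mult.assoc laplace_cmult, simp add: mult.commute)
  then show ?thesis
    unfolding laplace_def[abs_def] by (auto simp: holomorphic_on_def field_differentiable_def)
qed

lemma entire_zero_on_reals:
  assumes "g holomorphic_on UNIV" "\<And>x. g (complex_of_real x) = 0"
  shows "g w = 0"
proof (rule analytic_continuation[OF assms(1), where U = "\<real>" and \<xi> = 0])
  show "(0::complex) islimpt \<real>"
    unfolding islimpt_approachable
  proof (intro allI impI)
    fix e :: real assume "e > 0"
    then show "\<exists>x'\<in>\<real>. x' \<noteq> 0 \<and> dist x' (0::complex) < e"
      by (intro bexI[of _ "of_real (e/2)"]) auto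
  qed
qed (use assms(2) in \<open>auto elim: Reals_cases\<close>)

text \<open>The type argument carries the dimension. On \<open>complex ^ 'n\<close> this is the
  classical constant \<open>(pi * \<alpha>) ^ CARD('n)\<close> by which the inner product is
  normalized.\<close>

definition gauss_mass :: "'a::euclidean_space itself \<Rightarrow> real \<Rightarrow> real" where
  "gauss_mass _ \<alpha> = (LINT u|(lborel :: 'a measure). gauss \<alpha> u)"

lemma exp_linear_gaussian_nn_integral_finite':
  assumes "(\<alpha>::real) > 0"
  shows "(\<integral>\<^sup>+ x. ennreal (exp (r * norm x - (norm x)\<^sup>2 / \<alpha>)) \<partial>(lborel :: 'a::euclidean_space measure)) < \<infinity>"
  using exp_linear_gaussian_nn_integral_finite[of "1/\<alpha>" r, where ?'a = 'a] assms by simp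

text \<open>
  For fixed \<open>z\<close> the function \<open>E x y\<close> below is entire in \<open>x\<close> and in \<open>y\<close>. For real \<open>x\<close>, \<open>y\<close> the
  Gaussian mean value property identifies it with a multiple of \<open>f ((x + \<i> y) z) = A (x + \<i> y) + B' (x - \<i> y)\<close>,
  so the identity persists for complex \<open>x\<close>, \<open>y\<close>. The choices \<open>(x + \<i> y, x - \<i> y) = (1, 0), (0, 1), (0, 0)\<close>
  give the three parts of the kernel.
\<close>

theorem pluriharmonic_reproducing:
  fixes f :: "complex ^ 'n::finite \<Rightarrow> complex"
  assumes \<alpha>: "\<alpha> > 0" and f: "pluriharmonic f"
    and f2: "(\<integral>\<^sup>+ w. ennreal ((cmod (f w))\<^sup>2 * gauss \<alpha> w) \<partial>lborel) < \<infinity>"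
  shows "(LINT w|lborel. K_ph \<alpha> z w * (f w * of_real (gauss \<alpha> w)))
    = of_real (gauss_mass TYPE(complex ^ 'n) \<alpha>) * f z"
proof -
  define h where "h w = f w * complex_of_real (gauss \<alpha> w)" for w
  have [measurable]: "f \<in> borel_measurable borel"
    by (rule borel_measurable_continuous_onI[OF pluriharmonic_continuous[OF f]])
  have h: "exp_moments lborel h"
    unfolding h_def
    by (rule weighted_square_exp_moments[OF _ _ f2 exp_linear_gaussian_nn_integral_finite'[OF \<alpha>]]) auto
  define c where "c = complex_of_real (gauss_mass TYPE(complex ^ 'n) \<alpha>)"
  have c: "c = (LINT u|(lborel :: (complex ^ 'n) measure). complex_of_real (exp (- (1/\<alpha>) * (norm u)\<^sup>2)))"
    by (simp add: c_def gauss_mass_def)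
  \<comment> \<open>The cross term of \<open>- (norm (w - v))\<^sup>2 / \<alpha>\<close>: a Gaussian
    about \<open>v\<close> is the Gaussian about 0 times \<open>exp (g v w)\<close> and a factor
    that depends on \<open>v\<close> alone.\<close>
  define g where "g v w = 2 / \<alpha> * (v \<bullet> w)" for v w :: "complex ^ 'n"
  have g: "bounded_linear (g v)" for v
    unfolding g_def by (intro bounded_linear_const_mult bounded_linear_inner_right)
  obtain A B where A: "A holomorphic_on UNIV" and B: "B holomorphic_on UNIV"
    and AB: "\<And>l. f (0 + l *s z) = A l + cnj (B l)"
    using pluriharmonic_slice[OF f] by blast
  \<comment> \<open>Reflection makes the conjugate part entire: for real \<open>x\<close> and
    \<open>y\<close>, \<open>cnj (B (x + i y)) = B' (x - i y)\<close>.\<close>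
  define B' where "B' l = cnj (B (cnj l))" for l
  have B': "B' holomorphic_on UNIV"
    unfolding B'_def using holomorphic_on_compose_cnj_cnj[OF holomorphic_on_subset[OF B subset_UNIV] open_UNIV]
    by (simp add: o_def)
  have comp: "(\<lambda>x. F (x + a)) holomorphic_on UNIV" "(\<lambda>y. F (a + \<i> * y)) holomorphic_on UNIV"
     "(\<lambda>y. F (a - \<i> * y)) holomorphic_on UNIV" if "F holomorphic_on UNIV" for F a
    by (intro holomorphic_on_compose_gen[OF _ that, unfolded o_def] holomorphic_intros; simp)+
  define J where "J x y = (LINT w|lborel. exp (x * complex_of_real (g z w) + y * complex_of_real (g (\<i> *s z) w)) * h w)" for x y
  \<comment> \<open>For real \<open>x\<close>, \<open>y\<close> the prefactor is
    \<open>gauss \<alpha> v\<close> at \<open>v = (x + i y) z\<close>. Writing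
    \<open>(norm v)\<^sup>2\<close> as \<open>x\<^sup>2 + y\<^sup>2\<close> times
    \<open>(norm z)\<^sup>2\<close> lets it continue to complex arguments.\<close>
  define E where "E x y = exp (- ((x\<^sup>2 + y\<^sup>2) * of_real ((norm z)\<^sup>2 / \<alpha>))) * J x y" for x y
  have E_x: "(\<lambda>x. E x y) holomorphic_on UNIV" for y
    using exp_integral_holomorphic[OF g[of z] exp_moments_exp_linear[OF g[of "\<i> *s z"] h], of y]
    unfolding E_def J_def by (intro holomorphic_intros) (simp add: exp_add mult.assoc)
  have E_y: "(\<lambda>y. E x y) holomorphic_on UNIV" for x
    using exp_integral_holomorphic[OF g[of "\<i> *s z"] exp_moments_exp_linear[OF g[of z] h], of x]
    unfolding E_def J_def by (intro holomorphic_intros) (simp add: exp_add mult_ac)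
  have real: "E (of_real x) (of_real y) = c * f (Complex x y *s z)" for x y
  proof -
    define v where "v = Complex x y *s z"
    have gv: "x * g z w + y * g (\<i> *s z) w = g v w" for w
    proof -
      have "v \<bullet> w = x * (z \<bullet> w) + y * ((\<i> *s z) \<bullet> w)"
        by (simp add: v_def Re_herm[symmetric] herm_scale_left)
      then show ?thesis by (simp add: g_def algebra_simps)
    qed
    have nv: "(norm v)\<^sup>2 = (x\<^sup>2 + y\<^sup>2) * (norm z)\<^sup>2"
    proof -
      have "norm v = cmod (Complex x y) * norm z"
        by (simp add: v_def norm_vec_scale)
      then show ?thesis by (simp add: power_mult_distrib cmod_power2)
    qed
    have shift: "f w * of_real (exp (- (1/\<alpha>) * (norm (w - v))\<^sup>2))
        = of_real (gauss \<alpha> v) * (exp (1 * complex_of_real (g v w)) * h w)" for w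
    proof -
      have "- (1/\<alpha>) * (norm (w - v))\<^sup>2 = - (norm v)\<^sup>2 / \<alpha> + (g v w + - (norm w)\<^sup>2 / \<alpha>)"
        using \<alpha> by (simp add: g_def power2_norm_eq_inner inner_diff_left inner_diff_right inner_commute field_simps)
      then show ?thesis
        by (simp only: exp_add of_real_mult) (simp add: h_def exp_of_real)
    qed
    have int: "integrable lborel (\<lambda>w. of_real (gauss \<alpha> v) * (exp (1 * complex_of_real (g v w)) * h w))"
      by (intro integrable_mult_right exp_moments_imp_integrable exp_moments_exp_linear g h)
    then have int': "integrable (distr lborel borel ((+) v)) (\<lambda>w. f w * of_real (exp (- (1/\<alpha>) * (norm (w - v))\<^sup>2)))"
      by (simp only: shift lborel_distr_plus)
    then have int'': "integrable lborel (\<lambda>u. f (v + u) * of_real (exp (- (1/\<alpha>) * (norm u)\<^sup>2)))"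
      by (subst (asm) integrable_distr_eq) auto
    have "E (of_real x) (of_real y) = of_real (gauss \<alpha> v) * J (of_real x) (of_real y)"
      by (simp add: E_def nv exp_of_real[symmetric])
    also have "J (of_real x) (of_real y) = (LINT w|lborel. exp (1 * complex_of_real (g v w)) * h w)"
      unfolding J_def by (simp flip: gv of_real_mult of_real_add)
    also have "of_real (gauss \<alpha> v) * \<dots> = (LINT w|lborel. f w * of_real (exp (- (1/\<alpha>) * (norm (w - v))\<^sup>2)))"
      by (simp only: shift integral_mult_right_zero)
    also have "\<dots> = (LINT w|distr lborel borel ((+) v). f w * of_real (exp (- (1/\<alpha>) * (norm (w - v))\<^sup>2)))"
      by (simp only: lborel_distr_plus)
    also have "\<dots> = (LINT u|lborel. f (v + u) * of_real (exp (- (1/\<alpha>) * (norm u)\<^sup>2)))"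
      by (subst integral_distr) auto
    also have "\<dots> = f v * c"
      unfolding c by (rule pluriharmonic_gaussian_mean[OF f int''])
    finally show ?thesis by (simp add: v_def mult.commute)
  qed
  define D where "D x y = E x y - c * (A (x + \<i> * y) + B' (x - \<i> * y))" for x y
  have D_x: "(\<lambda>x. D x y) holomorphic_on UNIV" for y
    unfolding D_def using comp(1)[OF A, of "\<i> * y"] comp(1)[OF B', of "- \<i> * y"]
    by (intro holomorphic_intros E_x) auto
  have D_y: "(\<lambda>y. D x y) holomorphic_on UNIV" for x
    unfolding D_def by (intro holomorphic_intros E_y comp A B')
  have "D (of_real x) (of_real y) = 0" for x y
    using AB[of "Complex x y"] by (simp add: D_def real B'_def Complex_eq)
  \<comment> \<open>Continuation one variable at a time: in \<open>x\<close> for real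
    \<open>y\<close>, then in \<open>y\<close> for every complex \<open>x\<close>.\<close>
  then have "D x (of_real y) = 0" for x y
    using entire_zero_on_reals[OF D_x] by blast
  then have D0: "D x y = 0" for x y
    using entire_zero_on_reals[OF D_y] by blast
  have iz: "(\<i> *s z) \<bullet> w = - Im (herm z w)" and hz: "z \<bullet> w = Re (herm z w)" for w
    by (simp_all add: Re_herm[symmetric] herm_scale_left)
  have e1: "1/2 * complex_of_real (g z w) + - \<i>/2 * complex_of_real (g (\<i> *s z) w) = herm z w / of_real \<alpha>" for w
    using \<alpha> by (simp add: g_def iz hz complex_eq_iff)
  have e2: "1/2 * complex_of_real (g z w) + \<i>/2 * complex_of_real (g (\<i> *s z) w) = herm w z / of_real \<alpha>" for w
    using \<alpha> by (simp add: g_def iz hz cnj_herm[of z w, symmetric] complex_eq_iff)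
  \<comment> \<open>At the three points
    \<open>x\<^sup>2 + y\<^sup>2 = (x + i y) (x - i y) = 0\<close>, so the prefactor of
    \<open>E\<close> is 1 and \<open>E\<close> equals \<open>J\<close>. In the combination below the
    terms \<open>A 0 + B' 0\<close> cancel.\<close>
  have "J (1/2) (- \<i>/2) = c * (A 1 + B' 0)" "J (1/2) (\<i>/2) = c * (A 0 + B' 1)" "J 0 0 = c * (A 0 + B' 0)"
    using D0[of "1/2" "- \<i>/2"] D0[of "1/2" "\<i>/2"] D0[of 0 0]
    by (simp_all add: D_def E_def power2_eq_square)
  then have "J (1/2) (- \<i>/2) + J (1/2) (\<i>/2) - J 0 0 = c * (A 1 + B' 1)"
    by (simp add: algebra_simps)
  also have "A 1 + B' 1 = f z"
    using AB[of 1] by (simp add: B'_def)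
  finally have "J (1/2) (- \<i>/2) + J (1/2) (\<i>/2) - J 0 0 = c * f z" .
  then show ?thesis
    using K_ph_integral(1)[OF h, of \<alpha> z] unfolding J_def e1 e2
    by (simp add: laplace_def c_def h_def)
qed

subsection \<open>The Hilbert space\<close>

text \<open>For Lebesgue measure this is the squared norm up to normalization, for
  \<open>\<mu>\<close> it is the Carleson integral. Values in \<open>ennreal\<close> allow estimates
  before finiteness is known.\<close>

definition wsq :: "(complex ^ 'n::finite) measure \<Rightarrow> real \<Rightarrow> (complex ^ 'n \<Rightarrow> complex) \<Rightarrow> ennreal" where
  "wsq \<nu> \<alpha> f = (\<integral>\<^sup>+ w. ennreal ((cmod (f w))\<^sup>2 * gauss \<alpha> w) \<partial>\<nu>)"

lemma exp_half_squared: "(gauss (2 * \<alpha>) z)\<^sup>2 = gauss \<alpha> z"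
  by (simp add: exp_double[symmetric])

lemma weighted_pow_2: "weighted_pow 2 \<alpha> f z = (cmod (f z))\<^sup>2 * gauss \<alpha> z"
  unfolding weighted_pow_def
  by (simp add: norm_mult power_mult_distrib) (simp add: exp_double[symmetric])

lemma Lp_norm_nonneg: "0 \<le> Lp_norm p \<alpha> f"
  by (simp add: Lp_norm_def)

text \<open>Pluriharmonic functions are continuous, hence Borel, so the completed measure can be
  exchanged for \<open>lborel\<close>.\<close>

lemma PH_2_iff: "f \<in> PH 2 \<alpha> \<longleftrightarrow> pluriharmonic f \<and> wsq lborel \<alpha> f < \<infinity>"
proof -
  have "f \<in> Lp_space 2 \<alpha> \<longleftrightarrow> wsq lborel \<alpha> f < \<infinity>" if "pluriharmonic f"
  proof -
    have [measurable]: "f \<in> borel_measurable borel"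
      using pluriharmonic_continuous[OF that] by (rule borel_measurable_continuous_onI)
    have "f \<in> borel_measurable lebesgue" by (rule measurable_completion) simp
    moreover have "integrable lebesgue (weighted_pow 2 \<alpha> f) \<longleftrightarrow> integrable lborel (weighted_pow 2 \<alpha> f)"
      unfolding weighted_pow_2[abs_def] by (rule integrable_completion) simp
    ultimately show ?thesis
      by (simp add: Lp_space_def weighted_pow_2[abs_def] integrable_iff_bounded wsq_def)
  qed
  then show ?thesis by (auto simp: PH_def)
qed

lemma PH_measurable: "f \<in> PH 2 \<alpha> \<Longrightarrow> f \<in> borel_measurable borel"
  by (rule borel_measurable_continuous_onI[OF pluriharmonic_continuous]) (simp add: PH_2_iff)

lemma wsq_eq_Lp_norm:
  fixes f :: "complex ^ 'n::finite \<Rightarrow> complex"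
  assumes \<alpha>: "\<alpha> > 0" and f: "f \<in> PH 2 \<alpha>"
  shows "wsq lborel \<alpha> f = ennreal ((pi * \<alpha>) ^ CARD('n) * (Lp_norm 2 \<alpha> f)\<^sup>2)"
proof -
  have [measurable]: "f \<in> borel_measurable borel" by (rule PH_measurable[OF f])
  let ?I = "LINT z|lborel. weighted_pow 2 \<alpha> f z"
  have "(LINT z|lebesgue. weighted_pow 2 \<alpha> f z) = ?I"
    unfolding weighted_pow_2 by (rule integral_completion) simp
  moreover have I: "?I \<ge> 0" by (rule Bochner_Integration.integral_nonneg) (simp add: weighted_pow_def)
  ultimately have "(Lp_norm 2 \<alpha> f)\<^sup>2 = 2 ^ CARD('n) / (2 * pi * \<alpha>) ^ CARD('n) * ?I"
    using \<alpha> by (simp add: Lp_norm_def powr_half_sqrt)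
  also have "2 ^ CARD('n) / (2 * pi * \<alpha>) ^ CARD('n) = 1 / (pi * \<alpha>) ^ CARD('n)"
    by (simp add: power_mult_distrib)
  finally have "?I = (pi * \<alpha>) ^ CARD('n) * (Lp_norm 2 \<alpha> f)\<^sup>2"
    using \<alpha> by simp
  moreover have "integrable lborel (weighted_pow 2 \<alpha> f)"
    using f by (simp add: PH_2_iff weighted_pow_2[abs_def] integrable_iff_bounded wsq_def)
  then have "wsq lborel \<alpha> f = ennreal ?I"
    unfolding wsq_def weighted_pow_2[symmetric] by (intro nn_integral_eq_integral AE_I2) (assumption, simp add: weighted_pow_2)
  ultimately show ?thesis by simp
qed

lemma PH_bounded_iff:
  fixes f :: "nat \<Rightarrow> complex ^ 'n::finite \<Rightarrow> complex"
  assumes \<alpha>: "\<alpha> > 0" and f: "\<And>m. f m \<in> PH 2 \<alpha>"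
  shows "(\<exists>C. \<forall>m. Lp_norm 2 \<alpha> (f m) \<le> C) \<longleftrightarrow> (\<exists>C<\<infinity>. \<forall>m. wsq lborel \<alpha> (f m) \<le> C)"
proof
  assume "\<exists>C. \<forall>m. Lp_norm 2 \<alpha> (f m) \<le> C"
  then obtain C where C: "\<And>m. Lp_norm 2 \<alpha> (f m) \<le> C" by blast
  have "wsq lborel \<alpha> (f m) \<le> ennreal ((pi * \<alpha>) ^ CARD('n) * C\<^sup>2)" for m
    unfolding wsq_eq_Lp_norm[OF \<alpha> f] using \<alpha> C Lp_norm_nonneg
    by (intro ennreal_leI mult_left_mono power_mono) auto
  then show "\<exists>C<\<infinity>. \<forall>m. wsq lborel \<alpha> (f m) \<le> C"
    by (intro exI[of _ "ennreal ((pi * \<alpha>) ^ CARD('n) * C\<^sup>2)"]) auto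
next
  assume "\<exists>C<\<infinity>. \<forall>m. wsq lborel \<alpha> (f m) \<le> C"
  then obtain C where C: "C < \<infinity>" "\<And>m. wsq lborel \<alpha> (f m) \<le> C" by blast
  obtain c where c: "C = ennreal c" "c \<ge> 0" using C(1) by (cases C) auto
  have P: "(pi * \<alpha>) ^ CARD('n) > 0" using \<alpha> by simp
  have "Lp_norm 2 \<alpha> (f m) \<le> sqrt (c / (pi * \<alpha>) ^ CARD('n))" for m
  proof (rule real_le_rsqrt)
    have "(pi * \<alpha>) ^ CARD('n) * (Lp_norm 2 \<alpha> (f m))\<^sup>2 \<le> c"
      using C(2)[of m] c \<alpha> by (simp add: wsq_eq_Lp_norm[OF \<alpha> f] c)
    then show "(Lp_norm 2 \<alpha> (f m))\<^sup>2 \<le> c / (pi * \<alpha>) ^ CARD('n)"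
      using P by (simp add: pos_le_divide_eq mult.commute)
  qed
  then show "\<exists>C. \<forall>m. Lp_norm 2 \<alpha> (f m) \<le> C" by blast
qed

lemma Lp_norm_tendsto_0_iff:
  fixes f :: "nat \<Rightarrow> complex ^ 'n::finite \<Rightarrow> complex"
  assumes \<alpha>: "\<alpha> > 0" and f: "\<And>m. f m \<in> PH 2 \<alpha>"
  shows "(\<lambda>m. Lp_norm 2 \<alpha> (f m)) \<longlonglongrightarrow> 0 \<longleftrightarrow> (\<lambda>m. wsq lborel \<alpha> (f m)) \<longlonglongrightarrow> 0"
proof -
  have "(\<lambda>m. wsq lborel \<alpha> (f m)) \<longlonglongrightarrow> 0 \<longleftrightarrow> (\<lambda>m. (pi * \<alpha>) ^ CARD('n) * (Lp_norm 2 \<alpha> (f m))\<^sup>2) \<longlonglongrightarrow> 0"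
    unfolding wsq_eq_Lp_norm[OF \<alpha> f] ennreal_0[symmetric]
    using \<alpha> by (intro tendsto_ennreal_iff) auto
  also have "\<dots> \<longleftrightarrow> (\<lambda>m. (Lp_norm 2 \<alpha> (f m))\<^sup>2) \<longlonglongrightarrow> 0"
    using \<alpha> by (intro tendsto_mult_left_iff[where l = 0, simplified]) auto
  also have "\<dots> \<longleftrightarrow> (\<lambda>m. Lp_norm 2 \<alpha> (f m)) \<longlonglongrightarrow> 0"
  proof
    assume "(\<lambda>m. (Lp_norm 2 \<alpha> (f m))\<^sup>2) \<longlonglongrightarrow> 0"
    from tendsto_real_sqrt[OF this] show "(\<lambda>m. Lp_norm 2 \<alpha> (f m)) \<longlonglongrightarrow> 0"
      by (simp add: Lp_norm_nonneg)
  next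
    assume "(\<lambda>m. Lp_norm 2 \<alpha> (f m)) \<longlonglongrightarrow> 0"
    from tendsto_power[OF this, of 2] show "(\<lambda>m. (Lp_norm 2 \<alpha> (f m))\<^sup>2) \<longlonglongrightarrow> 0" by simp
  qed
  finally show ?thesis by simp
qed

lemma gauss_mass_pos:
  assumes \<alpha>: "(\<alpha>::real) > 0"
  shows "gauss_mass TYPE('a::euclidean_space) \<alpha> > 0"
proof -
  have int: "integrable lborel (\<lambda>u :: 'a. gauss \<alpha> u)"
    using gaussian_nn_integral_finite[of "1/\<alpha>", where ?'a = 'a] \<alpha> by (intro integrableI_bounded) auto
  have "gauss_mass TYPE('a) \<alpha> \<noteq> 0"
    unfolding gauss_mass_def
    using ae_filter_eq_bot_iff[of "lborel :: 'a measure"] int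
    by (subst integral_nonneg_eq_0_iff_AE) (auto simp: trivial_limit_def)
  moreover have "gauss_mass TYPE('a) \<alpha> \<ge> 0"
    unfolding gauss_mass_def by (rule Bochner_Integration.integral_nonneg) auto
  ultimately show ?thesis by linarith
qed

lemma PH_exp_moments:
  assumes "\<alpha> > 0" "f \<in> borel_measurable borel" "wsq lborel \<alpha> f < \<infinity>"
  shows "exp_moments lborel (\<lambda>w. f w * of_real (gauss \<alpha> w))"
  using assms by (intro weighted_square_exp_moments exp_linear_gaussian_nn_integral_finite') (auto simp: wsq_def)

lemma PH_reproducing:
  fixes f :: "complex ^ 'n::finite \<Rightarrow> complex"
  assumes "\<alpha> > 0" "f \<in> PH 2 \<alpha>"
  shows "f z = (LINT w|lborel. K_ph \<alpha> z w * (f w * of_real (gauss \<alpha> w)))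
     / of_real (gauss_mass TYPE(complex ^ 'n) \<alpha>)"
  using pluriharmonic_reproducing[OF assms(1), of f z] assms(2) gauss_mass_pos[OF assms(1), where ?'a = "complex ^ 'n"]
  by (simp add: PH_2_iff wsq_def)

text \<open>A function that reproduces itself is a kernel integral and therefore pluriharmonic. The
  criterion involves no derivatives, so it survives pointwise limits.\<close>

lemma PH_if_reproducing:
  fixes f :: "complex ^ 'n::finite \<Rightarrow> complex"
  assumes "\<alpha> > 0" "f \<in> borel_measurable borel" "wsq lborel \<alpha> f < \<infinity>"
    and "\<And>z. f z = (LINT w|lborel. K_ph \<alpha> z w * (f w * of_real (gauss \<alpha> w)))
     / of_real (gauss_mass TYPE(complex ^ 'n) \<alpha>)"
  shows "f \<in> PH 2 \<alpha>"
proof -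
  let ?c = "1 / complex_of_real (gauss_mass TYPE(complex ^ 'n) \<alpha>)"
  let ?h = "\<lambda>w. f w * of_real (gauss \<alpha> w)"
  have h: "exp_moments lborel (\<lambda>w. ?c * ?h w)"
    using exp_moments_lincomb[OF PH_exp_moments[OF assms(1-3)] PH_exp_moments[OF assms(1-3)], of ?c 0] by simp
  have "(LINT w|lborel. K_ph \<alpha> z w * (?c * ?h w)) = f z" for z
    by (subst assms(4)) (simp only: mult.left_commute[of _ ?c] integral_mult_right_zero, simp)
  with K_ph_integral_pluriharmonic[OF h, of \<alpha>] have "pluriharmonic f" by (simp only:) 
  then show ?thesis using assms(3) by (simp add: PH_2_iff)
qed

section \<open>Linear structure and elementary norm inequalities\<close>

lemma wsq_cmult:
  assumes "sets \<nu> = sets borel" "f \<in> borel_measurable borel"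
  shows "wsq \<nu> \<alpha> (\<lambda>z. c * f z) = ennreal ((cmod c)\<^sup>2) * wsq \<nu> \<alpha> f"
proof -
  note [measurable_cong] = assms(1) and [measurable] = assms(2)
  show ?thesis
    unfolding wsq_def
    by (subst nn_integral_cmult[symmetric]) (auto simp: norm_mult power_mult_distrib ennreal_mult[symmetric] mult.assoc)
qed

lemma wsq_add_le:
  assumes "sets \<nu> = sets borel" "f \<in> borel_measurable borel" "g \<in> borel_measurable borel"
  shows "wsq \<nu> \<alpha> (\<lambda>z. f z + g z) \<le> 2 * wsq \<nu> \<alpha> f + 2 * wsq \<nu> \<alpha> g"
proof -
  note [measurable_cong] = assms(1) and [measurable] = assms(2,3)
  have "(cmod (a + b))\<^sup>2 * e \<le> 2 * ((cmod a)\<^sup>2 * e) + 2 * ((cmod b)\<^sup>2 * e)" if "e \<ge> 0" for a b e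
  proof -
    have "(cmod (a + b))\<^sup>2 \<le> (cmod a + cmod b)\<^sup>2"
      by (intro power_mono norm_triangle_ineq) auto
    also have "\<dots> \<le> 2 * (cmod a)\<^sup>2 + 2 * (cmod b)\<^sup>2"
      using sum_squares_bound[of "cmod a" "cmod b"] by (simp add: power2_sum)
    finally have "(cmod (a + b))\<^sup>2 \<le> 2 * (cmod a)\<^sup>2 + 2 * (cmod b)\<^sup>2" .
    from mult_right_mono[OF this that] show ?thesis by (simp only: distrib_right mult.assoc)
  qed
  then have "wsq \<nu> \<alpha> (\<lambda>z. f z + g z) \<le> (\<integral>\<^sup>+ w. 2 * ennreal ((cmod (f w))\<^sup>2 * gauss \<alpha> w)
      + 2 * ennreal ((cmod (g w))\<^sup>2 * gauss \<alpha> w) \<partial>\<nu>)"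
    unfolding wsq_def
    by (intro nn_integral_mono) (simp add: ennreal_mult'[symmetric] ennreal_plus[symmetric] flip: ennreal_numeral del: ennreal_plus)
  also have "\<dots> = 2 * wsq \<nu> \<alpha> f + 2 * wsq \<nu> \<alpha> g"
    unfolding wsq_def by (subst nn_integral_add) (auto simp: nn_integral_cmult)
  finally show ?thesis .
qed

lemma PH_cmult:
  assumes \<alpha>: "\<alpha> > 0" and f: "f \<in> PH 2 \<alpha>"
  shows "(\<lambda>z. c * f z) \<in> PH 2 \<alpha>"
proof (rule PH_if_reproducing[OF \<alpha>])
  have [measurable]: "f \<in> borel_measurable borel" by (rule PH_measurable[OF f])
  show "(\<lambda>z. c * f z) \<in> borel_measurable borel" by measurable
  show "wsq lborel \<alpha> (\<lambda>z. c * f z) < \<infinity>"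
    using f by (subst wsq_cmult) (auto simp: PH_2_iff ennreal_mult_less_top)
  show "c * f z = (LINT w|lborel. K_ph \<alpha> z w * (c * f w * of_real (gauss \<alpha> w)))
     / of_real (gauss_mass TYPE(complex ^ 'a) \<alpha>)" for z
    by (subst PH_reproducing[OF \<alpha> f])
       (simp only: mult.left_commute[of _ c] mult.assoc integral_mult_right_zero times_divide_eq_right)
qed

lemma PH_add:
  assumes f: "f \<in> PH 2 \<alpha>" and g: "g \<in> PH 2 \<alpha>"
  shows "(\<lambda>z. f z + g z) \<in> PH 2 \<alpha>"
  using f g wsq_add_le[OF _ PH_measurable[OF f] PH_measurable[OF g], of lborel \<alpha>] pluriharmonic_add
  by (auto simp: PH_2_iff ennreal_mult_less_top intro: le_less_trans)

lemma PH_diff: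
  assumes \<alpha>: "\<alpha> > 0" and f: "f \<in> PH 2 \<alpha>" and g: "g \<in> PH 2 \<alpha>"
  shows "(\<lambda>z. f z - g z) \<in> PH 2 \<alpha>"
  using PH_add[OF f PH_cmult[OF \<alpha> g, of "- 1"]] by simp

lemma wsq_diff_le:
  assumes "sets \<nu> = sets borel" "f \<in> borel_measurable borel" "g \<in> borel_measurable borel"
  shows "wsq \<nu> \<alpha> (\<lambda>z. f z - g z) \<le> 2 * wsq \<nu> \<alpha> f + 2 * wsq \<nu> \<alpha> g"
proof -
  have "wsq \<nu> \<alpha> (\<lambda>z. - g z) = wsq \<nu> \<alpha> g" by (simp add: wsq_def)
  then show ?thesis
    using wsq_add_le[of \<nu> f "\<lambda>z. - g z" \<alpha>] assms by simp
qed

subsection \<open>Kernel estimates\<close>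

lemma K_ph_sym: "K_ph \<alpha> z w = K_ph \<alpha> w z"
  by (simp add: K_ph_def)

lemma K_ph_real: "K_ph \<alpha> z w = of_real (2 * Re (exp (herm z w / of_real \<alpha>)) - 1)"
proof -
  have "exp (herm w z / of_real \<alpha>) = cnj (exp (herm z w / of_real \<alpha>))"
    by (simp add: exp_cnj cnj_herm)
  then show ?thesis by (simp add: K_ph_def complex_eq_iff)
qed

text \<open>An envelope of the weighted kernel fit for a Schur test: it is symmetric, and its
  Lebesgue integral in one variable does not depend on the other.\<close>

definition kap :: "real \<Rightarrow> 'a::euclidean_space \<Rightarrow> 'a \<Rightarrow> real" where
  "kap \<alpha> z w = 3 * (gauss (2 * \<alpha>) (z - w) + gauss (2 * \<alpha>) (z + w))"

lemma kap_nonneg: "0 \<le> kap \<alpha> z w"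
  by (simp add: kap_def)

lemma kap_sym: "kap \<alpha> z w = kap \<alpha> w z"
  by (simp add: kap_def norm_minus_commute add.commute)

lemma kap_le: "\<alpha> > 0 \<Longrightarrow> kap \<alpha> z w \<le> 6"
proof -
  assume "\<alpha> > 0"
  then have "gauss (2 * \<alpha>) (z - w) \<le> 1" "gauss (2 * \<alpha>) (z + w) \<le> 1"
    by auto
  moreover have "3 * (a + b) \<le> 6" if "a \<le> 1" "b \<le> 1" for a b :: real using that by simp
  ultimately show ?thesis unfolding kap_def by blast
qed

lemma kap_measurable [measurable]:
  assumes [measurable]: "f \<in> borel_measurable M" "g \<in> borel_measurable M"
  shows "(\<lambda>x. kap \<alpha> (f x) (g x)) \<in> borel_measurable M"
  unfolding kap_def by measurable

text \<open>Both exponentials of the kernel have modulus \<open>exp x\<close>, and the constant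
  satisfies \<open>1 \<le> exp x + exp (- x)\<close>. Completing squares with the two weights turns
  \<open>exp x\<close> into the Gaussian about \<open>w\<close> and \<open>exp (- x)\<close> into
  the one about \<open>- w\<close>.\<close>

lemma K_ph_bound:
  assumes \<alpha>: "\<alpha> > 0"
  shows "cmod (K_ph \<alpha> z w) * gauss (2 * \<alpha>) z * gauss (2 * \<alpha>) w \<le> kap \<alpha> z w"
proof -
  define x where "x = (z \<bullet> w) / \<alpha>"
  have one_le: "1 \<le> exp x + exp (- x)"
    using exp_gt_zero[of x] exp_gt_zero[of "- x"] one_le_exp_iff[of x] one_le_exp_iff[of "- x"] by linarith
  have "cmod (K_ph \<alpha> z w) \<le> cmod (exp (herm z w / of_real \<alpha>)) + cmod (exp (herm w z / of_real \<alpha>)) + 1"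
    unfolding K_ph_def
    using norm_triangle_ineq4[of "exp (herm z w / of_real \<alpha>) + exp (herm w z / of_real \<alpha>)" 1]
      norm_triangle_ineq[of "exp (herm z w / of_real \<alpha>)" "exp (herm w z / of_real \<alpha>)"]
    unfolding norm_one by linarith
  also have "\<dots> = 2 * exp x + 1"
    by (simp add: x_def Re_herm Re_divide_of_real inner_commute)
  also have "\<dots> \<le> 3 * (exp x + exp (- x))"
    using one_le exp_gt_zero[of "- x"] by argo
  finally have "cmod (K_ph \<alpha> z w) \<le> 3 * (exp x + exp (- x))" .
  then have "cmod (K_ph \<alpha> z w) * (gauss (2 * \<alpha>) z * gauss (2 * \<alpha>) w)
     \<le> 3 * (exp x + exp (- x)) * (gauss (2 * \<alpha>) z * gauss (2 * \<alpha>) w)"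
    by (rule mult_right_mono) simp
  also have "\<dots> = 3 * (exp (x + (- (norm z)\<^sup>2 / (2 * \<alpha>) + - (norm w)\<^sup>2 / (2 * \<alpha>)))
      + exp (- x + (- (norm z)\<^sup>2 / (2 * \<alpha>) + - (norm w)\<^sup>2 / (2 * \<alpha>))))"
    by (simp only: exp_add ring_distribs mult.assoc)
  also have "x + (- (norm z)\<^sup>2 / (2 * \<alpha>) + - (norm w)\<^sup>2 / (2 * \<alpha>)) = - (norm (z - w))\<^sup>2 / (2 * \<alpha>)"
    using \<alpha> by (simp add: x_def power2_norm_eq_inner inner_diff_left inner_diff_right inner_commute field_simps)
  also have "- x + (- (norm z)\<^sup>2 / (2 * \<alpha>) + - (norm w)\<^sup>2 / (2 * \<alpha>)) = - (norm (z + w))\<^sup>2 / (2 * \<alpha>)"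
    using \<alpha> by (simp add: x_def power2_norm_eq_inner inner_add_left inner_add_right inner_commute field_simps)
  finally show ?thesis by (simp add: kap_def mult.assoc)
qed

text \<open>The Cauchy-Schwarz half of a Schur test: \<open>kap\<close> is split into two square
  roots, one kept alone and one multiplied with \<open>f\<close>.\<close>

lemma kernel_integral_bound:
  fixes f :: "complex ^ 'n::finite \<Rightarrow> complex"
  assumes \<alpha>: "\<alpha> > 0" and \<nu>: "sets \<nu> = sets borel" and f: "f \<in> borel_measurable borel"
  shows "ennreal ((cmod (LINT w|\<nu>. K_ph \<alpha> z w * (f w * of_real (gauss \<alpha> w))))\<^sup>2 * gauss \<alpha> z)
    \<le> (\<integral>\<^sup>+ w. ennreal (kap \<alpha> z w) \<partial>\<nu>)
      * (\<integral>\<^sup>+ w. ennreal (kap \<alpha> z w) * ennreal ((cmod (f w))\<^sup>2 * gauss \<alpha> w) \<partial>\<nu>)"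
    (is "ennreal ((cmod (LINT w|\<nu>. ?g w))\<^sup>2 * _) \<le> ?R")
proof (cases "integrable \<nu> ?g")
  \<comment> \<open>The Bochner integral of a non-integrable function is 0, so the left side
    vanishes.\<close>
  case False
  then show ?thesis by (simp add: not_integrable_integral_eq)
next
  case True
  note [measurable_cong] = \<nu> and [measurable] = f
  define E where "E w = gauss (2 * \<alpha>) w" for w :: "complex ^ 'n"
  have E2: "gauss \<alpha> w = E w * E w" for w
    using exp_half_squared[of w \<alpha>] by (simp add: E_def power2_eq_square)
  have E0: "E w \<ge> 0" for w by (simp add: E_def)
  have [measurable]: "E \<in> borel_measurable borel" unfolding E_def by measurable
  have "ennreal (cmod (LINT w|\<nu>. ?g w) * E z) \<le> (\<integral>\<^sup>+ w. ennreal (cmod (?g w)) \<partial>\<nu>) * ennreal (E z)"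
    using integral_norm_bound_ennreal[OF True] by (simp add: ennreal_mult' mult_right_mono E0)
  also have "\<dots> = (\<integral>\<^sup>+ w. ennreal (cmod (?g w)) * ennreal (E z) \<partial>\<nu>)"
    using True by (intro nn_integral_multc[symmetric]) auto
  also have "\<dots> \<le> (\<integral>\<^sup>+ w. ennreal (sqrt (kap \<alpha> z w)) * ennreal (sqrt (kap \<alpha> z w) * (cmod (f w) * E w)) \<partial>\<nu>)"
  proof (intro nn_integral_mono)
    fix w
    have "cmod (?g w) * E z = (cmod (K_ph \<alpha> z w) * E z * E w) * (cmod (f w) * E w)"
      by (simp only: norm_mult norm_of_real E2) (simp add: E0)
    also have "\<dots> \<le> kap \<alpha> z w * (cmod (f w) * E w)"
      using K_ph_bound[OF \<alpha>, of z w] by (intro mult_right_mono) (auto simp: E_def)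
    also have "\<dots> = sqrt (kap \<alpha> z w) * (sqrt (kap \<alpha> z w) * (cmod (f w) * E w))"
      by (simp add: mult.assoc[symmetric] kap_nonneg)
    finally show "ennreal (cmod (?g w)) * ennreal (E z) \<le> ennreal (sqrt (kap \<alpha> z w)) * ennreal (sqrt (kap \<alpha> z w) * (cmod (f w) * E w))"
      by (simp add: ennreal_mult[symmetric] E0 kap_nonneg ennreal_leI)
  qed
  finally have "(ennreal (cmod (LINT w|\<nu>. ?g w) * E z))\<^sup>2 \<le> (\<integral>\<^sup>+ w. ennreal (sqrt (kap \<alpha> z w)) * ennreal (sqrt (kap \<alpha> z w) * (cmod (f w) * E w)) \<partial>\<nu>)\<^sup>2"
    by (intro power_mono) auto
  also have "\<dots> \<le> (\<integral>\<^sup>+ w. ennreal (sqrt (kap \<alpha> z w)) ^ 2 \<partial>\<nu>) * (\<integral>\<^sup>+ w. ennreal (sqrt (kap \<alpha> z w) * (cmod (f w) * E w)) ^ 2 \<partial>\<nu>)"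
    by (rule Cauchy_Schwarz_nn_integral) measurable
  also have "\<dots> = ?R"
  proof -
    have "ennreal (sqrt (kap \<alpha> z w)) ^ 2 = ennreal (kap \<alpha> z w)" for w
      by (simp add: ennreal_power kap_nonneg)
    moreover have "ennreal (sqrt (kap \<alpha> z w) * (cmod (f w) * E w)) ^ 2 = ennreal (kap \<alpha> z w) * ennreal ((cmod (f w))\<^sup>2 * gauss \<alpha> w)" for w
    proof -
      have "(sqrt (kap \<alpha> z w) * (cmod (f w) * E w))\<^sup>2 = kap \<alpha> z w * ((cmod (f w))\<^sup>2 * gauss \<alpha> w)"
        by (simp only: power_mult_distrib real_sqrt_pow2[OF kap_nonneg] E2 power2_eq_square[of "E w"])
      then show ?thesis
        by (subst ennreal_power) (simp_all add: E0 kap_nonneg ennreal_mult)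
    qed
    ultimately show ?thesis by simp
  qed
  also have "(ennreal (cmod (LINT w|\<nu>. ?g w) * E z))\<^sup>2 = ennreal ((cmod (LINT w|\<nu>. ?g w))\<^sup>2 * gauss \<alpha> z)"
  proof -
    have "(cmod (LINT w|\<nu>. ?g w) * E z)\<^sup>2 = (cmod (LINT w|\<nu>. ?g w))\<^sup>2 * gauss \<alpha> z"
      by (simp only: power_mult_distrib E2 power2_eq_square[of "E z"])
    then show ?thesis
      by (subst ennreal_power) (simp_all add: E0)
  qed
  finally show ?thesis .
qed

lemma kap_integral:
  fixes z :: "'a::euclidean_space"
  shows "(\<integral>\<^sup>+ w. ennreal (kap \<alpha> z w) \<partial>lborel) = (\<integral>\<^sup>+ w. ennreal (kap \<alpha> (0::'a) w) \<partial>lborel)"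
proof -
  let ?g = "\<lambda>x :: 'a. ennreal (gauss (2 * \<alpha>) x)"
  have shift: "(\<integral>\<^sup>+ w. 3 * ?g (c + w) \<partial>lborel) = (\<integral>\<^sup>+ w. 3 * ?g w \<partial>lborel)" for c
    by (rule nn_integral_lborel_translate[where f = "\<lambda>w. 3 * ?g w"]) measurable
  have "(\<integral>\<^sup>+ w. ennreal (kap \<alpha> z w) \<partial>lborel) = (\<integral>\<^sup>+ w. 3 * ?g w \<partial>lborel) + (\<integral>\<^sup>+ w. 3 * ?g w \<partial>lborel)" for z :: 'a
  proof -
    have "kap \<alpha> z w = 3 * gauss (2 * \<alpha>) (- z + w) + 3 * gauss (2 * \<alpha>) (z + w)" for w
      by (simp add: kap_def norm_minus_commute)
    then have "(\<integral>\<^sup>+ w. ennreal (kap \<alpha> z w) \<partial>lborel) = (\<integral>\<^sup>+ w. 3 * ?g (- z + w) + 3 * ?g (z + w) \<partial>lborel)"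
      by (simp add: ennreal_mult')
    also have "\<dots> = (\<integral>\<^sup>+ w. 3 * ?g (- z + w) \<partial>lborel) + (\<integral>\<^sup>+ w. 3 * ?g (z + w) \<partial>lborel)"
      by (intro nn_integral_add) measurable
    also have "\<dots> = (\<integral>\<^sup>+ w. 3 * ?g w \<partial>lborel) + (\<integral>\<^sup>+ w. 3 * ?g w \<partial>lborel)"
      by (simp only: shift)
    finally show ?thesis .
  qed
  then show ?thesis by simp
qed

lemma kap_integral_finite:
  assumes "(\<alpha>::real) > 0"
  shows "(\<integral>\<^sup>+ w. ennreal (kap \<alpha> (0::'a::euclidean_space) w) \<partial>lborel) < \<infinity>"
proof -
  have "ennreal (kap \<alpha> (0::'a) w) = 6 * ennreal (exp (- (1 / (2 * \<alpha>)) * (norm w)\<^sup>2))" for w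
    by (simp add: kap_def ennreal_mult' flip: ennreal_numeral)
  then show ?thesis
    using gaussian_nn_integral_finite[of "1 / (2 * \<alpha>)", where ?'a = 'a] assms
    by (simp only:) (subst nn_integral_cmult, auto simp: ennreal_mult_less_top)
qed

text \<open>The reproducing formula combined with the Schur estimate, whose first factor does not
  depend on \<open>z\<close>. The weight \<open>kap \<alpha> z w\<close> stays on the right because
  its locality is what later gives decay at infinity and averages of \<open>\<mu>\<close>.\<close>

lemma PH_pointwise:
  assumes \<alpha>: "\<alpha> > 0"
  obtains D where "D < \<infinity>"
    "\<And>(f :: complex ^ 'n::finite \<Rightarrow> complex) z. f \<in> PH 2 \<alpha> \<Longrightarrow> ennreal ((cmod (f z))\<^sup>2 * gauss \<alpha> z)
      \<le> D * (\<integral>\<^sup>+ w. ennreal (kap \<alpha> z w) * ennreal ((cmod (f w))\<^sup>2 * gauss \<alpha> w) \<partial>lborel)"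
proof -
  define c where "c = gauss_mass TYPE(complex ^ 'n) \<alpha>"
  have c: "c > 0" unfolding c_def by (rule gauss_mass_pos[OF \<alpha>])
  define D where "D = ennreal (1 / c\<^sup>2) * (\<integral>\<^sup>+ w. ennreal (kap \<alpha> (0 :: complex ^ 'n) w) \<partial>lborel)"
  show ?thesis
  proof (rule that[of D])
    show "D < \<infinity>" unfolding D_def using kap_integral_finite[OF \<alpha>, where ?'a = "complex ^ 'n"] by (simp add: ennreal_mult_less_top)
    fix f :: "complex ^ 'n \<Rightarrow> complex" and z assume f: "f \<in> PH 2 \<alpha>"
    define h where "h = (LINT w|lborel. K_ph \<alpha> z w * (f w * of_real (gauss \<alpha> w)))"
    have "f z = h / of_real c"
      unfolding h_def c_def by (rule PH_reproducing[OF \<alpha> f])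
    then have "ennreal ((cmod (f z))\<^sup>2 * gauss \<alpha> z) = ennreal (1 / c\<^sup>2) * ennreal ((cmod h)\<^sup>2 * gauss \<alpha> z)"
      using c by (simp add: norm_divide power_divide ennreal_mult[symmetric])
    also have "\<dots> \<le> D * (\<integral>\<^sup>+ w. ennreal (kap \<alpha> z w) * ennreal ((cmod (f w))\<^sup>2 * gauss \<alpha> w) \<partial>lborel)"
      using kernel_integral_bound[OF \<alpha> _ PH_measurable[OF f], of lborel z]
      unfolding D_def h_def kap_integral[of \<alpha> z] mult.assoc by (intro mult_left_mono) auto
    finally show "ennreal ((cmod (f z))\<^sup>2 * gauss \<alpha> z)
      \<le> D * (\<integral>\<^sup>+ w. ennreal (kap \<alpha> z w) * ennreal ((cmod (f w))\<^sup>2 * gauss \<alpha> w) \<partial>lborel)" .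
  qed
qed

lemma PH_point_evaluation:
  assumes \<alpha>: "\<alpha> > 0"
  obtains D where "D < \<infinity>"
    "\<And>(f :: complex ^ 'n::finite \<Rightarrow> complex) z. f \<in> PH 2 \<alpha> \<Longrightarrow>
      ennreal ((cmod (f z))\<^sup>2 * gauss \<alpha> z) \<le> D * wsq lborel \<alpha> f"
proof -
  obtain D where D: "D < \<infinity>" "\<And>(f :: complex ^ 'n \<Rightarrow> complex) z. f \<in> PH 2 \<alpha> \<Longrightarrow> ennreal ((cmod (f z))\<^sup>2 * gauss \<alpha> z)
      \<le> D * (\<integral>\<^sup>+ w. ennreal (kap \<alpha> z w) * ennreal ((cmod (f w))\<^sup>2 * gauss \<alpha> w) \<partial>lborel)"
    using PH_pointwise[OF \<alpha>] by blast
  show ?thesis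
  proof (rule that[of "D * 6"])
    show "D * 6 < \<infinity>" using D(1) by (simp add: ennreal_mult_less_top)
    fix f :: "complex ^ 'n \<Rightarrow> complex" and z assume f: "f \<in> PH 2 \<alpha>"
    have [measurable]: "f \<in> borel_measurable borel" by (rule PH_measurable[OF f])
    have "(\<integral>\<^sup>+ w. ennreal (kap \<alpha> z w) * ennreal ((cmod (f w))\<^sup>2 * gauss \<alpha> w) \<partial>lborel)
       \<le> (\<integral>\<^sup>+ w. 6 * ennreal ((cmod (f w))\<^sup>2 * gauss \<alpha> w) \<partial>lborel)"
      using ennreal_leI[OF kap_le[OF \<alpha>]] by (intro nn_integral_mono mult_right_mono) auto
    also have "\<dots> = 6 * wsq lborel \<alpha> f"
      unfolding wsq_def by (rule nn_integral_cmult) measurable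
    finally show "ennreal ((cmod (f z))\<^sup>2 * gauss \<alpha> z) \<le> D * 6 * wsq lborel \<alpha> f"
      using D(2)[OF f, of z] by (simp add: mult.assoc) (meson mult_left_mono order_trans zero_le)
  qed
qed

section \<open>Decay at infinity and integration against the measure\<close>

lemma gauss_tendsto_0:
  fixes z :: "nat \<Rightarrow> 'a::euclidean_space"
  assumes \<alpha>: "\<alpha> > 0" and z: "filterlim (\<lambda>m. norm (z m)) at_top sequentially"
  shows "(\<lambda>m. gauss (2 * \<alpha>) (z m + w)) \<longlonglongrightarrow> 0"
proof -
  have "filterlim (\<lambda>m. - norm w + norm (z m)) at_top sequentially"
    by (rule filterlim_tendsto_add_at_top[OF tendsto_const z])
  then have "filterlim (\<lambda>m. norm (z m + w)) at_top sequentially"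
    by (rule filterlim_at_top_mono)
       (use norm_diff_ineq[of "z m" w for m] in \<open>auto intro!: always_eventually simp: algebra_simps\<close>)
  then have "filterlim (\<lambda>m. (norm (z m + w))\<^sup>2) at_top sequentially"
    by (rule filterlim_pow_at_top[rotated]) simp
  then have "filterlim (\<lambda>m. 1 / (2 * \<alpha>) * (norm (z m + w))\<^sup>2) at_top sequentially"
    using \<alpha> by (intro filterlim_tendsto_pos_mult_at_top[OF tendsto_const]) auto
  then have "filterlim (\<lambda>m. - (1 / (2 * \<alpha>) * (norm (z m + w))\<^sup>2)) at_bot sequentially"
    by (simp add: filterlim_uminus_at_bot)
  from filterlim_compose[OF exp_at_bot this] show ?thesis by simp
qed

lemma kap_tendsto_0:
  fixes z :: "nat \<Rightarrow> 'a::euclidean_space"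
  assumes \<alpha>: "\<alpha> > 0" and z: "filterlim (\<lambda>m. norm (z m)) at_top sequentially"
  shows "(\<lambda>m. kap \<alpha> (z m) w) \<longlonglongrightarrow> 0"
  unfolding kap_def
  using tendsto_mult_left[OF tendsto_add[OF gauss_tendsto_0[OF \<alpha> z, of "- w"] gauss_tendsto_0[OF \<alpha> z, of w]], of 3]
  by simp

text \<open>Dominated convergence in the local pointwise bound: \<open>kap\<close> tends to 0 for
  each \<open>w\<close> and never exceeds 6. It disposes of the unidentified limit function in the
  compactness argument.\<close>

lemma PH_decay:
  fixes f :: "complex ^ 'n::finite \<Rightarrow> complex"
  assumes \<alpha>: "\<alpha> > 0" and f: "f \<in> PH 2 \<alpha>" and z: "filterlim (\<lambda>m. norm (z m)) at_top sequentially"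
  shows "(\<lambda>m. ennreal ((cmod (f (z m)))\<^sup>2 * gauss \<alpha> (z m))) \<longlonglongrightarrow> 0"
proof -
  obtain D where D: "D < \<infinity>" "\<And>(f :: complex ^ 'n \<Rightarrow> complex) z. f \<in> PH 2 \<alpha> \<Longrightarrow> ennreal ((cmod (f z))\<^sup>2 * gauss \<alpha> z)
      \<le> D * (\<integral>\<^sup>+ w. ennreal (kap \<alpha> z w) * ennreal ((cmod (f w))\<^sup>2 * gauss \<alpha> w) \<partial>lborel)"
    using PH_pointwise[OF \<alpha>] by blast
  have [measurable]: "f \<in> borel_measurable borel" by (rule PH_measurable[OF f])
  let ?g = "\<lambda>w. (cmod (f w))\<^sup>2 * gauss \<alpha> w"
  have "(\<lambda>m. \<integral>\<^sup>+ w. ennreal (kap \<alpha> (z m) w) * ennreal (?g w) \<partial>lborel) \<longlonglongrightarrow> (\<integral>\<^sup>+ w. 0 \<partial>(lborel :: (complex ^ 'n) measure))"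
  proof (rule nn_integral_dominated_convergence[where w = "\<lambda>w. 6 * ennreal (?g w)"])
    show "(\<integral>\<^sup>+ w. 6 * ennreal (?g w) \<partial>lborel) < \<infinity>"
      using f by (subst nn_integral_cmult) (auto simp: PH_2_iff wsq_def ennreal_mult_less_top)
    show "AE w in lborel. (ennreal (kap \<alpha> (z m) w) * ennreal (?g w)) \<le> 6 * ennreal (?g w)" for m
      using ennreal_leI[OF kap_le[OF \<alpha>]] by (intro AE_I2 mult_right_mono) auto
    show "AE w in lborel. (\<lambda>m. ennreal (kap \<alpha> (z m) w) * ennreal (?g w)) \<longlonglongrightarrow> 0"
    proof (rule AE_I2)
      fix w
      have "(\<lambda>m. ennreal (kap \<alpha> (z m) w * ?g w)) \<longlonglongrightarrow> ennreal (0 * ?g w)"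
        by (intro tendsto_ennrealI tendsto_mult kap_tendsto_0[OF \<alpha> z] tendsto_const)
      then show "(\<lambda>m. ennreal (kap \<alpha> (z m) w) * ennreal (?g w)) \<longlonglongrightarrow> 0"
        by (simp add: ennreal_mult kap_nonneg)
    qed
  qed measurable
  then have "(\<lambda>m. D * (\<integral>\<^sup>+ w. ennreal (kap \<alpha> (z m) w) * ennreal (?g w) \<partial>lborel)) \<longlonglongrightarrow> D * 0"
    using D(1) by (intro ennreal_tendsto_cmult) auto
  then have lim: "(\<lambda>m. D * (\<integral>\<^sup>+ w. ennreal (kap \<alpha> (z m) w) * ennreal (?g w) \<partial>lborel)) \<longlonglongrightarrow> 0"
    by simp
  show ?thesis
    by (rule tendsto_sandwich[OF always_eventually always_eventually tendsto_const[of 0] lim]) (simp_all only: D(2)[OF f] zero_le simp_thms)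
qed

text \<open>The local pointwise bound is integrated against \<open>\<mu>\<close> and Tonelli moves
  the integral onto \<open>kap\<close>. The constant is chosen before \<open>\<mu>\<close> and
  \<open>f\<close>.\<close>

lemma wsq_le_averaged:
  assumes \<alpha>: "\<alpha> > 0"
  obtains D where "D < \<infinity>"
    "\<And>(\<mu> :: (complex ^ 'n::finite) measure) f. sets \<mu> = sets borel \<Longrightarrow> sigma_finite_measure \<mu> \<Longrightarrow> f \<in> PH 2 \<alpha> \<Longrightarrow>
      wsq \<mu> \<alpha> f \<le> D * (\<integral>\<^sup>+ w. (\<integral>\<^sup>+ u. ennreal (kap \<alpha> u w) \<partial>\<mu>) * ennreal ((cmod (f w))\<^sup>2 * gauss \<alpha> w) \<partial>lborel)"
proof -
  obtain D where D: "D < \<infinity>" "\<And>(f :: complex ^ 'n \<Rightarrow> complex) z. f \<in> PH 2 \<alpha> \<Longrightarrow> ennreal ((cmod (f z))\<^sup>2 * gauss \<alpha> z)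
      \<le> D * (\<integral>\<^sup>+ w. ennreal (kap \<alpha> z w) * ennreal ((cmod (f w))\<^sup>2 * gauss \<alpha> w) \<partial>lborel)"
    using PH_pointwise[OF \<alpha>] by blast
  show ?thesis
  proof (rule that[OF D(1)])
    fix \<mu> :: "(complex ^ 'n) measure" and f :: "complex ^ 'n \<Rightarrow> complex"
    assume [measurable_cong]: "sets \<mu> = sets borel" and "sigma_finite_measure \<mu>" and f: "f \<in> PH 2 \<alpha>"
    interpret \<mu>: sigma_finite_measure \<mu> by fact
    interpret pair_sigma_finite \<mu> lborel ..
    have [measurable]: "f \<in> borel_measurable borel" by (rule PH_measurable[OF f])
    let ?g = "\<lambda>w. ennreal ((cmod (f w))\<^sup>2 * gauss \<alpha> w)"
    have "wsq \<mu> \<alpha> f \<le> (\<integral>\<^sup>+ u. D * (\<integral>\<^sup>+ w. ennreal (kap \<alpha> u w) * ?g w \<partial>lborel) \<partial>\<mu>)"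
      unfolding wsq_def by (intro nn_integral_mono D(2)[OF f])
    also have "\<dots> = D * (\<integral>\<^sup>+ u. (\<integral>\<^sup>+ w. ennreal (kap \<alpha> u w) * ?g w \<partial>lborel) \<partial>\<mu>)"
      by (rule nn_integral_cmult) measurable
    also have "(\<integral>\<^sup>+ u. (\<integral>\<^sup>+ w. ennreal (kap \<alpha> u w) * ?g w \<partial>lborel) \<partial>\<mu>) = (\<integral>\<^sup>+ w. (\<integral>\<^sup>+ u. ennreal (kap \<alpha> u w) * ?g w \<partial>\<mu>) \<partial>lborel)"
      by (rule Fubini'[symmetric]) measurable
    also have "\<dots> = (\<integral>\<^sup>+ w. (\<integral>\<^sup>+ u. ennreal (kap \<alpha> u w) \<partial>\<mu>) * ?g w \<partial>lborel)"
      by (intro nn_integral_cong nn_integral_multc) measurable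
    finally show "wsq \<mu> \<alpha> f \<le> D * (\<integral>\<^sup>+ w. (\<integral>\<^sup>+ u. ennreal (kap \<alpha> u w) \<partial>\<mu>) * ?g w \<partial>lborel)" .
  qed
qed

subsection \<open>Averages of the measure\<close>

lemma ennreal_tendsto_0I:
  fixes x :: "nat \<Rightarrow> ennreal"
  assumes "\<And>\<epsilon>::real. \<epsilon> > 0 \<Longrightarrow> eventually (\<lambda>m. x m \<le> ennreal \<epsilon>) sequentially"
  shows "x \<longlonglongrightarrow> 0"
proof (rule order_tendstoI)
  fix a :: ennreal assume "a > 0"
  then obtain b where b: "0 < b" "b < a" using dense by blast
  then obtain e where e: "b = ennreal e" "e > 0" by (cases b) (auto simp: top_unique)
  from assms[OF e(2)] show "eventually (\<lambda>m. x m < a) sequentially"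
    by eventually_elim (use b e in auto)
qed simp

text \<open>If no \<open>R\<close> works, the counterexamples for \<open>R = 0, 1, 2, ...\<close>
  form a sequence that leaves every ball and contradicts the sequential hypothesis.\<close>

lemma vanishing_at_infinity_eps:
  fixes F :: "'a::real_normed_vector \<Rightarrow> ennreal"
  assumes F: "\<And>z. filterlim (\<lambda>m. norm (z m)) at_top sequentially \<Longrightarrow> (\<lambda>m. F (z m)) \<longlonglongrightarrow> 0"
    and \<epsilon>: "\<epsilon> > (0::real)"
  obtains R where "\<And>w. norm w \<ge> R \<Longrightarrow> F w \<le> ennreal \<epsilon>"
proof (rule ccontr)
  assume "\<not> thesis"
  then have "\<forall>R. \<exists>w. norm w \<ge> R \<and> \<not> F w \<le> ennreal \<epsilon>" using that by blast
  then obtain z where z: "\<And>R. norm (z R) \<ge> R" "\<And>R. \<not> F (z R) \<le> ennreal \<epsilon>" by metis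
  have "filterlim (\<lambda>m. norm (z (real m))) at_top sequentially"
    by (rule filterlim_at_top_mono[OF filterlim_real_sequentially]) (simp add: z)
  from F[OF this] have "eventually (\<lambda>m. F (z (real m)) < ennreal \<epsilon>) sequentially"
    using \<epsilon> by (intro order_tendstoD) auto
  then show False using z(2) by (auto simp: eventually_sequentially intro: less_imp_le)
qed

text \<open>On the unit ball about \<open>x\<close> one has
  \<open>(norm y)\<^sup>2 \<le> 2 * (norm x)\<^sup>2 + 2\<close>. Widening
  \<open>2 * \<alpha>\<close> to \<open>4 * \<alpha>\<close> pays for the factor 2, and the summand
  2 becomes \<open>exp (1 / (2 * \<alpha>))\<close>.\<close>

lemma gaussian_le_ball_average:
  fixes x :: "'a::euclidean_space"
  assumes \<alpha>: "\<alpha> > 0"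
  shows "ennreal (gauss (2 * \<alpha>) x)
     \<le> ennreal (exp (1 / (2 * \<alpha>)) / unit_ball_vol (DIM('a)))
       * (\<integral>\<^sup>+ y. indicator (ball x 1) y * ennreal (gauss (4 * \<alpha>) y) \<partial>lborel)"
proof -
  define c where "c = exp (- (norm x)\<^sup>2 / (2 * \<alpha>) - 1 / (2 * \<alpha>))"
  have V: "unit_ball_vol (DIM('a)) > (0::real)" by simp
  have le: "c \<le> gauss (4 * \<alpha>) y" if "y \<in> ball x 1" for y
  proof -
    have "norm y \<le> norm x + 1"
      using that norm_triangle_ineq2[of y x] by (simp add: dist_norm norm_minus_commute)
    then have "(norm y)\<^sup>2 \<le> (norm x + 1)\<^sup>2" by (intro power_mono) auto
    also have "\<dots> \<le> 2 * (norm x)\<^sup>2 + 2"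
      using sum_squares_bound[of "norm x" 1] by (simp add: power2_sum)
    finally have "(norm y)\<^sup>2 / (4 * \<alpha>) \<le> (2 * (norm x)\<^sup>2 + 2) / (4 * \<alpha>)"
      using \<alpha> by (intro divide_right_mono) auto
    also have "\<dots> = (norm x)\<^sup>2 / (2 * \<alpha>) + 1 / (2 * \<alpha>)"
      using \<alpha> by (simp add: field_simps)
    finally show ?thesis by (simp add: c_def)
  qed
  have "ennreal c * ennreal (unit_ball_vol (DIM('a))) = (\<integral>\<^sup>+ y. ennreal c * indicator (ball x 1) y \<partial>lborel)"
    by (subst nn_integral_cmult_indicator) (auto simp: emeasure_ball)
  also have "\<dots> \<le> (\<integral>\<^sup>+ y. indicator (ball x 1) y * ennreal (gauss (4 * \<alpha>) y) \<partial>lborel)"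
    using le by (intro nn_integral_mono) (auto simp: indicator_def intro!: ennreal_leI)
  finally have "ennreal (exp (1 / (2 * \<alpha>)) / unit_ball_vol (DIM('a))) * (ennreal c * ennreal (unit_ball_vol (DIM('a))))
     \<le> ennreal (exp (1 / (2 * \<alpha>)) / unit_ball_vol (DIM('a))) * (\<integral>\<^sup>+ y. indicator (ball x 1) y * ennreal (gauss (4 * \<alpha>) y) \<partial>lborel)"
    by (intro mult_left_mono) auto
  also have "ennreal (exp (1 / (2 * \<alpha>)) / unit_ball_vol (DIM('a))) * (ennreal c * ennreal (unit_ball_vol (DIM('a))))
     = ennreal (gauss (2 * \<alpha>) x)"
    using V order_less_imp_not_eq2[OF V] by (simp add: c_def ennreal_mult'[symmetric] exp_diff exp_minus)
  finally show ?thesis .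
qed

text \<open>Replacing the Gaussian by its ball averages and exchanging the integrals leaves
  \<open>\<mu>\<close> visible only through the masses of unit balls.\<close>

lemma gaussian_integral_le_ball_average:
  fixes w :: "'a::euclidean_space"
  assumes \<alpha>: "\<alpha> > 0" and \<mu>: "sets \<mu> = sets borel" "sigma_finite_measure \<mu>"
  shows "(\<integral>\<^sup>+ u. ennreal (gauss (2 * \<alpha>) (u - w)) \<partial>\<mu>)
     \<le> ennreal (exp (1 / (2 * \<alpha>)) / unit_ball_vol (DIM('a)))
       * (\<integral>\<^sup>+ y. ennreal (gauss (4 * \<alpha>) y) * emeasure \<mu> (ball (w + y) 1) \<partial>lborel)"
    (is "?N \<le> ?C * _")
proof -
  note [measurable_cong] = \<mu>(1)
  interpret \<mu>: sigma_finite_measure \<mu> by fact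
  interpret pair_sigma_finite \<mu> lborel ..
  \<comment> \<open>One condition with two readings: \<open>y\<close> lies in the unit ball about
    \<open>u - w\<close>, and \<open>u\<close> lies in the unit ball about
    \<open>w + y\<close>.\<close>
  define F where "F u y = (if norm (u - w - y) < 1 then ennreal (gauss (4 * \<alpha>) y) else 0)" for u y
  have [measurable]: "(\<lambda>p. F (fst p) (snd p)) \<in> borel_measurable (\<mu> \<Otimes>\<^sub>M lborel)"
    unfolding F_def by measurable
  have "?N \<le> (\<integral>\<^sup>+ u. ?C * (\<integral>\<^sup>+ y. F u y \<partial>lborel) \<partial>\<mu>)"
  proof (intro nn_integral_mono)
    fix u
    have "(\<integral>\<^sup>+ y. indicator (ball (u - w) 1) y * ennreal (gauss (4 * \<alpha>) y) \<partial>lborel) = (\<integral>\<^sup>+ y. F u y \<partial>lborel)"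
      by (intro nn_integral_cong) (simp add: F_def indicator_def dist_norm)
    with gaussian_le_ball_average[OF \<alpha>, of "u - w"]
    show "ennreal (gauss (2 * \<alpha>) (u - w)) \<le> ?C * (\<integral>\<^sup>+ y. F u y \<partial>lborel)" by simp
  qed
  also have "\<dots> = ?C * (\<integral>\<^sup>+ u. (\<integral>\<^sup>+ y. F u y \<partial>lborel) \<partial>\<mu>)"
    by (rule nn_integral_cmult) measurable
  also have "(\<integral>\<^sup>+ u. (\<integral>\<^sup>+ y. F u y \<partial>lborel) \<partial>\<mu>) = (\<integral>\<^sup>+ y. (\<integral>\<^sup>+ u. F u y \<partial>\<mu>) \<partial>lborel)"
    by (rule Fubini'[symmetric]) measurable
  also have "\<dots> = (\<integral>\<^sup>+ y. ennreal (gauss (4 * \<alpha>) y) * emeasure \<mu> (ball (w + y) 1) \<partial>lborel)"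
  proof (rule nn_integral_cong)
    fix y
    have "(\<integral>\<^sup>+ u. F u y \<partial>\<mu>) = (\<integral>\<^sup>+ u. ennreal (gauss (4 * \<alpha>) y) * indicator (ball (w + y) 1) u \<partial>\<mu>)"
      by (intro nn_integral_cong) (simp add: F_def indicator_def dist_norm norm_minus_commute diff_diff_eq)
    also have "\<dots> = ennreal (gauss (4 * \<alpha>) y) * emeasure \<mu> (ball (w + y) 1)"
      by (rule nn_integral_cmult_indicator) (simp add: \<mu>)
    finally show "(\<integral>\<^sup>+ u. F u y \<partial>\<mu>) = ennreal (gauss (4 * \<alpha>) y) * emeasure \<mu> (ball (w + y) 1)" .
  qed
  finally show ?thesis .
qed

lemma kap_integral_split:
  assumes \<mu>: "sets \<mu> = sets borel"
  shows "(\<integral>\<^sup>+ u. ennreal (kap \<alpha> u w) \<partial>\<mu>)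
    = 3 * (\<integral>\<^sup>+ u. ennreal (gauss (2 * \<alpha>) (u - w)) \<partial>\<mu>)
    + 3 * (\<integral>\<^sup>+ u. ennreal (gauss (2 * \<alpha>) (u - - w)) \<partial>\<mu>)"
proof -
  note [measurable_cong] = \<mu>
  have "ennreal (kap \<alpha> u w) = 3 * ennreal (gauss (2 * \<alpha>) (u - w))
      + 3 * ennreal (gauss (2 * \<alpha>) (u - - w))" for u
    by (simp add: kap_def ennreal_mult' distrib_left)
  then show ?thesis
    by (simp only:) (subst nn_integral_add, auto simp: nn_integral_cmult)
qed

lemma ball_measure_measurable:
  fixes \<mu> :: "'a::euclidean_space measure"
  assumes \<mu>: "sets \<mu> = sets borel" "sigma_finite_measure \<mu>"
  shows "(\<lambda>w. emeasure \<mu> (ball w 1)) \<in> borel_measurable borel"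
proof -
  note [measurable_cong] = \<mu>(1)
  interpret \<mu>: sigma_finite_measure \<mu> by fact
  have [measurable]: "(\<lambda>p. if dist (fst p) (snd p) < 1 then 1 else 0 :: ennreal) \<in> borel_measurable (borel \<Otimes>\<^sub>M \<mu>)"
    by measurable
  have "(\<lambda>w :: 'a. \<integral>\<^sup>+ u. (if dist w u < 1 then 1 else 0) \<partial>\<mu>) \<in> borel_measurable borel"
    by measurable
  moreover have "(\<integral>\<^sup>+ u. (if dist w u < 1 then 1 else 0) \<partial>\<mu>) = emeasure \<mu> (ball w 1)" for w
  proof -
    have "(\<integral>\<^sup>+ u. (if dist w u < 1 then 1 else 0) \<partial>\<mu>) = (\<integral>\<^sup>+ u. indicator (ball w 1) u \<partial>\<mu>)"
      by (intro nn_integral_cong) (simp add: indicator_def)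
    then show ?thesis using \<mu> by (simp add: nn_integral_indicator)
  qed
  ultimately show ?thesis by simp
qed

text \<open>A fixed shift \<open>y\<close> does not stop the centres from going to infinity, so the
  ball masses tend to 0 for each \<open>y\<close>, with the Gaussian times \<open>S\<close> as
  majorant. The Gaussian about \<open>- w\<close> is handled by the sequence
  \<open>- z\<close>.\<close>

lemma kap_average_vanishes:
  fixes \<mu> :: "'a::euclidean_space measure"
  assumes \<alpha>: "\<alpha> > 0" and \<mu>: "sets \<mu> = sets borel" "sigma_finite_measure \<mu>"
    and S: "S < \<infinity>" "\<And>w. emeasure \<mu> (ball w 1) \<le> S"
    and lim: "\<And>z. filterlim (\<lambda>m. norm (z m)) at_top sequentially \<Longrightarrow> (\<lambda>m. emeasure \<mu> (ball (z m) 1)) \<longlonglongrightarrow> 0"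
  obtains S' where "S' < \<infinity>" "\<And>w. (\<integral>\<^sup>+ u. ennreal (kap \<alpha> u w) \<partial>\<mu>) \<le> S'"
    "\<And>z. filterlim (\<lambda>m. norm (z m)) at_top sequentially \<Longrightarrow> (\<lambda>m. \<integral>\<^sup>+ u. ennreal (kap \<alpha> u (z m)) \<partial>\<mu>) \<longlonglongrightarrow> 0"
proof -
  note [measurable] = ball_measure_measurable[OF \<mu>]
  define C where "C = ennreal (exp (1 / (2 * \<alpha>)) / unit_ball_vol (DIM('a)))"
  define g where "g y = ennreal (gauss (4 * \<alpha>) y)" for y :: 'a
  have [measurable]: "g \<in> borel_measurable borel" unfolding g_def by measurable
  define N where "N w = (\<integral>\<^sup>+ u. ennreal (gauss (2 * \<alpha>) (u - w)) \<partial>\<mu>)" for w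
  have N: "N w \<le> C * (\<integral>\<^sup>+ y. g y * emeasure \<mu> (ball (w + y) 1) \<partial>lborel)" for w
    unfolding N_def C_def g_def by (rule gaussian_integral_le_ball_average[OF \<alpha> \<mu>])
  have C: "C < \<infinity>" by (simp add: C_def)
  have g: "(\<integral>\<^sup>+ y. g y \<partial>lborel) < \<infinity>"
    unfolding g_def using gaussian_nn_integral_finite[of "1 / (4 * \<alpha>)", where ?'a = 'a] \<alpha> by simp
  have gS: "(\<integral>\<^sup>+ y. g y * S \<partial>lborel) < \<infinity>"
    using g S(1) by (subst nn_integral_multc) (auto simp: ennreal_mult_less_top)
  have split: "(\<integral>\<^sup>+ u. ennreal (kap \<alpha> u w) \<partial>\<mu>) = 3 * N w + 3 * N (- w)" for w
    unfolding N_def by (rule kap_integral_split[OF \<mu>(1)])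
  have N_le: "N w \<le> C * (\<integral>\<^sup>+ y. g y * S \<partial>lborel)" for w
    by (rule order_trans[OF N]) (intro mult_left_mono nn_integral_mono S; simp)
  have N_lim: "(\<lambda>m. N (z m)) \<longlonglongrightarrow> 0" if z: "filterlim (\<lambda>m. norm (z m)) at_top sequentially" for z
  proof -
    have "(\<lambda>m. \<integral>\<^sup>+ y. g y * emeasure \<mu> (ball (z m + y) 1) \<partial>lborel) \<longlonglongrightarrow> (\<integral>\<^sup>+ y. 0 \<partial>(lborel :: 'a measure))"
    proof (rule nn_integral_dominated_convergence[where w = "\<lambda>y. g y * S"])
      show "AE y in lborel. (\<lambda>m. g y * emeasure \<mu> (ball (z m + y) 1)) \<longlonglongrightarrow> 0"
      proof (rule AE_I2)
        fix y :: 'a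
        have "filterlim (\<lambda>m. - norm y + norm (z m)) at_top sequentially"
          by (rule filterlim_tendsto_add_at_top[OF tendsto_const z])
        then have "filterlim (\<lambda>m. norm (z m + y)) at_top sequentially"
          by (rule filterlim_at_top_mono)
             (use norm_diff_ineq[of "z m" y for m] in \<open>auto intro!: always_eventually simp: algebra_simps\<close>)
        from lim[OF this] have "(\<lambda>m. g y * emeasure \<mu> (ball (z m + y) 1)) \<longlonglongrightarrow> g y * 0"
          by (intro ennreal_tendsto_cmult) (simp_all add: g_def)
        then show "(\<lambda>m. g y * emeasure \<mu> (ball (z m + y) 1)) \<longlonglongrightarrow> 0" by simp
      qed
      show "AE y in lborel. g y * emeasure \<mu> (ball (z m + y) 1) \<le> g y * S" for m
        by (intro AE_I2 mult_left_mono S) simp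
    qed (use gS in measurable)
    then have "(\<lambda>m. C * (\<integral>\<^sup>+ y. g y * emeasure \<mu> (ball (z m + y) 1) \<partial>lborel)) \<longlonglongrightarrow> C * 0"
      using C by (intro ennreal_tendsto_cmult) auto
    then have l: "(\<lambda>m. C * (\<integral>\<^sup>+ y. g y * emeasure \<mu> (ball (z m + y) 1) \<partial>lborel)) \<longlonglongrightarrow> 0" by simp
    show ?thesis
      by (rule tendsto_sandwich[OF always_eventually always_eventually tendsto_const[of 0] l]) (simp_all only: N zero_le simp_thms)
  qed
  show ?thesis
  proof (rule that[of "3 * (C * (\<integral>\<^sup>+ y. g y * S \<partial>lborel)) + 3 * (C * (\<integral>\<^sup>+ y. g y * S \<partial>lborel))"])
    show "3 * (C * (\<integral>\<^sup>+ y. g y * S \<partial>lborel)) + 3 * (C * (\<integral>\<^sup>+ y. g y * S \<partial>lborel)) < \<infinity>"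
      using C gS by (simp add: ennreal_mult_less_top)
    show "(\<integral>\<^sup>+ u. ennreal (kap \<alpha> u w) \<partial>\<mu>) \<le> 3 * (C * (\<integral>\<^sup>+ y. g y * S \<partial>lborel)) + 3 * (C * (\<integral>\<^sup>+ y. g y * S \<partial>lborel))" for w
      unfolding split by (intro add_mono mult_left_mono N_le) auto
    fix z :: "nat \<Rightarrow> 'a" assume z: "filterlim (\<lambda>m. norm (z m)) at_top sequentially"
    then have z': "filterlim (\<lambda>m. norm (- z m)) at_top sequentially" by simp
    have "(\<lambda>m. 3 * N (z m) + 3 * N (- z m)) \<longlonglongrightarrow> 3 * 0 + 3 * 0"
      by (intro tendsto_add ennreal_tendsto_cmult N_lim[OF z] N_lim[OF z']) auto
    then show "(\<lambda>m. \<integral>\<^sup>+ u. ennreal (kap \<alpha> u (z m)) \<partial>\<mu>) \<longlonglongrightarrow> 0"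
      unfolding split by simp
  qed
qed

text \<open>The averaged integral is split at a large ball. Outside, \<open>M\<close> is at most
  \<open>\<delta>\<close> and the norms are bounded; inside, \<open>M\<close> is at most
  \<open>S\<close>, and point evaluation supplies a constant majorant for dominated
  convergence.\<close>

lemma wsq_tendsto_0:
  fixes f :: "nat \<Rightarrow> complex ^ 'n::finite \<Rightarrow> complex"
  assumes \<alpha>: "\<alpha> > 0" and \<mu>: "sets \<mu> = sets borel" "sigma_finite_measure \<mu>"
    and S: "S < \<infinity>" "\<And>w. (\<integral>\<^sup>+ u. ennreal (kap \<alpha> u w) \<partial>\<mu>) \<le> S"
    and lim: "\<And>z. filterlim (\<lambda>m. norm (z m)) at_top sequentially \<Longrightarrow> (\<lambda>m. \<integral>\<^sup>+ u. ennreal (kap \<alpha> u (z m)) \<partial>\<mu>) \<longlonglongrightarrow> 0"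
    and f: "\<And>m. f m \<in> PH 2 \<alpha>" and C: "C < \<infinity>" "\<And>m. wsq lborel \<alpha> (f m) \<le> C"
    and f0: "\<And>z. (\<lambda>m. f m z) \<longlonglongrightarrow> 0"
  shows "(\<lambda>m. wsq \<mu> \<alpha> (f m)) \<longlonglongrightarrow> 0"
proof -
  define M where "M w = (\<integral>\<^sup>+ u. ennreal (kap \<alpha> u w) \<partial>\<mu>)" for w
  have [measurable]: "f m \<in> borel_measurable borel" for m by (rule PH_measurable[OF f])
  define g where "g m w = ennreal ((cmod (f m w))\<^sup>2 * gauss \<alpha> w)" for m w
  have [measurable]: "g m \<in> borel_measurable borel" for m unfolding g_def by measurable
  have wsq_g: "wsq lborel \<alpha> (f m) = (\<integral>\<^sup>+ w. g m w \<partial>lborel)" for m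
    by (simp add: wsq_def g_def)
  obtain D where D_fin: "D < \<infinity>" and D0: "\<And>(\<mu> :: (complex ^ 'n) measure) f. sets \<mu> = sets borel \<Longrightarrow> sigma_finite_measure \<mu> \<Longrightarrow> f \<in> PH 2 \<alpha> \<Longrightarrow>
      wsq \<mu> \<alpha> f \<le> D * (\<integral>\<^sup>+ w. (\<integral>\<^sup>+ u. ennreal (kap \<alpha> u w) \<partial>\<mu>) * ennreal ((cmod (f w))\<^sup>2 * gauss \<alpha> w) \<partial>lborel)"
    using wsq_le_averaged[OF \<alpha>] by blast
  have D: "wsq \<mu> \<alpha> (f m) \<le> D * (\<integral>\<^sup>+ w. M w * g m w \<partial>lborel)" for m
    unfolding M_def g_def by (rule D0[OF \<mu> f])
  obtain D' where D'_fin: "D' < \<infinity>" and D'0: "\<And>(f :: complex ^ 'n \<Rightarrow> complex) z. f \<in> PH 2 \<alpha> \<Longrightarrow>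
      ennreal ((cmod (f z))\<^sup>2 * gauss \<alpha> z) \<le> D' * wsq lborel \<alpha> f"
    using PH_point_evaluation[OF \<alpha>] by blast
  have D': "g m z \<le> D' * wsq lborel \<alpha> (f m)" for m z
    unfolding g_def by (rule D'0[OF f])
  have g_le: "g m z \<le> D' * C" for m z
    by (rule order_trans[OF D']) (intro mult_left_mono C; simp)
  have "(\<lambda>m. \<integral>\<^sup>+ w. M w * g m w \<partial>lborel) \<longlonglongrightarrow> 0"
  proof (rule ennreal_tendsto_0I)
    fix \<epsilon> :: real assume \<epsilon>: "\<epsilon> > 0"
    obtain c where c: "C = ennreal c" "c \<ge> 0" using C(1) by (cases C) auto
    \<comment> \<open>The outer part costs at most \<open>\<delta> * c\<close>; adding 1 in the
      denominator allows \<open>c = 0\<close>.\<close>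
    define \<delta> where "\<delta> = \<epsilon> / (2 * (c + 1))"
    have \<delta>: "\<delta> > 0" "\<delta> * c \<le> \<epsilon> / 2"
      using \<epsilon> c(2) by (auto simp: \<delta>_def field_simps)
    obtain R where R: "\<And>w. norm w \<ge> R \<Longrightarrow> M w \<le> ennreal \<delta>"
      using vanishing_at_infinity_eps[OF _ \<delta>(1), of M] lim unfolding M_def by blast
    have [measurable]: "ball (0 :: complex ^ 'n) R \<in> sets borel" by simp
    have "(\<lambda>m. \<integral>\<^sup>+ w. g m w * indicator (ball 0 R) w \<partial>lborel) \<longlonglongrightarrow> (\<integral>\<^sup>+ w. 0 \<partial>(lborel :: (complex ^ 'n) measure))"
    proof (rule nn_integral_dominated_convergence[where w = "\<lambda>w. D' * C * indicator (ball 0 R) w"])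
      show "(\<integral>\<^sup>+ w. D' * C * indicator (ball (0 :: complex ^ 'n) R) w \<partial>lborel) < \<infinity>"
        using C(1) D'_fin emeasure_lborel_ball_finite[of "0 :: complex ^ 'n" R]
        by (subst nn_integral_cmult_indicator) (auto simp: ennreal_mult_less_top less_top)
      show "AE w in lborel. (\<lambda>m. g m w * indicator (ball 0 R) w) \<longlonglongrightarrow> 0"
      proof (rule AE_I2)
        fix w
        have "(\<lambda>m. ennreal ((cmod (f m w))\<^sup>2 * gauss \<alpha> w * indicator (ball 0 R) w)) \<longlonglongrightarrow> ennreal ((cmod 0)\<^sup>2 * gauss \<alpha> w * indicator (ball 0 R) w)"
          by (intro tendsto_ennrealI tendsto_intros f0)
        then show "(\<lambda>m. g m w * indicator (ball 0 R) w) \<longlonglongrightarrow> 0"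
          by (cases "w \<in> ball 0 R") (auto simp: g_def)
      qed
      show "AE w in lborel. g m w * indicator (ball 0 R) w \<le> D' * C * indicator (ball 0 R) w" for m
        by (intro AE_I2 mult_right_mono g_le) simp
    qed measurable
    then have "(\<lambda>m. S * (\<integral>\<^sup>+ w. g m w * indicator (ball 0 R) w \<partial>lborel)) \<longlonglongrightarrow> S * 0"
      using S(1) by (intro ennreal_tendsto_cmult) auto
    then have "eventually (\<lambda>m. S * (\<integral>\<^sup>+ w. g m w * indicator (ball 0 R) w \<partial>lborel) < ennreal (\<epsilon> / 2)) sequentially"
      using \<epsilon> by (intro order_tendstoD) (auto simp: ennreal_zero_less_divide)
    then show "eventually (\<lambda>m. (\<integral>\<^sup>+ w. M w * g m w \<partial>lborel) \<le> ennreal \<epsilon>) sequentially"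
    proof eventually_elim
      case (elim m)
      have "(\<integral>\<^sup>+ w. M w * g m w \<partial>lborel) \<le> (\<integral>\<^sup>+ w. S * (g m w * indicator (ball 0 R) w) + ennreal \<delta> * g m w \<partial>lborel)"
      proof (rule nn_integral_mono)
        fix w :: "complex ^ 'n"
        show "M w * g m w \<le> S * (g m w * indicator (ball 0 R) w) + ennreal \<delta> * g m w"
        proof (cases "norm w < R")
          case True
          have "M w * g m w \<le> S * g m w" using S(2)[of w] by (intro mult_right_mono) (auto simp: M_def)
          then show ?thesis using True by (simp add: add_increasing2)
        next
          case False
          then have "M w * g m w \<le> ennreal \<delta> * g m w" using R[of w] by (intro mult_right_mono) auto
          then show ?thesis by (simp add: add_increasing)
        qed
      qed
      also have "\<dots> = S * (\<integral>\<^sup>+ w. g m w * indicator (ball 0 R) w \<partial>lborel) + ennreal \<delta> * wsq lborel \<alpha> (f m)"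
        unfolding wsq_g by (subst nn_integral_add) (auto simp: nn_integral_cmult)
      also have "\<dots> \<le> ennreal (\<epsilon> / 2) + ennreal \<delta> * C"
        using elim C(2) by (intro add_mono mult_left_mono) auto
      also have "\<dots> \<le> ennreal (\<epsilon> / 2) + ennreal (\<epsilon> / 2)"
        using \<delta> c by (intro add_left_mono) (auto simp: ennreal_mult'[symmetric] intro!: ennreal_leI)
      also have "\<dots> = ennreal \<epsilon>" using \<epsilon> by (subst ennreal_plus[symmetric]) auto
      finally show ?case .
    qed
  qed
  then have "(\<lambda>m. D * (\<integral>\<^sup>+ w. M w * g m w \<partial>lborel)) \<longlonglongrightarrow> D * 0"
    using D_fin by (intro ennreal_tendsto_cmult) auto
  then have l: "(\<lambda>m. D * (\<integral>\<^sup>+ w. M w * g m w \<partial>lborel)) \<longlonglongrightarrow> 0" by simp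
  show ?thesis
    by (rule tendsto_sandwich[OF always_eventually always_eventually tendsto_const[of 0] l]) (simp_all only: D zero_le simp_thms)
qed

text \<open>Both halves of a Schur test with different measures: \<open>S\<close> bounds the
  integral of \<open>kap\<close> against \<open>\<mu>\<close>, and after Tonelli the Lebesgue
  integral of \<open>kap\<close> in \<open>z\<close> is constant.\<close>

lemma wsq_toeplitz_le:
  fixes f :: "complex ^ 'n::finite \<Rightarrow> complex"
  assumes \<alpha>: "\<alpha> > 0" and \<mu>: "sets \<mu> = sets borel" "sigma_finite_measure \<mu>"
    and S: "\<And>w. (\<integral>\<^sup>+ u. ennreal (kap \<alpha> u w) \<partial>\<mu>) \<le> S"
    and [measurable]: "f \<in> borel_measurable borel"
  shows "wsq lborel \<alpha> (toeplitz \<alpha> \<mu> f) \<le> S * ((\<integral>\<^sup>+ w. ennreal (kap \<alpha> (0 :: complex ^ 'n) w) \<partial>lborel) * wsq \<mu> \<alpha> f)"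
proof -
  note [measurable_cong] = \<mu>(1)
  interpret \<mu>: sigma_finite_measure \<mu> by fact
  interpret pair_sigma_finite \<mu> lborel ..
  let ?g = "\<lambda>w. ennreal ((cmod (f w))\<^sup>2 * gauss \<alpha> w)"
  have "wsq lborel \<alpha> (toeplitz \<alpha> \<mu> f) \<le> (\<integral>\<^sup>+ z. S * (\<integral>\<^sup>+ w. ennreal (kap \<alpha> z w) * ?g w \<partial>\<mu>) \<partial>lborel)"
    unfolding wsq_def toeplitz_def mult.assoc
  proof (rule nn_integral_mono)
    fix z
    show "ennreal ((cmod (LINT w|\<mu>. K_ph \<alpha> z w * (f w * complex_of_real (gauss \<alpha> w))))\<^sup>2 * gauss \<alpha> z)
       \<le> S * (\<integral>\<^sup>+ w. ennreal (kap \<alpha> z w) * ?g w \<partial>\<mu>)"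
      using S[of z] unfolding kap_sym[of \<alpha> _ z]
      by (intro order_trans[OF kernel_integral_bound[OF \<alpha> \<mu>(1)]] mult_right_mono) auto
  qed
  also have "\<dots> = S * (\<integral>\<^sup>+ z. (\<integral>\<^sup>+ w. ennreal (kap \<alpha> z w) * ?g w \<partial>\<mu>) \<partial>lborel)"
    by (rule nn_integral_cmult) measurable
  also have "(\<integral>\<^sup>+ z. (\<integral>\<^sup>+ w. ennreal (kap \<alpha> z w) * ?g w \<partial>\<mu>) \<partial>lborel) = (\<integral>\<^sup>+ w. (\<integral>\<^sup>+ z. ennreal (kap \<alpha> z w) * ?g w \<partial>lborel) \<partial>\<mu>)"
    by (rule Fubini') measurable
  also have "\<dots> = (\<integral>\<^sup>+ w. (\<integral>\<^sup>+ w. ennreal (kap \<alpha> (0 :: complex ^ 'n) w) \<partial>lborel) * ?g w \<partial>\<mu>)"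
  proof (rule nn_integral_cong)
    fix w
    have "(\<integral>\<^sup>+ z. ennreal (kap \<alpha> z w) * ?g w \<partial>lborel) = (\<integral>\<^sup>+ z. ennreal (kap \<alpha> z w) \<partial>lborel) * ?g w"
      by (rule nn_integral_multc) measurable
    then show "(\<integral>\<^sup>+ z. ennreal (kap \<alpha> z w) * ?g w \<partial>lborel) = (\<integral>\<^sup>+ w. ennreal (kap \<alpha> (0 :: complex ^ 'n) w) \<partial>lborel) * ?g w"
      by (simp only: kap_sym[of \<alpha> _ w] kap_integral[of \<alpha> w])
  qed
  also have "\<dots> = (\<integral>\<^sup>+ w. ennreal (kap \<alpha> (0 :: complex ^ 'n) w) \<partial>lborel) * wsq \<mu> \<alpha> f"
    unfolding wsq_def by (rule nn_integral_cmult) measurable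
  finally show ?thesis .
qed

subsection \<open>Normal families\<close>

lemma K_ph_norm_le:
  assumes \<alpha>: "\<alpha> > 0" and z: "norm z \<le> R"
  shows "cmod (K_ph \<alpha> z w) \<le> 3 * exp (R / \<alpha> * norm w)"
proof -
  have h: "\<bar>z \<bullet> w\<bar> \<le> R * norm w"
    using Cauchy_Schwarz_ineq2[of z w] mult_right_mono[OF z norm_ge_zero[of w]] by linarith
  then have "exp (z \<bullet> w / \<alpha>) \<le> exp (R / \<alpha> * norm w)"
    using \<alpha> by (simp add: divide_right_mono)
  moreover have "1 \<le> exp (R / \<alpha> * norm w)"
    using \<alpha> order_trans[OF norm_ge_zero z] by simp
  moreover have "cmod (K_ph \<alpha> z w) \<le> exp (z \<bullet> w / \<alpha>) + exp (z \<bullet> w / \<alpha>) + 1"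
    using norm_triangle_ineq4[of "exp (herm z w / of_real \<alpha>) + exp (herm w z / of_real \<alpha>)" 1]
      norm_triangle_ineq[of "exp (herm z w / of_real \<alpha>)" "exp (herm w z / of_real \<alpha>)"]
    by (simp add: K_ph_def Re_herm Re_divide_of_real inner_commute)
  ultimately show ?thesis by linarith
qed

lemma exp_gaussian_integrable:
  assumes "\<alpha> > 0"
  shows "integrable (lborel :: 'a::euclidean_space measure) (\<lambda>w. exp (r * norm w) * gauss (2 * \<alpha>) w)"
  using exp_linear_gaussian_nn_integral_finite[of "1 / (2 * \<alpha>)" r, where ?'a = 'a] assms
  by (intro integrableI_bounded) (auto simp: exp_add[symmetric])

lemma PH_bounded_cmod_le:
  fixes f :: "nat \<Rightarrow> complex ^ 'n::finite \<Rightarrow> complex"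
  assumes \<alpha>: "\<alpha> > 0" and f: "\<And>m. f m \<in> PH 2 \<alpha>" and C: "C < \<infinity>" "\<And>m. wsq lborel \<alpha> (f m) \<le> C"
  obtains b where "b \<ge> 0" "\<And>m z. cmod (f m z) * gauss (2 * \<alpha>) z \<le> b"
proof -
  obtain D where D: "D < \<infinity>" and pt: "\<And>(f :: complex ^ 'n \<Rightarrow> complex) z. f \<in> PH 2 \<alpha> \<Longrightarrow>
      ennreal ((cmod (f z))\<^sup>2 * gauss \<alpha> z) \<le> D * wsq lborel \<alpha> f"
    using PH_point_evaluation[OF \<alpha>] by blast
  have "D * C < \<infinity>" using C(1) D by (simp add: ennreal_mult_less_top)
  then obtain c where c: "D * C = ennreal c" "c \<ge> 0" by (cases "D * C") auto
  show ?thesis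
  proof (rule that[of "sqrt c"])
    fix m z
    have "ennreal ((cmod (f m z))\<^sup>2 * gauss \<alpha> z) \<le> D * C"
      by (rule order_trans[OF pt[OF f]]) (intro mult_left_mono C; simp)
    then have "(cmod (f m z))\<^sup>2 * gauss \<alpha> z \<le> c"
      using c by simp
    then have "(cmod (f m z) * gauss (2 * \<alpha>) z)\<^sup>2 \<le> c"
      by (simp only: power_mult_distrib exp_half_squared)
    then show "cmod (f m z) * gauss (2 * \<alpha>) z \<le> sqrt c"
      by (rule real_le_rsqrt)
  qed (simp add: c)
qed

text \<open>
  A normal family argument: a subsequence converges on a countable dense set, hence everywhere,
  because the reproducing formula makes the sequence equicontinuous.
\<close>

lemma PH_bounded_convergent_subsequence:
  fixes f :: "nat \<Rightarrow> complex ^ 'n::finite \<Rightarrow> complex"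
  assumes \<alpha>: "\<alpha> > 0" and f: "\<And>m. f m \<in> PH 2 \<alpha>" and C: "C < \<infinity>" "\<And>m. wsq lborel \<alpha> (f m) \<le> C"
  obtains r g where "strict_mono (r :: nat \<Rightarrow> nat)" "g \<in> PH 2 \<alpha>" "\<And>z. (\<lambda>m. f (r m) z) \<longlonglongrightarrow> g z"
proof -
  have [measurable]: "f m \<in> borel_measurable borel" for m by (rule PH_measurable[OF f])
  have Km [measurable]: "K_ph \<alpha> z \<in> borel_measurable borel" for z :: "complex ^ 'n"
    by (intro borel_measurable_continuous_onI K_ph_continuous continuous_intros)
  define E where "E w = gauss (2 * \<alpha>) w" for w :: "complex ^ 'n"
  have E2: "gauss \<alpha> w = E w * E w" for w
    using exp_half_squared[of w \<alpha>] by (simp add: E_def power2_eq_square)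
  have E0: "E w > 0" for w by (simp add: E_def)
  have [measurable]: "E \<in> borel_measurable borel" unfolding E_def by measurable
  define c where "c = gauss_mass TYPE(complex ^ 'n) \<alpha>"
  have c: "c > 0" unfolding c_def by (rule gauss_mass_pos[OF \<alpha>])
  obtain b where b: "b \<ge> 0" "\<And>m z. cmod (f m z) * E z \<le> b"
    unfolding E_def by (rule PH_bounded_cmod_le[where f = f, OF \<alpha> f C]) metis
  have rep: "f m z = (LINT w|lborel. K_ph \<alpha> z w * (f m w * of_real (E w * E w))) / of_real c" for m z
    using PH_reproducing[OF \<alpha> f] unfolding c_def E2 .
  have expint: "integrable lborel (\<lambda>w :: complex ^ 'n. k * (exp (r * norm w) * E w))" for k r
    unfolding E_def by (intro integrable_mult_right exp_gaussian_integrable[OF \<alpha>])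
  have Kint: "integrable lborel (\<lambda>w. K_ph \<alpha> z w * (f m w * of_real (E w * E w)))" for z m
    unfolding E2[symmetric]
    by (rule K_ph_integral(2)[OF PH_exp_moments[OF \<alpha> PH_measurable[OF f]]]) (use f[of m] in \<open>simp add: PH_2_iff\<close>)
  \<comment> \<open>With the factor \<open>b / c\<close>, this is a modulus of continuity at
    \<open>z\<close> that is common to all members of the sequence.\<close>
  define G where "G z y = (LINT w|lborel. cmod (K_ph \<alpha> z w - K_ph \<alpha> y w) * E w)" for z y
  have KEint: "integrable lborel (\<lambda>w. cmod (K_ph \<alpha> z w - K_ph \<alpha> y w) * E w)" for z y
  proof (rule Bochner_Integration.integrable_bound[OF expint[of 6 "max (norm z) (norm y) / \<alpha>"]])
    have "cmod (K_ph \<alpha> z w - K_ph \<alpha> y w) \<le> 6 * exp (max (norm z) (norm y) / \<alpha> * norm w)" for w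
      using norm_triangle_ineq4[of "K_ph \<alpha> z w" "K_ph \<alpha> y w"] K_ph_norm_le[OF \<alpha>, of z "max (norm z) (norm y)" w]
        K_ph_norm_le[OF \<alpha>, of y "max (norm z) (norm y)" w] by simp
    from mult_right_mono[OF this less_imp_le[OF E0]]
    show "AE w in lborel. norm (cmod (K_ph \<alpha> z w - K_ph \<alpha> y w) * E w) \<le> norm (6 * (exp (max (norm z) (norm y) / \<alpha> * norm w) * E w))"
      by (intro AE_I2) (simp add: abs_mult less_imp_le[OF E0] mult.assoc)
  qed measurable
  have equi: "cmod (f m z - f m y) \<le> b / c * G z y" for m z y
  proof -
    have "f m z - f m y = (LINT w|lborel. (K_ph \<alpha> z w - K_ph \<alpha> y w) * (f m w * of_real (E w * E w))) / of_real c"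
      unfolding rep[of m z] rep[of m y] left_diff_distrib
      by (simp only: diff_divide_distrib Bochner_Integration.integral_diff[OF Kint Kint])
    then have "cmod (f m z - f m y) = cmod (LINT w|lborel. (K_ph \<alpha> z w - K_ph \<alpha> y w) * (f m w * of_real (E w * E w))) / c"
      using c by (simp add: norm_divide)
    also have "\<dots> \<le> (LINT w|lborel. b * (cmod (K_ph \<alpha> z w - K_ph \<alpha> y w) * E w)) / c"
    proof (intro divide_right_mono order_trans[OF integral_norm_bound] integral_mono)
      show "integrable lborel (\<lambda>w. cmod ((K_ph \<alpha> z w - K_ph \<alpha> y w) * (f m w * of_real (E w * E w))))"
        unfolding left_diff_distrib by (intro integrable_norm Bochner_Integration.integrable_diff Kint)
      show "integrable lborel (\<lambda>w. b * (cmod (K_ph \<alpha> z w - K_ph \<alpha> y w) * E w))"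
        by (intro integrable_mult_right KEint)
      fix w
      have "cmod ((K_ph \<alpha> z w - K_ph \<alpha> y w) * (f m w * of_real (E w * E w)))
          = (cmod (f m w) * E w) * (cmod (K_ph \<alpha> z w - K_ph \<alpha> y w) * E w)"
        using less_imp_le[OF E0[of w]] by (simp add: norm_mult)
      also have "\<dots> \<le> b * (cmod (K_ph \<alpha> z w - K_ph \<alpha> y w) * E w)"
        using less_imp_le[OF E0[of w]] by (intro mult_right_mono b) auto
      finally show "cmod ((K_ph \<alpha> z w - K_ph \<alpha> y w) * (f m w * of_real (E w * E w))) \<le> b * (cmod (K_ph \<alpha> z w - K_ph \<alpha> y w) * E w)" .
    qed (use c in auto)
    finally show ?thesis by (simp add: G_def)
  qed
  have G0: "(\<lambda>k. G z (y k)) \<longlonglongrightarrow> 0" if y: "\<And>k. norm (y k) \<le> norm z + 1" "y \<longlonglongrightarrow> z" for z y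
  proof -
    have "(\<lambda>k. G z (y k)) \<longlonglongrightarrow> (LINT w|(lborel :: (complex ^ 'n) measure). 0)"
      unfolding G_def
    proof (rule integral_dominated_convergence)
      show "integrable lborel (\<lambda>w :: complex ^ 'n. 6 * (exp ((norm z + 1) / \<alpha> * norm w) * E w))" by (rule expint)
      show "AE w in lborel. (\<lambda>k. cmod (K_ph \<alpha> z w - K_ph \<alpha> (y k) w) * E w) \<longlonglongrightarrow> 0"
      proof (rule AE_I2)
        fix w
        have "continuous_on UNIV (\<lambda>v. cmod (K_ph \<alpha> z w - K_ph \<alpha> v w) * E w)"
          by (intro continuous_intros K_ph_continuous)
        from continuous_on_tendsto_compose[OF this y(2)]
        show "(\<lambda>k. cmod (K_ph \<alpha> z w - K_ph \<alpha> (y k) w) * E w) \<longlonglongrightarrow> 0" by simp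
      qed
      show "AE w in lborel. norm (cmod (K_ph \<alpha> z w - K_ph \<alpha> (y k) w) * E w) \<le> 6 * (exp ((norm z + 1) / \<alpha> * norm w) * E w)" for k
      proof (rule AE_I2)
        fix w
        have "cmod (K_ph \<alpha> z w - K_ph \<alpha> (y k) w) \<le> 6 * exp ((norm z + 1) / \<alpha> * norm w)"
          using norm_triangle_ineq4[of "K_ph \<alpha> z w" "K_ph \<alpha> (y k) w"] K_ph_norm_le[OF \<alpha>, of z "norm z + 1" w]
            K_ph_norm_le[OF \<alpha> y(1), of k w] by simp
        from mult_right_mono[OF this less_imp_le[OF E0[of w]]]
        show "norm (cmod (K_ph \<alpha> z w - K_ph \<alpha> (y k) w) * E w) \<le> 6 * (exp ((norm z + 1) / \<alpha> * norm w) * E w)"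
          by (simp add: abs_mult less_imp_le[OF E0] mult.assoc)
      qed
    qed measurable
    then show ?thesis by simp
  qed
  obtain X :: "(complex ^ 'n) set" where X: "countable X" "\<And>U. open U \<Longrightarrow> U \<noteq> {} \<Longrightarrow> \<exists>d\<in>X. d \<in> U"
    by (rule countable_dense_setE) (rule that)
  \<comment> \<open>The diagonal selection asks for one bound valid at all points, which holds only
    after weighting; the positive factor \<open>E x\<close> is divided out afterwards.\<close>
  have bE: "norm (f m x * of_real (E x)) \<le> b" for m x
    using b(2)[of m x] less_imp_le[OF E0[of x]] by (simp add: norm_mult)
  obtain r where r: "strict_mono (r :: nat \<Rightarrow> nat)" "\<And>x. x \<in> X \<Longrightarrow> \<exists>l. (\<lambda>m. f (r m) x * of_real (E x)) \<longlonglongrightarrow> l"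
    by (rule function_convergent_subsequence[where f = "\<lambda>m x. f m x * of_real (E x)", OF X(1) bE]) (rule that)
  have cauchy_X: "Cauchy (\<lambda>m. f (r m) x)" if x: "x \<in> X" for x
  proof -
    obtain l where "(\<lambda>m. f (r m) x * of_real (E x)) \<longlonglongrightarrow> l" using r(2)[OF x] by blast
    from tendsto_mult_right[OF this, of "1 / of_real (E x)"]
    have "(\<lambda>m. f (r m) x) \<longlonglongrightarrow> l * (1 / of_real (E x))"
      using E0[of x] by simp
    then show ?thesis by (rule LIMSEQ_imp_Cauchy)
  qed
  have cauchy: "Cauchy (\<lambda>m. f (r m) z)" for z
  proof (rule metric_CauchyI)
    fix e :: real assume e: "e > 0"
    have "\<exists>y. y \<in> X \<and> dist z y < 1 / real (Suc k)" for k
      using X(2)[of "ball z (1 / real (Suc k))"] by auto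
    then obtain y where y: "\<And>k. y k \<in> X" "\<And>k. dist z (y k) < 1 / real (Suc k)" by metis
    have "norm (y k) \<le> norm z + 1" for k
    proof -
      have "dist z (y k) < 1" using y(2)[of k] by (rule less_le_trans) simp
      then show ?thesis using norm_triangle_ineq2[of "y k" z] by (simp add: dist_norm norm_minus_commute)
    qed
    moreover have "y \<longlonglongrightarrow> z"
    proof (rule metric_LIMSEQ_I)
      fix e :: real assume "e > 0"
      then obtain N where N: "1 / real (Suc N) < e" using nat_approx_posE by blast
      have "dist (y k) z < e" if "k \<ge> N" for k
      proof -
        have "dist (y k) z < 1 / real (Suc k)" using y(2)[of k] by (simp add: dist_commute)
        also have "\<dots> \<le> 1 / real (Suc N)" using that by (simp add: frac_le)
        finally show ?thesis using N by simp
      qed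
      then show "\<exists>N. \<forall>k\<ge>N. dist (y k) z < e" by blast
    qed
    ultimately have "(\<lambda>k. b / c * G z (y k)) \<longlonglongrightarrow> b / c * 0"
      by (intro tendsto_mult_left G0)
    then have "eventually (\<lambda>k. b / c * G z (y k) < e / 3) sequentially"
      using e by (intro order_tendstoD) auto
    then obtain k where k: "b / c * G z (y k) < e / 3" by (auto simp: eventually_sequentially)
    obtain M where M: "\<And>m n. m \<ge> M \<Longrightarrow> n \<ge> M \<Longrightarrow> dist (f (r m) (y k)) (f (r n) (y k)) < e / 3"
      using metric_CauchyD[OF cauchy_X[OF y(1)], of "e / 3" k] e by auto
    have "dist (f (r m) z) (f (r n) z) < e" if "m \<ge> M" "n \<ge> M" for m n
    proof -
      have "dist (f (r m) z) (f (r n) z) \<le> dist (f (r m) z) (f (r m) (y k)) + dist (f (r m) (y k)) (f (r n) (y k)) + dist (f (r n) (y k)) (f (r n) z)"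
        by (metis add_mono_thms_linordered_semiring(3) dist_triangle order_trans)
      moreover have "dist (f (r m) z) (f (r m) (y k)) < e / 3" "dist (f (r n) (y k)) (f (r n) z) < e / 3"
        using le_less_trans[OF equi[of "r m" z "y k"] k] le_less_trans[OF equi[of "r n" z "y k"] k]
        by (simp_all only: dist_norm norm_minus_commute[of "f (r n) (y k)"])
      ultimately show ?thesis using M[OF that] by linarith
    qed
    then show "\<exists>M. \<forall>m\<ge>M. \<forall>n\<ge>M. dist (f (r m) z) (f (r n) z) < e" by blast
  qed
  define g where "g z = lim (\<lambda>m. f (r m) z)" for z
  have g: "(\<lambda>m. f (r m) z) \<longlonglongrightarrow> g z" for z
    unfolding g_def using cauchy[of z] by (simp add: Cauchy_convergent convergent_LIMSEQ_iff[symmetric])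
  have gm [measurable]: "g \<in> borel_measurable borel"
    by (rule borel_measurable_LIMSEQ_metric[where f = "\<lambda>m. f (r m)"]) (auto intro: g)
  \<comment> \<open>Fatou's lemma: the limit inherits the bound \<open>C\<close>.\<close>
  have "wsq lborel \<alpha> g = (\<integral>\<^sup>+ w. liminf (\<lambda>m. ennreal ((cmod (f (r m) w))\<^sup>2 * gauss \<alpha> w)) \<partial>lborel)"
    unfolding wsq_def
  proof (rule nn_integral_cong)
    fix w
    have "(\<lambda>m. ennreal ((cmod (f (r m) w))\<^sup>2 * gauss \<alpha> w)) \<longlonglongrightarrow> ennreal ((cmod (g w))\<^sup>2 * gauss \<alpha> w)"
      by (intro tendsto_ennrealI tendsto_intros g)
    from lim_imp_Liminf[OF _ this]
    show "ennreal ((cmod (g w))\<^sup>2 * gauss \<alpha> w) = liminf (\<lambda>m. ennreal ((cmod (f (r m) w))\<^sup>2 * gauss \<alpha> w))"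
      by simp
  qed
  also have "\<dots> \<le> liminf (\<lambda>m. wsq lborel \<alpha> (f (r m)))"
    unfolding wsq_def by (rule nn_integral_liminf) measurable
  also have "\<dots> \<le> liminf (\<lambda>m. C)"
    by (intro Liminf_mono always_eventually allI C)
  also have "\<dots> = C" by (simp add: Liminf_const)
  finally have wg: "wsq lborel \<alpha> g < \<infinity>" using C(1) by (rule le_less_trans)
  have "g \<in> PH 2 \<alpha>"
  proof (rule PH_if_reproducing[OF \<alpha> gm wg])
    fix z
    \<comment> \<open>Membership passes to the limit through the reproducing formula. One factor
      \<open>E\<close> is spent on bounding \<open>f\<close> by \<open>b\<close>, the other keeps
      the majorant integrable.\<close>
    have "(\<lambda>m. LINT w|lborel. K_ph \<alpha> z w * (f (r m) w * of_real (E w * E w))) \<longlonglongrightarrow> (LINT w|lborel. K_ph \<alpha> z w * (g w * of_real (E w * E w)))"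
    proof (rule integral_dominated_convergence)
      show "integrable lborel (\<lambda>w :: complex ^ 'n. 3 * b * (exp (norm z / \<alpha> * norm w) * E w))" by (rule expint)
      show "AE w in lborel. (\<lambda>m. K_ph \<alpha> z w * (f (r m) w * of_real (E w * E w))) \<longlonglongrightarrow> K_ph \<alpha> z w * (g w * of_real (E w * E w))"
        by (intro AE_I2 tendsto_intros g)
      show "AE w in lborel. norm (K_ph \<alpha> z w * (f (r m) w * of_real (E w * E w))) \<le> 3 * b * (exp (norm z / \<alpha> * norm w) * E w)" for m
      proof (rule AE_I2)
        fix w
        have "norm (K_ph \<alpha> z w * (f (r m) w * of_real (E w * E w))) = cmod (K_ph \<alpha> z w) * ((cmod (f (r m) w) * E w) * E w)"
          using less_imp_le[OF E0[of w]] by (simp add: norm_mult)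
        also have "\<dots> \<le> (3 * exp (norm z / \<alpha> * norm w)) * (b * E w)"
          using less_imp_le[OF E0[of w]] b(1)
          by (intro mult_mono K_ph_norm_le[OF \<alpha>] mult_right_mono b mult_nonneg_nonneg) auto
        finally show "norm (K_ph \<alpha> z w * (f (r m) w * of_real (E w * E w))) \<le> 3 * b * (exp (norm z / \<alpha> * norm w) * E w)"
          by (simp add: mult_ac)
      qed
    qed measurable
    then have "(\<lambda>m. (LINT w|lborel. K_ph \<alpha> z w * (f (r m) w * of_real (E w * E w))) / of_real c)
        \<longlonglongrightarrow> (LINT w|lborel. K_ph \<alpha> z w * (g w * of_real (E w * E w))) / of_real c"
      using c by (intro tendsto_divide tendsto_const) auto
    then have "(\<lambda>m. f (r m) z) \<longlonglongrightarrow> (LINT w|lborel. K_ph \<alpha> z w * (g w * of_real (E w * E w))) / of_real c"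
      by (simp only: rep[of _ z, symmetric])
    from LIMSEQ_unique[OF g this]
    show "g z = (LINT w|lborel. K_ph \<alpha> z w * (g w * of_real (gauss \<alpha> w))) / of_real (gauss_mass TYPE(complex ^ 'n) \<alpha>)"
      by (simp only: E2 c_def)
  qed
  with r(1) g show ?thesis using that by blast
qed

subsection \<open>Normalized kernels\<close>

text \<open>Normalized up to constants: the exact squared norm of the kernel is
  \<open>2 * exp ((norm w)\<^sup>2 / \<alpha>) - 1\<close>, which lies between one and two times the
  square of the inverse of this weight.\<close>

definition nker :: "real \<Rightarrow> complex ^ 'n::finite \<Rightarrow> complex ^ 'n \<Rightarrow> complex" where
  "nker \<alpha> w z = of_real (gauss (2 * \<alpha>) w) * K_ph \<alpha> z w"

lemma nker_sq_le_kap: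
  assumes \<alpha>: "\<alpha> > 0"
  shows "(cmod (nker \<alpha> w z))\<^sup>2 * gauss \<alpha> z \<le> (kap \<alpha> w z)\<^sup>2"
proof -
  have "(cmod (nker \<alpha> w z))\<^sup>2 * gauss \<alpha> z
      = (cmod (K_ph \<alpha> z w) * gauss (2 * \<alpha>) z * gauss (2 * \<alpha>) w)\<^sup>2"
    by (simp only: nker_def norm_mult power_mult_distrib exp_half_squared norm_of_real power2_abs) (simp add: mult_ac)
  also have "\<dots> \<le> (kap \<alpha> w z)\<^sup>2"
    using K_ph_bound[OF \<alpha>, of z w] by (intro power_mono) (auto simp: kap_sym)
  finally show ?thesis .
qed

lemma wsq_nker_le:
  fixes w :: "complex ^ 'n::finite"
  assumes \<alpha>: "\<alpha> > 0"
  shows "wsq lborel \<alpha> (nker \<alpha> w) \<le> 6 * (\<integral>\<^sup>+ z. ennreal (kap \<alpha> (0 :: complex ^ 'n) z) \<partial>lborel)"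
proof -
  have "wsq lborel \<alpha> (nker \<alpha> w) \<le> (\<integral>\<^sup>+ z. 6 * ennreal (kap \<alpha> w z) \<partial>lborel)"
    unfolding wsq_def
  proof (rule nn_integral_mono)
    fix z
    have "(kap \<alpha> w z)\<^sup>2 \<le> 6 * kap \<alpha> w z"
      unfolding power2_eq_square by (intro mult_right_mono kap_le[OF \<alpha>] kap_nonneg)
    then have "ennreal ((cmod (nker \<alpha> w z))\<^sup>2 * gauss \<alpha> z) \<le> ennreal (6 * kap \<alpha> w z)"
      using nker_sq_le_kap[OF \<alpha>, of w z] by (intro ennreal_leI) linarith
    then show "ennreal ((cmod (nker \<alpha> w z))\<^sup>2 * gauss \<alpha> z) \<le> 6 * ennreal (kap \<alpha> w z)"
      by (simp add: ennreal_mult')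
  qed
  also have "\<dots> = 6 * (\<integral>\<^sup>+ z. ennreal (kap \<alpha> w z) \<partial>lborel)"
    by (rule nn_integral_cmult) measurable
  finally show ?thesis by (simp only: kap_integral[of \<alpha> w])
qed

lemma K_ph_in_PH:
  fixes w :: "complex ^ 'n::finite"
  assumes \<alpha>: "\<alpha> > 0"
  shows "nker \<alpha> w \<in> PH 2 \<alpha>" "(\<lambda>z. K_ph \<alpha> z w) \<in> PH 2 \<alpha>"
proof -
  let ?e = "complex_of_real (gauss (2 * \<alpha>) w)"
  have fin: "wsq lborel \<alpha> (nker \<alpha> w) < \<infinity>"
    by (rule le_less_trans[OF wsq_nker_le[OF \<alpha>]])
       (use kap_integral_finite[OF \<alpha>, where ?'a = "complex ^ 'n"] in \<open>simp add: ennreal_mult_less_top\<close>)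
  have [measurable]: "(\<lambda>z. K_ph \<alpha> z w) \<in> borel_measurable borel"
    by (rule borel_measurable_continuous_onI[OF pluriharmonic_continuous[OF K_ph_pluriharmonic]])
  have nm: "nker \<alpha> w \<in> borel_measurable borel"
    unfolding nker_def[abs_def] by measurable
  have "wsq lborel \<alpha> (\<lambda>z. K_ph \<alpha> z w) = wsq lborel \<alpha> (\<lambda>z. (1 / ?e) * nker \<alpha> w z)"
    by (simp add: nker_def)
  also have "\<dots> < \<infinity>"
    using fin nm by (subst wsq_cmult) (auto simp: ennreal_mult_less_top)
  finally show K: "(\<lambda>z. K_ph \<alpha> z w) \<in> PH 2 \<alpha>"
    by (simp add: PH_2_iff K_ph_pluriharmonic)
  from PH_cmult[OF \<alpha> K, of ?e] show "nker \<alpha> w \<in> PH 2 \<alpha>"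
    by (simp add: nker_def[abs_def])
qed

lemma nker_bounded:
  fixes z :: "nat \<Rightarrow> complex ^ 'n::finite"
  assumes \<alpha>: "\<alpha> > 0"
  shows "\<exists>C. \<forall>m. Lp_norm 2 \<alpha> (nker \<alpha> (z m)) \<le> C"
  using wsq_nker_le[OF \<alpha>] kap_integral_finite[OF \<alpha>, where ?'a = "complex ^ 'n"]
  by (subst PH_bounded_iff[where f = "\<lambda>m. nker \<alpha> (z m)", OF \<alpha> K_ph_in_PH(1)[OF \<alpha>]])
     (intro exI[of _ "6 * (\<integral>\<^sup>+ z. ennreal (kap \<alpha> (0 :: complex ^ 'n) z) \<partial>lborel)"] conjI allI, auto simp: ennreal_mult_less_top)

lemma nker_in_kernel_span: "nker \<alpha> w \<in> kernel_span \<alpha>"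
  unfolding kernel_span_def mem_Collect_eq nker_def[abs_def]
  by (rule exI[of _ "{w}"], rule exI[of _ "\<lambda>_. of_real (gauss (2 * \<alpha>) w)"]) simp

text \<open>For \<open>norm z \<le> R\<close> both centres \<open>w\<close> and \<open>- w\<close>
  have distance at least \<open>norm w - R\<close> from \<open>z\<close>, so \<open>kap\<close> is
  uniformly small. Undoing the weight in \<open>z\<close> costs at most
  \<open>exp (R\<^sup>2 / (2 * \<alpha>))\<close>.\<close>

lemma nker_locally_uniform_limit:
  fixes w :: "nat \<Rightarrow> complex ^ 'n::finite"
  assumes \<alpha>: "\<alpha> > 0" and w: "filterlim (\<lambda>m. norm (w m)) at_top sequentially" and S: "compact S"
  shows "uniform_limit S (\<lambda>m. nker \<alpha> (w m)) (\<lambda>_. 0) sequentially"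
proof -
  obtain R where R: "R > 0" "\<And>z. z \<in> S \<Longrightarrow> norm z \<le> R"
    using compact_imp_bounded[OF S] by (auto simp: bounded_pos)
  \<comment> \<open>The maximum with 0 keeps the square monotone for the finitely many
    \<open>m\<close> that may have \<open>norm (w m) < R\<close>.\<close>
  define B where "B m = 6 * exp (R\<^sup>2 / (2 * \<alpha>)) * exp (- (max 0 (norm (w m) - R))\<^sup>2 / (2 * \<alpha>))" for m
  have bound: "cmod (nker \<alpha> (w m) z) \<le> B m" if z: "z \<in> S" for m z
  proof -
    have le: "gauss (2 * \<alpha>) v \<le> exp (- (max 0 (norm (w m) - R))\<^sup>2 / (2 * \<alpha>))"
      if "norm v \<ge> norm (w m) - norm z" for v :: "complex ^ 'n"
    proof -
      have "(max 0 (norm (w m) - R))\<^sup>2 \<le> (norm v)\<^sup>2"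
        using that R(2)[OF z] by (intro power_mono) auto
      then show ?thesis using \<alpha> by (simp add: divide_right_mono)
    qed
    have k: "kap \<alpha> z (w m) \<le> 6 * exp (- (max 0 (norm (w m) - R))\<^sup>2 / (2 * \<alpha>))"
    proof -
      have "3 * (a + b) \<le> 6 * x" if "a \<le> x" "b \<le> x" for a b x :: real using that by simp
      moreover have "norm (z - w m) \<ge> norm (w m) - norm z" "norm (z + w m) \<ge> norm (w m) - norm z"
        using norm_triangle_ineq2[of "w m" z] norm_diff_ineq[of "w m" z]
        by (simp_all add: norm_minus_commute add.commute)
      ultimately show ?thesis unfolding kap_def using le by blast
    qed
    have "cmod (nker \<alpha> (w m) z) * gauss (2 * \<alpha>) z \<le> kap \<alpha> z (w m)"
      using K_ph_bound[OF \<alpha>, of z "w m"] by (simp add: nker_def norm_mult mult_ac)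
    then have "exp ((norm z)\<^sup>2 / (2 * \<alpha>)) * (cmod (nker \<alpha> (w m) z) * gauss (2 * \<alpha>) z) \<le> exp ((norm z)\<^sup>2 / (2 * \<alpha>)) * kap \<alpha> z (w m)"
      by (rule mult_left_mono) simp
    then have "cmod (nker \<alpha> (w m) z) \<le> exp ((norm z)\<^sup>2 / (2 * \<alpha>)) * kap \<alpha> z (w m)"
      by (simp add: exp_minus field_simps)
    also have "\<dots> \<le> exp (R\<^sup>2 / (2 * \<alpha>)) * (6 * exp (- (max 0 (norm (w m) - R))\<^sup>2 / (2 * \<alpha>)))"
      using R(2)[OF z] \<alpha> by (intro mult_mono k) (auto simp: kap_nonneg intro!: divide_right_mono power_mono)
    finally show ?thesis by (simp add: B_def mult_ac)
  qed
  have "filterlim (\<lambda>m. - R + norm (w m)) at_top sequentially"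
    by (rule filterlim_tendsto_add_at_top[OF tendsto_const w])
  then have "filterlim (\<lambda>m. max 0 (norm (w m) - R)) at_top sequentially"
    by (rule filterlim_at_top_mono) auto
  then have "filterlim (\<lambda>m. (max 0 (norm (w m) - R))\<^sup>2) at_top sequentially"
    by (rule filterlim_pow_at_top[rotated]) simp
  then have "filterlim (\<lambda>m. 1 / (2 * \<alpha>) * (max 0 (norm (w m) - R))\<^sup>2) at_top sequentially"
    using \<alpha> by (intro filterlim_tendsto_pos_mult_at_top[OF tendsto_const]) auto
  then have "filterlim (\<lambda>m. - (1 / (2 * \<alpha>) * (max 0 (norm (w m) - R))\<^sup>2)) at_bot sequentially"
    by (simp add: filterlim_uminus_at_bot)
  from tendsto_mult_left[OF filterlim_compose[OF exp_at_bot this], of "6 * exp (R\<^sup>2 / (2 * \<alpha>))"]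
  have B0: "B \<longlonglongrightarrow> 0" by (simp add: B_def[abs_def])
  show ?thesis
  proof (rule uniform_limitI)
    fix e :: real assume "e > 0"
    with B0 have "eventually (\<lambda>m. B m < e) sequentially" by (rule order_tendstoD)
    then show "\<forall>\<^sub>F m in sequentially. \<forall>z\<in>S. dist (nker \<alpha> (w m) z) 0 < e"
      by eventually_elim (auto intro: le_less_trans[OF bound])
  qed
qed

text \<open>
  The real kernel \<open>K_ph \<alpha> u w\<close> vanishes for some \<open>u\<close> near \<open>w\<close>. Moving \<open>w\<close> to \<open>(1 + \<i> \<tau>) w\<close> with
  \<open>\<tau> = \<pi> \<alpha> / (2 |w|\<^sup>2)\<close> multiplies \<open>exp (herm u w / \<alpha>)\<close> by almost exactly \<open>- \<i>\<close>, so that the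
  two kernels cannot both be small.
\<close>

lemma two_kernels_large:
  fixes \<zeta> \<eta> :: complex
  assumes "\<zeta>' = - \<i> * \<zeta> * (1 + \<eta>)" "cmod \<eta> \<le> 1/2" "cmod \<zeta> \<ge> 4"
  shows "cmod \<zeta> / 2 \<le> \<bar>2 * Re \<zeta> - 1\<bar> + \<bar>2 * Re \<zeta>' - 1\<bar>"
proof -
  have "\<zeta>' = - \<i> * \<zeta> + - \<i> * \<zeta> * \<eta>" using assms(1) by (simp add: algebra_simps)
  then have "Re \<zeta>' = Im \<zeta> + Re (- \<i> * \<zeta> * \<eta>)" by simp
  moreover have "\<bar>Re (- \<i> * \<zeta> * \<eta>)\<bar> \<le> cmod \<zeta> * (1/2)"
    using abs_Re_le_cmod[of "- \<i> * \<zeta> * \<eta>"] mult_left_mono[OF assms(2), of "cmod \<zeta>"] by (simp add: norm_mult)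
  moreover have "cmod \<zeta> \<le> \<bar>Re \<zeta>\<bar> + \<bar>Im \<zeta>\<bar>" by (rule cmod_le)
  \<comment> \<open>The right side is at least \<open>2 * cmod \<zeta> - cmod \<zeta> - 2\<close>,
    which reaches \<open>cmod \<zeta> / 2\<close> exactly when
    \<open>cmod \<zeta> \<ge> 4\<close>.\<close>
  ultimately show ?thesis using assms(3) by linarith
qed

text \<open>The bound 16 makes the perturbation of the exponent at most 1/8, and
  \<open>1 + \<alpha> * ln 4\<close> ensures \<open>cmod \<zeta> \<ge> 4\<close>. The factor 8
  arises from squaring \<open>cmod \<zeta> / 2 \<le> \<bar>a\<bar> + \<bar>b\<bar>\<close>. The
  exponential pays for the distance of \<open>u\<close> from \<open>w\<close>, at most 1, and for
  the growth of the squared norm from \<open>w\<close> to \<open>w'\<close>, at most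
  \<open>(pi * \<alpha> / 2)\<^sup>2\<close>.\<close>

lemma kernel_lower_bound:
  fixes u w :: "complex ^ 'n::finite"
  assumes \<alpha>: "\<alpha> > 0" and u: "u \<in> ball w 1"
    and w: "norm w \<ge> 16" "norm w \<ge> 1 + \<alpha> * ln 4"
  defines "w' \<equiv> (1 + \<i> * of_real (pi * \<alpha> / (2 * (norm w)\<^sup>2))) *s w"
  shows "1 \<le> 8 * exp ((1 + (pi * \<alpha> / 2)\<^sup>2) / \<alpha>) *
    ((cmod (nker \<alpha> w u))\<^sup>2 * gauss \<alpha> u + (cmod (nker \<alpha> w' u))\<^sup>2 * gauss \<alpha> u)"
proof -
  define s where "s = norm w"
  define \<tau> where "\<tau> = pi * \<alpha> / (2 * s\<^sup>2)"
  define d where "d = u - w"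
  have s: "s \<ge> 16" "s - 1 \<ge> \<alpha> * ln 4" using w by (simp_all add: s_def)
  have nd: "norm d < 1" using u by (simp add: d_def dist_norm norm_minus_commute)
  have w'_\<tau>: "w' = (1 + \<i> * of_real \<tau>) *s w" by (simp add: w'_def \<tau>_def s_def)
  define \<zeta> where "\<zeta> = exp (herm u w / of_real \<alpha>)"
  define \<zeta>' where "\<zeta>' = exp (herm u w' / of_real \<alpha>)"
  \<comment> \<open>The part of the change of exponent due to \<open>u\<close> differing from
    \<open>w\<close>; its modulus is at most
    \<open>\<tau> / \<alpha> * norm w = pi / (2 * norm w)\<close>.\<close>
  define q where "q = - \<i> * of_real \<tau> * herm d w / of_real \<alpha>"
  have hww: "herm w w = of_real (s\<^sup>2)"
    using Re_herm[of w w] cnj_herm[of w w] by (simp add: complex_eq_iff s_def power2_norm_eq_inner)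
  have hu: "herm u w = of_real (s\<^sup>2) + herm d w"
    unfolding hww[symmetric] by (simp add: d_def herm_def algebra_simps sum_subtractf)
  \<comment> \<open>Conjugate linearity in the second argument turns \<open>1 + i \<tau>\<close>
    into \<open>1 - i \<tau>\<close>; with \<open>\<tau> * s\<^sup>2 / \<alpha> = pi / 2\<close>
    this is the source of the factor \<open>- i\<close>.\<close>
  have hu': "herm u w' = cnj (1 + \<i> * of_real \<tau>) * herm u w"
    using herm_scale_left[of "1 + \<i> * of_real \<tau>" w u] by (metis cnj_herm complex_cnj_mult w'_\<tau>)
  have "herm u w' / of_real \<alpha> = herm u w / of_real \<alpha> + (- \<i> * of_real (\<tau> * s\<^sup>2 / \<alpha>) + q)"
    using \<alpha> by (simp add: hu' q_def hu field_simps)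
  also have "\<tau> * s\<^sup>2 / \<alpha> = pi / 2"
    using \<alpha> s by (simp add: \<tau>_def)
  finally have "\<zeta>' = \<zeta> * (exp (- \<i> * of_real (pi / 2)) * exp q)"
    unfolding \<zeta>_def \<zeta>'_def by (simp only: exp_add)
  also have "exp (- \<i> * of_real (pi / 2)) = - \<i>"
    using cis_conv_exp[of "- (pi / 2)"] by (simp add: complex_eq_iff)
  finally have \<zeta>': "\<zeta>' = - \<i> * \<zeta> * (1 + (exp q - 1))" by simp
  have "cmod q = \<tau> / \<alpha> * cmod (herm d w)"
    using \<alpha> by (simp add: q_def norm_mult norm_divide norm_power \<tau>_def)
  also have "\<dots> \<le> \<tau> / \<alpha> * s"
  proof (rule mult_left_mono)
    show "cmod (herm d w) \<le> s"
      using norm_herm_le[of d w] nd mult_right_mono[of "norm d" 1 s] s by (simp add: s_def)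
  qed (use \<alpha> in \<open>simp add: \<tau>_def\<close>)
  also have "\<dots> = pi / (2 * s)"
    using \<alpha> s by (simp add: \<tau>_def power2_eq_square)
  also have "\<dots> \<le> 1 / 8"
    using pi_less_4 s by (simp add: field_simps)
  finally have q: "cmod q \<le> 1 / 8" .
  have "cmod (exp q - 1) \<le> exp (cmod q) * cmod q"
    using Taylor_exp_field[of q 0] by simp
  also have "\<dots> \<le> 3 * (1 / 8)"
    using q exp_le order_trans[of "exp (cmod q)" "exp 1" 3] by (intro mult_mono) auto
  finally have \<eta>: "cmod (exp q - 1) \<le> 1 / 2" by simp
  have norm_\<zeta>: "cmod \<zeta> = exp ((u \<bullet> w) / \<alpha>)"
    by (simp add: \<zeta>_def Re_herm Re_divide_of_real)
  have "ln 4 \<le> (u \<bullet> w) / \<alpha>"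
  proof -
    have "\<bar>d \<bullet> w\<bar> \<le> s"
      using Cauchy_Schwarz_ineq2[of d w] nd mult_right_mono[of "norm d" 1 s] s by (simp add: s_def)
    then have "u \<bullet> w \<ge> s\<^sup>2 - s"
      by (simp add: d_def inner_diff_left s_def power2_norm_eq_inner)
    also have "s\<^sup>2 - s = s * (s - 1)" by (simp add: power2_eq_square algebra_simps)
    finally have "u \<bullet> w \<ge> s * (s - 1)" .
    moreover have "s * (s - 1) \<ge> 1 * (\<alpha> * ln 4)"
      using s \<alpha> by (intro mult_mono) auto
    ultimately show ?thesis using \<alpha> by (simp add: pos_le_divide_eq mult.commute)
  qed
  then have \<zeta>4: "cmod \<zeta> \<ge> 4"
    unfolding norm_\<zeta> using exp_le_cancel_iff[of "ln 4" "(u \<bullet> w) / \<alpha>"] by simp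
  define a where "a = 2 * Re \<zeta> - 1"
  define b where "b = 2 * Re \<zeta>' - 1"
  have "cmod \<zeta> / 2 \<le> \<bar>a\<bar> + \<bar>b\<bar>"
    unfolding a_def b_def by (rule two_kernels_large[OF \<zeta>' \<eta> \<zeta>4])
  then have "(cmod \<zeta> / 2)\<^sup>2 \<le> (\<bar>a\<bar> + \<bar>b\<bar>)\<^sup>2" by (intro power_mono) auto
  also have "\<dots> \<le> 2 * (a\<^sup>2 + b\<^sup>2)"
    using sum_squares_bound[of "\<bar>a\<bar>" "\<bar>b\<bar>"] by (simp add: power2_sum)
  finally have ab: "(cmod \<zeta>)\<^sup>2 \<le> 8 * (a\<^sup>2 + b\<^sup>2)" by (simp add: power_divide)
  have nker2: "(cmod (nker \<alpha> v u))\<^sup>2 = gauss \<alpha> v * (cmod (K_ph \<alpha> u v))\<^sup>2" for v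
    by (simp only: nker_def norm_mult power_mult_distrib exp_half_squared norm_of_real power2_abs)
  have Ka: "cmod (K_ph \<alpha> u w) = \<bar>a\<bar>" "cmod (K_ph \<alpha> u w') = \<bar>b\<bar>"
    unfolding K_ph_real a_def b_def \<zeta>_def \<zeta>'_def norm_of_real by (rule refl)+
  define c where "c = (pi * \<alpha> / 2)\<^sup>2"
  have c0: "c \<ge> 0" by (simp add: c_def)
  have "(norm w')\<^sup>2 = (1 + \<tau>\<^sup>2) * s\<^sup>2"
  proof -
    have "norm w' = cmod (1 + \<i> * of_real \<tau>) * s"
      unfolding w'_\<tau> s_def by (rule norm_vec_scale)
    then show ?thesis by (simp add: power_mult_distrib cmod_power2)
  qed
  also have "\<dots> = s\<^sup>2 + c / s\<^sup>2"
    using s by (simp add: \<tau>_def c_def power_divide power_mult_distrib field_simps power2_eq_square)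
  also have "\<dots> \<le> s\<^sup>2 + c"
    using s c0 one_le_power[of s 2] by (simp add: divide_le_eq mult_le_cancel_left1)
  finally have w'2: "(norm w')\<^sup>2 \<le> s\<^sup>2 + c" .
  have e1: "exp (- (s\<^sup>2 + c) / \<alpha>) \<le> gauss \<alpha> w"
    unfolding exp_le_cancel_iff by (rule divide_right_mono) (use \<alpha> c0 in \<open>simp_all add: s_def\<close>)
  have e2: "exp (- (s\<^sup>2 + c) / \<alpha>) \<le> gauss \<alpha> w'"
    unfolding exp_le_cancel_iff by (rule divide_right_mono) (use \<alpha> w'2 in simp_all)
  \<comment> \<open>The Gaussian weights cancel the growth of \<open>(cmod \<zeta>)\<^sup>2\<close>:
    the inner products complete to \<open>(norm d)\<^sup>2\<close>, and only the bounded loss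
    \<open>c\<close> remains.\<close>
  have "(u \<bullet> w) / \<alpha> * 2 + (- (s\<^sup>2 + c) / \<alpha> + - (norm u)\<^sup>2 / \<alpha>) = - ((norm d)\<^sup>2 + c) / \<alpha>"
    using \<alpha> by (simp add: d_def s_def power2_norm_eq_inner inner_diff_left inner_diff_right inner_commute field_simps)
  moreover have "- ((norm d)\<^sup>2 + c) / \<alpha> \<ge> - (1 + c) / \<alpha>"
    using nd \<alpha> power_le_one[of "norm d" 2] by (intro divide_right_mono) auto
  ultimately have "exp (- (1 + c) / \<alpha>) \<le> exp ((u \<bullet> w) / \<alpha> * 2 + (- (s\<^sup>2 + c) / \<alpha> + - (norm u)\<^sup>2 / \<alpha>))"
    by simp
  also have "\<dots> = (cmod \<zeta>)\<^sup>2 * (exp (- (s\<^sup>2 + c) / \<alpha>) * gauss \<alpha> u)"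
    by (simp only: exp_add norm_\<zeta> exp_double[symmetric] mult.commute[of 2])
  also have "\<dots> \<le> 8 * (a\<^sup>2 + b\<^sup>2) * (exp (- (s\<^sup>2 + c) / \<alpha>) * gauss \<alpha> u)"
    using ab by (rule mult_right_mono) simp
  also have "\<dots> = 8 * ((a\<^sup>2 * exp (- (s\<^sup>2 + c) / \<alpha>) + b\<^sup>2 * exp (- (s\<^sup>2 + c) / \<alpha>)) * gauss \<alpha> u)"
    by (simp only: ring_distribs mult_ac)
  also have "\<dots> \<le> 8 * ((a\<^sup>2 * gauss \<alpha> w + b\<^sup>2 * gauss \<alpha> w') * gauss \<alpha> u)"
    by (intro mult_left_mono mult_right_mono add_mono e1 e2) auto
  also have "\<dots> = 8 * ((cmod (nker \<alpha> w u))\<^sup>2 * gauss \<alpha> u + (cmod (nker \<alpha> w' u))\<^sup>2 * gauss \<alpha> u)"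
    unfolding nker2 Ka power2_abs by (simp only: ring_distribs mult_ac)
  finally have "exp ((1 + c) / \<alpha>) * exp (- (1 + c) / \<alpha>) \<le> exp ((1 + c) / \<alpha>) * (8 * ((cmod (nker \<alpha> w u))\<^sup>2 * gauss \<alpha> u + (cmod (nker \<alpha> w' u))\<^sup>2 * gauss \<alpha> u))"
    by (rule mult_left_mono) simp
  moreover have "exp ((1 + c) / \<alpha>) * exp (- (1 + c) / \<alpha>) = 1"
    by (simp only: exp_add[symmetric] add_divide_distrib[symmetric]) simp
  ultimately show ?thesis by (simp only: c_def mult_ac)
qed

lemma nker_measurable: "nker \<alpha> w \<in> borel_measurable borel"
proof -
  have [measurable]: "(\<lambda>z. K_ph \<alpha> z w) \<in> borel_measurable borel"
    by (rule borel_measurable_continuous_onI[OF pluriharmonic_continuous[OF K_ph_pluriharmonic]])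
  show ?thesis unfolding nker_def[abs_def] by measurable
qed

lemma ball_measure_le:
  fixes w :: "complex ^ 'n::finite"
  assumes \<alpha>: "\<alpha> > 0" and \<mu>: "sets \<mu> = sets borel"
    and w: "norm w \<ge> 16" "norm w \<ge> 1 + \<alpha> * ln 4"
  shows "emeasure \<mu> (ball w 1) \<le> ennreal (8 * exp ((1 + (pi * \<alpha> / 2)\<^sup>2) / \<alpha>))
    * (wsq \<mu> \<alpha> (nker \<alpha> w) + wsq \<mu> \<alpha> (nker \<alpha> ((1 + \<i> * of_real (pi * \<alpha> / (2 * (norm w)\<^sup>2))) *s w)))"
    (is "_ \<le> ennreal ?C * (_ + wsq \<mu> \<alpha> (nker \<alpha> ?w'))")
proof -
  note [measurable_cong] = \<mu> and [measurable] = nker_measurable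
  let ?g = "\<lambda>v u. (cmod (nker \<alpha> v u))\<^sup>2 * gauss \<alpha> u"
  have "emeasure \<mu> (ball w 1) = (\<integral>\<^sup>+ u. indicator (ball w 1) u \<partial>\<mu>)"
    using \<mu> by (simp add: nn_integral_indicator)
  also have "\<dots> \<le> (\<integral>\<^sup>+ u. ennreal ?C * (ennreal (?g w u) + ennreal (?g ?w' u)) \<partial>\<mu>)"
  proof (rule nn_integral_mono)
    fix u
    show "indicator (ball w 1) u \<le> ennreal ?C * (ennreal (?g w u) + ennreal (?g ?w' u))"
    proof (cases "u \<in> ball w 1")
      case True
      have "1 \<le> ?C * (?g w u + ?g ?w' u)"
        by (rule kernel_lower_bound[OF \<alpha> True w])
      then have "ennreal 1 \<le> ennreal (?C * (?g w u + ?g ?w' u))" by (rule ennreal_leI)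
      also have "\<dots> = ennreal ?C * (ennreal (?g w u) + ennreal (?g ?w' u))"
        by (subst ennreal_mult) simp_all
      finally show ?thesis using True by simp
    qed simp
  qed
  also have "\<dots> = ennreal ?C * (wsq \<mu> \<alpha> (nker \<alpha> w) + wsq \<mu> \<alpha> (nker \<alpha> ?w'))"
    unfolding wsq_def by (subst nn_integral_cmult, measurable) (subst nn_integral_add, auto)
  finally show ?thesis .
qed

subsection \<open>Compactness and vanishing Carleson measures\<close>

text \<open>The kernel is constantly 1 at \<open>z = 0\<close>, so the hypothesis says that the
  Gaussian is integrable for \<open>\<mu>\<close>. On a ball the Gaussian is bounded below, and
  countably many balls cover the space.\<close>

lemma finite_on_balls:
  fixes \<mu> :: "(complex ^ 'n::finite) measure"
  assumes \<alpha>: "\<alpha> > 0" and \<mu>: "sets \<mu> = sets borel"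
    and K: "(\<integral>\<^sup>+ w. ennreal ((cmod (K_ph \<alpha> 0 w))\<^sup>2 * gauss \<alpha> w) \<partial>\<mu>) < \<infinity>"
  shows "emeasure \<mu> (ball 0 R) < \<infinity>" "sigma_finite_measure \<mu>"
proof -
  note [measurable_cong] = \<mu>
  have "K_ph \<alpha> 0 w = 1" for w :: "complex ^ 'n" by (simp add: K_ph_def herm_def)
  then have K': "(\<integral>\<^sup>+ w. ennreal (gauss \<alpha> w) \<partial>\<mu>) < \<infinity>" using K by simp
  have fin: "emeasure \<mu> (ball 0 R) < \<infinity>" for R
  proof -
    have "emeasure \<mu> (ball 0 R) = (\<integral>\<^sup>+ w. indicator (ball 0 R) w \<partial>\<mu>)"
      using \<mu> by (simp add: nn_integral_indicator)
    also have "\<dots> \<le> (\<integral>\<^sup>+ w. ennreal (exp (R\<^sup>2 / \<alpha>)) * ennreal (gauss \<alpha> w) \<partial>\<mu>)"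
    proof (rule nn_integral_mono)
      fix w :: "complex ^ 'n"
      show "indicator (ball 0 R) w \<le> ennreal (exp (R\<^sup>2 / \<alpha>)) * ennreal (gauss \<alpha> w)"
      proof (cases "w \<in> ball 0 R")
        case True
        then have "(norm w)\<^sup>2 / \<alpha> \<le> R\<^sup>2 / \<alpha>"
          using \<alpha> by (intro divide_right_mono power_mono) auto
        then have "1 \<le> exp (R\<^sup>2 / \<alpha>) * gauss \<alpha> w"
          by (simp add: exp_add[symmetric])
        then have "ennreal 1 \<le> ennreal (exp (R\<^sup>2 / \<alpha>) * gauss \<alpha> w)" by (rule ennreal_leI)
        then show ?thesis using True by (simp add: ennreal_mult)
      qed simp
    qed
    also have "\<dots> = ennreal (exp (R\<^sup>2 / \<alpha>)) * (\<integral>\<^sup>+ w. ennreal (gauss \<alpha> w) \<partial>\<mu>)"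
      by (rule nn_integral_cmult) measurable
    also have "\<dots> < \<infinity>" using K' by (simp add: ennreal_mult_less_top)
    finally show ?thesis .
  qed
  then show "emeasure \<mu> (ball 0 R) < \<infinity>" .
  have UN: "(\<Union>n::nat. ball 0 (real n)) = (UNIV :: (complex ^ 'n) set)"
    using reals_Archimedean2 by auto
  show "sigma_finite_measure \<mu>"
  proof
    have "space \<mu> = UNIV" using sets_eq_imp_space_eq[OF \<mu>] by simp
    then show "\<exists>A. countable A \<and> A \<subseteq> sets \<mu> \<and> \<Union>A = space \<mu> \<and> (\<forall>a\<in>A. emeasure \<mu> a \<noteq> \<infinity>)"
      using UN \<mu> fin by (intro exI[of _ "range (\<lambda>n::nat. ball 0 (real n))"]) (auto simp: less_top)
  qed
qed

text \<open>The common half of both implications: compactness and the Carleson property are used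
  only through the limit assumed here. Since \<open>w'\<close> is at least as long as
  \<open>w\<close>, the shifted points also go to infinity. Balls centred near the origin lie in one
  ball of finite mass.\<close>

lemma kap_average_vanishes_if_nker:
  fixes \<mu> :: "(complex ^ 'n::finite) measure"
  assumes \<alpha>: "\<alpha> > 0" and \<mu>: "sets \<mu> = sets borel"
    and K: "(\<integral>\<^sup>+ w. ennreal ((cmod (K_ph \<alpha> 0 w))\<^sup>2 * gauss \<alpha> w) \<partial>\<mu>) < \<infinity>"
    and lim: "\<And>z. filterlim (\<lambda>m. norm (z m)) at_top sequentially \<Longrightarrow> (\<lambda>m. wsq \<mu> \<alpha> (nker \<alpha> (z m))) \<longlonglongrightarrow> 0"
  obtains S where "S < \<infinity>" "\<And>w. (\<integral>\<^sup>+ u. ennreal (kap \<alpha> u w) \<partial>\<mu>) \<le> S"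
    "\<And>z. filterlim (\<lambda>m. norm (z m)) at_top sequentially \<Longrightarrow> (\<lambda>m. \<integral>\<^sup>+ u. ennreal (kap \<alpha> u (z m)) \<partial>\<mu>) \<longlonglongrightarrow> 0"
proof -
  have ball_lim: "(\<lambda>m. emeasure \<mu> (ball (z m) 1)) \<longlonglongrightarrow> 0" if z: "filterlim (\<lambda>m. norm (z m)) at_top sequentially" for z
  proof -
    define z' where "z' m = (1 + \<i> * of_real (pi * \<alpha> / (2 * (norm (z m))\<^sup>2))) *s z m" for m
    define C where "C = ennreal (8 * exp ((1 + (pi * \<alpha> / 2)\<^sup>2) / \<alpha>))"
    have "norm (z m) \<le> norm (z' m)" for m
    proof -
      have "1 \<le> cmod (1 + \<i> * of_real (pi * \<alpha> / (2 * (norm (z m))\<^sup>2)))"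
        using abs_Re_le_cmod[of "1 + \<i> * of_real (pi * \<alpha> / (2 * (norm (z m))\<^sup>2))"] by simp
      from mult_right_mono[OF this norm_ge_zero[of "z m"]]
      show ?thesis unfolding z'_def norm_vec_scale by simp
    qed
    then have z': "filterlim (\<lambda>m. norm (z' m)) at_top sequentially"
      by (intro filterlim_at_top_mono[OF z]) simp
    have "(\<lambda>m. C * (wsq \<mu> \<alpha> (nker \<alpha> (z m)) + wsq \<mu> \<alpha> (nker \<alpha> (z' m)))) \<longlonglongrightarrow> C * (0 + 0)"
      by (intro ennreal_tendsto_cmult tendsto_add lim z z') (simp add: C_def)
    then have l: "(\<lambda>m. C * (wsq \<mu> \<alpha> (nker \<alpha> (z m)) + wsq \<mu> \<alpha> (nker \<alpha> (z' m)))) \<longlonglongrightarrow> 0" by simp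
    have "eventually (\<lambda>m. norm (z m) \<ge> max 16 (1 + \<alpha> * ln 4)) sequentially"
      using z unfolding filterlim_at_top by blast
    then have "eventually (\<lambda>m. emeasure \<mu> (ball (z m) 1) \<le> C * (wsq \<mu> \<alpha> (nker \<alpha> (z m)) + wsq \<mu> \<alpha> (nker \<alpha> (z' m)))) sequentially"
      by eventually_elim (unfold C_def z'_def, rule ball_measure_le[OF \<alpha> \<mu>], auto)
    then show ?thesis
      by (intro tendsto_sandwich[OF always_eventually _ tendsto_const[of 0] l]) simp_all
  qed
  obtain R where R: "\<And>w. norm w \<ge> R \<Longrightarrow> emeasure \<mu> (ball w 1) \<le> ennreal 1"
    by (rule vanishing_at_infinity_eps[where F = "\<lambda>w. emeasure \<mu> (ball w 1)" and \<epsilon> = 1]) (use ball_lim in auto)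
  have bound: "emeasure \<mu> (ball w 1) \<le> 1 + emeasure \<mu> (ball 0 (R + 1))" for w
  proof (cases "norm w \<ge> R")
    case True
    then show ?thesis using R[of w] by (simp add: add_increasing2)
  next
    case False
    have "ball w 1 \<subseteq> ball 0 (R + 1)"
    proof
      fix x assume "x \<in> ball w 1"
      then show "x \<in> ball 0 (R + 1)"
        using False norm_triangle_ineq2[of x w] by (simp add: dist_norm norm_minus_commute)
    qed
    then have "emeasure \<mu> (ball w 1) \<le> emeasure \<mu> (ball 0 (R + 1))"
      by (rule emeasure_mono) (simp add: \<mu>)
    then show ?thesis by (simp add: add_increasing)
  qed
  have fin: "1 + emeasure \<mu> (ball 0 (R + 1)) < \<infinity>"
    using finite_on_balls(1)[OF \<alpha> \<mu> K] by simp
  show ?thesis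
    by (rule kap_average_vanishes[OF \<alpha> \<mu> finite_on_balls(2)[OF \<alpha> \<mu> K] fin bound ball_lim])
       (use that in auto)
qed

text \<open>The kernel is symmetric and real, so on the diagonal the integrand of the operator is
  the squared normalized kernel up to the weight at \<open>w\<close>. This plays the role of the
  inner product of the image of the kernel with that kernel.\<close>

lemma toeplitz_nker:
  assumes \<alpha>: "\<alpha> > 0" and \<mu>: "sets \<mu> = sets borel" and fin: "wsq \<mu> \<alpha> (nker \<alpha> w) < \<infinity>"
  shows "ennreal ((cmod (toeplitz \<alpha> \<mu> (nker \<alpha> w) w))\<^sup>2 * gauss \<alpha> w) = (wsq \<mu> \<alpha> (nker \<alpha> w))\<^sup>2"
proof -
  note [measurable_cong] = \<mu> and [measurable] = nker_measurable
  define e where "e = gauss (2 * \<alpha>) w"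
  have e: "e > 0" "gauss \<alpha> w = e\<^sup>2"
    using exp_half_squared[of w \<alpha>] by (simp_all add: e_def)
  define g where "g u = (cmod (nker \<alpha> w u))\<^sup>2 * gauss \<alpha> u" for u
  have [measurable]: "g \<in> borel_measurable borel" unfolding g_def by measurable
  have "integrable \<mu> g"
    using fin by (intro integrableI_bounded) (auto simp: g_def wsq_def)
  then have wsq_eq: "wsq \<mu> \<alpha> (nker \<alpha> w) = ennreal (LINT u|\<mu>. g u)"
    unfolding wsq_def g_def by (intro nn_integral_eq_integral) auto
  have I: "(LINT u|\<mu>. g u) \<ge> 0" by (rule Bochner_Integration.integral_nonneg) (simp add: g_def)
  have "K_ph \<alpha> w u * nker \<alpha> w u * of_real (gauss \<alpha> u) = of_real (g u / e)" for u
  proof -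
    define k where "k = 2 * Re (exp (herm u w / of_real \<alpha>)) - 1"
    have k: "K_ph \<alpha> u w = of_real k" unfolding k_def by (rule K_ph_real)
    have "g u = e\<^sup>2 * k\<^sup>2 * gauss \<alpha> u"
      unfolding g_def nker_def k norm_mult norm_of_real power_mult_distrib e_def[symmetric] by simp
    then show ?thesis
      using e(1) unfolding K_ph_sym[of \<alpha> w u] nker_def k e_def[symmetric]
      by (simp add: power2_eq_square)
  qed
  then have "toeplitz \<alpha> \<mu> (nker \<alpha> w) w = of_real ((LINT u|\<mu>. g u) / e)"
    unfolding toeplitz_def by simp
  then have "(cmod (toeplitz \<alpha> \<mu> (nker \<alpha> w) w))\<^sup>2 * gauss \<alpha> w = (LINT u|\<mu>. g u)\<^sup>2"
    using e(1) by (simp only: e(2) norm_of_real) (simp add: power_divide)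
  then show ?thesis
    using I by (simp add: wsq_eq ennreal_power)
qed

text \<open>If the limit fails, compactness provides a subsequence whose images converge in norm to
  some \<open>g\<close>. Evaluating at the moving points, the difference is controlled by point
  evaluation and \<open>g\<close> itself by its decay, so \<open>g\<close> need not be
  identified.\<close>

lemma wsq_nker_vanishes_if_compact:
  fixes \<mu> :: "(complex ^ 'n::finite) measure"
  assumes \<alpha>: "\<alpha> > 0" and \<mu>: "sets \<mu> = sets borel"
    and K: "\<And>z. (\<integral>\<^sup>+ w. ennreal ((cmod (K_ph \<alpha> z w))\<^sup>2 * gauss \<alpha> w) \<partial>\<mu>) < \<infinity>"
    and T: "toeplitz_compact \<alpha> \<mu>" and z: "filterlim (\<lambda>m. norm (z m)) at_top sequentially"
  shows "(\<lambda>m. wsq \<mu> \<alpha> (nker \<alpha> (z m))) \<longlonglongrightarrow> 0"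
proof (rule ennreal_tendsto_0I, rule ccontr)
  fix \<epsilon> :: real assume \<epsilon>: "\<epsilon> > 0"
  assume "\<not> (\<forall>\<^sub>F m in sequentially. wsq \<mu> \<alpha> (nker \<alpha> (z m)) \<le> ennreal \<epsilon>)"
  then obtain s where s: "strict_mono (s :: nat \<Rightarrow> nat)" "\<And>m. \<not> wsq \<mu> \<alpha> (nker \<alpha> (z (s m))) \<le> ennreal \<epsilon>"
    using not_eventually_sequentiallyD by blast
  obtain T where T: "compact_operator_PH2 \<alpha> T" "\<And>f. f \<in> kernel_span \<alpha> \<Longrightarrow> T f = toeplitz \<alpha> \<mu> f"
    using T by (auto simp: toeplitz_compact_def)
  have Km [measurable]: "(\<lambda>u. K_ph \<alpha> u w) \<in> borel_measurable borel" for w :: "complex ^ 'n"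
    by (rule borel_measurable_continuous_onI[OF pluriharmonic_continuous[OF K_ph_pluriharmonic]])
  have fin: "wsq \<mu> \<alpha> (nker \<alpha> w) < \<infinity>" for w
  proof -
    have "wsq \<mu> \<alpha> (\<lambda>u. K_ph \<alpha> u w) < \<infinity>"
      using K[of w] by (simp add: wsq_def K_ph_sym[of \<alpha> _ w])
    then show ?thesis
      unfolding nker_def[abs_def] by (subst wsq_cmult[OF \<mu> Km]) (simp add: ennreal_mult_less_top)
  qed
  have bounded: "\<exists>C. \<forall>m. Lp_norm 2 \<alpha> (nker \<alpha> (z (s m))) \<le> C"
    by (rule nker_bounded[OF \<alpha>])
  obtain r g where r: "strict_mono (r :: nat \<Rightarrow> nat)" and g: "g \<in> PH 2 \<alpha>"
    and lim: "(\<lambda>m. Lp_norm 2 \<alpha> (\<lambda>u. T (nker \<alpha> (z (s (r m)))) u - g u)) \<longlonglongrightarrow> 0"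
    using T(1) bounded K_ph_in_PH(1)[OF \<alpha>] unfolding compact_operator_PH2_def by meson
  define y where "y m = z (s (r m))" for m
  have y: "filterlim (\<lambda>m. norm (y m)) at_top sequentially"
    unfolding y_def using filterlim_compose[OF z filterlim_subseq[OF strict_mono_o[OF s(1) r]]] by (simp add: o_def)
  have TP: "T (nker \<alpha> w) \<in> PH 2 \<alpha>" for w
    using T(1) K_ph_in_PH(1)[OF \<alpha>] by (auto simp: compact_operator_PH2_def linear_operator_PH2_def)
  have dP: "(\<lambda>u. T (nker \<alpha> (y m)) u - g u) \<in> PH 2 \<alpha>" for m
    by (rule PH_diff[OF \<alpha> TP g])
  have wlim: "(\<lambda>m. wsq lborel \<alpha> (\<lambda>u. T (nker \<alpha> (y m)) u - g u)) \<longlonglongrightarrow> 0"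
    using lim Lp_norm_tendsto_0_iff[where f = "\<lambda>m u. T (nker \<alpha> (y m)) u - g u", OF \<alpha> dP] by (simp add: y_def)
  obtain D where D: "D < \<infinity>" and pt: "\<And>(f :: complex ^ 'n \<Rightarrow> complex) z. f \<in> PH 2 \<alpha> \<Longrightarrow>
      ennreal ((cmod (f z))\<^sup>2 * gauss \<alpha> z) \<le> D * wsq lborel \<alpha> f"
    using PH_point_evaluation[OF \<alpha>] by blast
  have upper: "(wsq \<mu> \<alpha> (nker \<alpha> (y m)))\<^sup>2 \<le> 2 * (D * wsq lborel \<alpha> (\<lambda>u. T (nker \<alpha> (y m)) u - g u))
      + 2 * ennreal ((cmod (g (y m)))\<^sup>2 * gauss \<alpha> (y m))" for m
  proof -
    define a where "a = T (nker \<alpha> (y m)) (y m) - g (y m)"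
    define b where "b = g (y m)"
    define e where "e = gauss \<alpha> (y m)"
    have "e > 0" by (simp add: e_def)
    have "(cmod (a + b))\<^sup>2 \<le> (cmod a + cmod b)\<^sup>2"
      by (intro power_mono norm_triangle_ineq) auto
    also have "\<dots> \<le> 2 * (cmod a)\<^sup>2 + 2 * (cmod b)\<^sup>2"
      using sum_squares_bound[of "cmod a" "cmod b"] by (simp add: power2_sum)
    finally have "(cmod (a + b))\<^sup>2 * e \<le> (2 * (cmod a)\<^sup>2 + 2 * (cmod b)\<^sup>2) * e"
      using \<open>e > 0\<close> by (intro mult_right_mono) auto
    then have "(cmod (a + b))\<^sup>2 * e \<le> 2 * ((cmod a)\<^sup>2 * e) + 2 * ((cmod b)\<^sup>2 * e)"
      by (simp only: distrib_right mult.assoc)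
    then have "ennreal ((cmod (a + b))\<^sup>2 * e) \<le> ennreal (2 * ((cmod a)\<^sup>2 * e) + 2 * ((cmod b)\<^sup>2 * e))"
      by (rule ennreal_leI)
    also have "\<dots> = 2 * ennreal ((cmod a)\<^sup>2 * e) + 2 * ennreal ((cmod b)\<^sup>2 * e)"
      using \<open>e > 0\<close> by (simp add: ennreal_mult')
    also have "\<dots> \<le> 2 * (D * wsq lborel \<alpha> (\<lambda>u. T (nker \<alpha> (y m)) u - g u)) + 2 * ennreal ((cmod b)\<^sup>2 * e)"
      using pt[OF dP[of m], of "y m"] unfolding a_def e_def by (intro add_right_mono mult_left_mono) auto
    also have "ennreal ((cmod (a + b))\<^sup>2 * e) = (wsq \<mu> \<alpha> (nker \<alpha> (y m)))\<^sup>2"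
      using toeplitz_nker[OF \<alpha> \<mu> fin[of "y m"]] by (simp add: a_def b_def e_def T(2)[OF nker_in_kernel_span])
    finally show ?thesis by (simp add: b_def e_def)
  qed
  have "(\<lambda>m. 2 * (D * wsq lborel \<alpha> (\<lambda>u. T (nker \<alpha> (y m)) u - g u))
      + 2 * ennreal ((cmod (g (y m)))\<^sup>2 * gauss \<alpha> (y m))) \<longlonglongrightarrow> 2 * (D * 0) + 2 * 0"
    using D by (intro tendsto_add ennreal_tendsto_cmult wlim PH_decay[OF \<alpha> g y]) auto
  \<comment> \<open>The threshold is squared because the diagonal evaluation yields the square of
    \<open>wsq\<close>.\<close>
  then have "eventually (\<lambda>m. 2 * (D * wsq lborel \<alpha> (\<lambda>u. T (nker \<alpha> (y m)) u - g u))
      + 2 * ennreal ((cmod (g (y m)))\<^sup>2 * gauss \<alpha> (y m)) < (ennreal \<epsilon>)\<^sup>2) sequentially"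
    using \<epsilon> by (intro order_tendstoD) (auto simp: ennreal_power)
  then obtain m where m: "2 * (D * wsq lborel \<alpha> (\<lambda>u. T (nker \<alpha> (y m)) u - g u))
      + 2 * ennreal ((cmod (g (y m)))\<^sup>2 * gauss \<alpha> (y m)) < (ennreal \<epsilon>)\<^sup>2"
    by (auto simp: eventually_sequentially)
  have "(ennreal \<epsilon>)\<^sup>2 \<le> (wsq \<mu> \<alpha> (nker \<alpha> (y m)))\<^sup>2"
    using s(2)[of "r m"] by (intro power_mono) (auto simp: y_def)
  then show False using upper[of m] m by (meson not_less order_trans)
qed

lemma wsq_nker_vanishes_if_carleson:
  fixes \<mu> :: "(complex ^ 'n::finite) measure"
  assumes \<alpha>: "\<alpha> > 0" and V: "vanishing_carleson 2 \<alpha> \<mu>" and z: "filterlim (\<lambda>m. norm (z m)) at_top sequentially"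
  shows "(\<lambda>m. wsq \<mu> \<alpha> (nker \<alpha> (z m))) \<longlonglongrightarrow> 0"
proof -
  have "\<exists>C. \<forall>m. Lp_norm 2 \<alpha> (nker \<alpha> (z m)) \<le> C"
    by (rule nker_bounded[OF \<alpha>])
  moreover have "\<forall>S. compact S \<longrightarrow> uniform_limit S (\<lambda>m. nker \<alpha> (z m)) (\<lambda>_. 0) sequentially"
    using nker_locally_uniform_limit[OF \<alpha> z] by blast
  ultimately have "(\<lambda>m. \<integral>\<^sup>+ u. ennreal (weighted_pow 2 \<alpha> (nker \<alpha> (z m)) u) \<partial>\<mu>) \<longlonglongrightarrow> 0"
    using V[unfolded vanishing_carleson_def, rule_format, of "\<lambda>m. nker \<alpha> (z m)"] K_ph_in_PH(1)[OF \<alpha>] by blast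
  then show ?thesis by (simp add: wsq_def weighted_pow_2)
qed

section \<open>From bounded and vanishing averages back to both properties\<close>

lemma vanishing_carleson_if_average:
  fixes \<mu> :: "(complex ^ 'n::finite) measure"
  assumes \<alpha>: "\<alpha> > 0" and \<mu>: "sets \<mu> = sets borel" "sigma_finite_measure \<mu>"
    and S: "S < \<infinity>" "\<And>w. (\<integral>\<^sup>+ u. ennreal (kap \<alpha> u w) \<partial>\<mu>) \<le> S"
    and lim: "\<And>z. filterlim (\<lambda>m. norm (z m)) at_top sequentially \<Longrightarrow> (\<lambda>m. \<integral>\<^sup>+ u. ennreal (kap \<alpha> u (z m)) \<partial>\<mu>) \<longlonglongrightarrow> 0"
  shows "vanishing_carleson 2 \<alpha> \<mu>"
  unfolding vanishing_carleson_def
proof (intro allI impI)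
  fix f :: "nat \<Rightarrow> complex ^ 'n \<Rightarrow> complex"
  assume *: "(\<forall>m. f m \<in> PH 2 \<alpha>) \<and> (\<exists>C. \<forall>m. Lp_norm 2 \<alpha> (f m) \<le> C) \<and>
        (\<forall>S. compact S \<longrightarrow> uniform_limit S f (\<lambda>_. 0) sequentially)"
  then have f: "\<And>m. f m \<in> PH 2 \<alpha>" by blast
  obtain C where C: "C < \<infinity>" "\<And>m. wsq lborel \<alpha> (f m) \<le> C"
    using * PH_bounded_iff[where f = f, OF \<alpha> f] by blast
  have f0: "(\<lambda>m. f m z) \<longlonglongrightarrow> 0" for z
  proof -
    have "uniform_limit {z} f (\<lambda>_. 0) sequentially" using * by (meson compact_sing)
    from tendsto_uniform_limitI[OF this, of z] show ?thesis by simp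
  qed
  show "(\<lambda>m. \<integral>\<^sup>+ z. ennreal (weighted_pow 2 \<alpha> (f m) z) \<partial>\<mu>) \<longlonglongrightarrow> 0"
    using wsq_tendsto_0[where f = f, OF \<alpha> \<mu> S lim f C f0] by (simp add: wsq_def weighted_pow_2)
qed

text \<open>The integral formula itself is the extension: bounded averages put every member of the
  space into the weighted square-integrable functions of \<open>\<mu>\<close>, so the defining
  integral converges. A bounded sequence has a pointwise convergent subsequence with limit
  \<open>g\<close> in the space. The differences tend to 0 in the norm of \<open>\<mu>\<close>,
  which bounds their images, so these images converge to that of \<open>g\<close>.\<close>

lemma toeplitz_compact_if_average:
  fixes \<mu> :: "(complex ^ 'n::finite) measure"
  assumes \<alpha>: "\<alpha> > 0" and \<mu>: "sets \<mu> = sets borel" "sigma_finite_measure \<mu>"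
    and S: "S < \<infinity>" "\<And>w. (\<integral>\<^sup>+ u. ennreal (kap \<alpha> u w) \<partial>\<mu>) \<le> S"
    and lim: "\<And>z. filterlim (\<lambda>m. norm (z m)) at_top sequentially \<Longrightarrow> (\<lambda>m. \<integral>\<^sup>+ u. ennreal (kap \<alpha> u (z m)) \<partial>\<mu>) \<longlonglongrightarrow> 0"
  shows "toeplitz_compact \<alpha> \<mu>"
proof -
  note [measurable_cong] = \<mu>(1)
  let ?T = "toeplitz \<alpha> \<mu>"
  \<comment> \<open>The average at the origin suffices: half of the Gaussian exponent absorbs
    \<open>r * norm w\<close>, and the other half is dominated by
    \<open>kap \<alpha> w 0\<close>.\<close>
  have exp_fin: "(\<integral>\<^sup>+ w. ennreal (exp (r * norm w - (norm w)\<^sup>2 / \<alpha>)) \<partial>\<mu>) < \<infinity>" for r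
  proof -
    have "(\<integral>\<^sup>+ w. ennreal (exp (r * norm w - (norm w)\<^sup>2 / \<alpha>)) \<partial>\<mu>)
       \<le> (\<integral>\<^sup>+ w. ennreal (exp (r\<^sup>2 * \<alpha> / 2)) * ennreal (kap \<alpha> w 0) \<partial>\<mu>)"
    proof (rule nn_integral_mono)
      fix w :: "complex ^ 'n"
      have "r * norm w - (norm w)\<^sup>2 / \<alpha> \<le> r\<^sup>2 * \<alpha> / 2 + - (norm w)\<^sup>2 / (2 * \<alpha>)"
        using linear_minus_quadratic_le[of "1 / \<alpha>" r "norm w"] \<alpha> by simp
      then have "exp (r * norm w - (norm w)\<^sup>2 / \<alpha>) \<le> exp (r\<^sup>2 * \<alpha> / 2) * gauss (2 * \<alpha>) w"
        by (simp only: exp_add[symmetric] exp_le_cancel_iff)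
      also have "\<dots> \<le> exp (r\<^sup>2 * \<alpha> / 2) * kap \<alpha> w 0"
        by (intro mult_left_mono) (auto simp: kap_def)
      finally show "ennreal (exp (r * norm w - (norm w)\<^sup>2 / \<alpha>)) \<le> ennreal (exp (r\<^sup>2 * \<alpha> / 2)) * ennreal (kap \<alpha> w 0)"
        by (simp add: ennreal_mult[symmetric] kap_nonneg ennreal_leI)
    qed
    also have "\<dots> = ennreal (exp (r\<^sup>2 * \<alpha> / 2)) * (\<integral>\<^sup>+ w. ennreal (kap \<alpha> w 0) \<partial>\<mu>)"
      by (rule nn_integral_cmult) measurable
    also have "\<dots> < \<infinity>"
      using S(1) le_less_trans[OF S(2)[of 0]] by (simp add: ennreal_mult_less_top)
    finally show ?thesis .
  qed
  obtain D where D: "D < \<infinity>" and avg: "\<And>(\<mu> :: (complex ^ 'n) measure) f. sets \<mu> = sets borel \<Longrightarrow> sigma_finite_measure \<mu> \<Longrightarrow> f \<in> PH 2 \<alpha> \<Longrightarrow>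
      wsq \<mu> \<alpha> f \<le> D * (\<integral>\<^sup>+ w. (\<integral>\<^sup>+ u. ennreal (kap \<alpha> u w) \<partial>\<mu>) * ennreal ((cmod (f w))\<^sup>2 * gauss \<alpha> w) \<partial>lborel)"
    using wsq_le_averaged[OF \<alpha>] by blast
  have wsq_fin: "wsq \<mu> \<alpha> f < \<infinity>" if f: "f \<in> PH 2 \<alpha>" for f
  proof -
    have [measurable]: "f \<in> borel_measurable borel" by (rule PH_measurable[OF f])
    have "wsq \<mu> \<alpha> f \<le> D * (\<integral>\<^sup>+ w. S * ennreal ((cmod (f w))\<^sup>2 * gauss \<alpha> w) \<partial>lborel)"
      by (rule order_trans[OF avg[OF \<mu> f]]) (intro mult_left_mono nn_integral_mono mult_right_mono S; simp)
    also have "\<dots> = D * (S * wsq lborel \<alpha> f)"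
      unfolding wsq_def by (subst nn_integral_cmult) auto
    also have "\<dots> < \<infinity>" using f D S(1) by (simp add: PH_2_iff ennreal_mult_less_top)
    finally show ?thesis .
  qed
  have moments: "exp_moments \<mu> (\<lambda>w. f w * of_real (gauss \<alpha> w))" if f: "f \<in> PH 2 \<alpha>" for f
    by (rule weighted_square_exp_moments[OF \<mu>(1) PH_measurable[OF f] wsq_fin[OF f, unfolded wsq_def] exp_fin])
  have int: "integrable \<mu> (\<lambda>w. K_ph \<alpha> z w * f w * of_real (gauss \<alpha> w))" if f: "f \<in> PH 2 \<alpha>" for f z
    using K_ph_integral(2)[OF moments[OF f]] by (simp only: mult.assoc)
  define k where "k = (\<integral>\<^sup>+ w. ennreal (kap \<alpha> (0 :: complex ^ 'n) w) \<partial>lborel)"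
  have k: "k < \<infinity>" unfolding k_def by (rule kap_integral_finite[OF \<alpha>])
  have T_le: "wsq lborel \<alpha> (?T f) \<le> S * (k * wsq \<mu> \<alpha> f)" if f: "f \<in> PH 2 \<alpha>" for f
    unfolding k_def by (rule wsq_toeplitz_le[OF \<alpha> \<mu> S(2) PH_measurable[OF f]])
  have T_PH: "?T f \<in> PH 2 \<alpha>" if f: "f \<in> PH 2 \<alpha>" for f
    unfolding PH_2_iff
  proof
    show "pluriharmonic (?T f)"
      using K_ph_integral_pluriharmonic[OF moments[OF f], of \<alpha>] by (simp add: toeplitz_def[abs_def] mult.assoc)
    show "wsq lborel \<alpha> (?T f) < \<infinity>"
      by (rule le_less_trans[OF T_le[OF f]]) (use S(1) k wsq_fin[OF f] in \<open>simp add: ennreal_mult_less_top\<close>)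
  qed
  have T_add: "?T (\<lambda>z. f z + g z) = (\<lambda>z. ?T f z + ?T g z)" if "f \<in> PH 2 \<alpha>" "g \<in> PH 2 \<alpha>" for f g
    unfolding toeplitz_def
    using Bochner_Integration.integral_add[OF int[OF that(1)] int[OF that(2)]]
    by (intro ext) (simp add: distrib_left distrib_right)
  have T_cmult: "?T (\<lambda>z. c * f z) = (\<lambda>z. c * ?T f z)" for c f
    unfolding toeplitz_def by (simp only: mult.assoc mult.left_commute[of _ c] integral_mult_right_zero)
  have T_diff: "?T (\<lambda>z. f z - g z) = (\<lambda>z. ?T f z - ?T g z)" if "f \<in> PH 2 \<alpha>" "g \<in> PH 2 \<alpha>" for f g
    using T_add[OF that(1) PH_cmult[OF \<alpha> that(2), of "- 1"]] T_cmult[of "- 1" g] by (simp add: fun_eq_iff)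
  have "compact_operator_PH2 \<alpha> ?T"
    unfolding compact_operator_PH2_def linear_operator_PH2_def
  proof (intro conjI allI ballI impI T_PH T_add T_cmult)
    fix f :: "nat \<Rightarrow> complex ^ 'n \<Rightarrow> complex"
    assume *: "(\<forall>m. f m \<in> PH 2 \<alpha>) \<and> (\<exists>C. \<forall>m. Lp_norm 2 \<alpha> (f m) \<le> C)"
    then have f: "\<And>m. f m \<in> PH 2 \<alpha>" by blast
    obtain C where C: "C < \<infinity>" "\<And>m. wsq lborel \<alpha> (f m) \<le> C"
      using * PH_bounded_iff[where f = f, OF \<alpha> f] by blast
    obtain r g where r: "strict_mono (r :: nat \<Rightarrow> nat)" and g: "g \<in> PH 2 \<alpha>" and fg: "\<And>z. (\<lambda>m. f (r m) z) \<longlonglongrightarrow> g z"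
      by (rule PH_bounded_convergent_subsequence[where f = f, OF \<alpha> f C]) blast
    define h where "h m z = f (r m) z - g z" for m z
    have h: "h m \<in> PH 2 \<alpha>" for m
      unfolding h_def[abs_def] by (rule PH_diff[OF \<alpha> f g])
    have "wsq lborel \<alpha> (h m) \<le> 2 * C + 2 * wsq lborel \<alpha> g" for m
      unfolding h_def[abs_def]
      by (rule order_trans[OF wsq_diff_le[OF _ PH_measurable[OF f] PH_measurable[OF g]]])
         (auto intro!: add_right_mono mult_left_mono C)
    moreover have "2 * C + 2 * wsq lborel \<alpha> g < \<infinity>"
      using C(1) g by (simp add: PH_2_iff ennreal_mult_less_top)
    moreover have "(\<lambda>m. h m z) \<longlonglongrightarrow> 0" for z
      using tendsto_diff[OF fg[of z] tendsto_const[of "g z"]] by (simp add: h_def)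
    ultimately have "(\<lambda>m. wsq \<mu> \<alpha> (h m)) \<longlonglongrightarrow> 0"
      by (intro wsq_tendsto_0[where f = h, OF \<alpha> \<mu> S lim h])
    then have "(\<lambda>m. S * (k * wsq \<mu> \<alpha> (h m))) \<longlonglongrightarrow> S * (k * 0)"
      using S(1) k by (intro ennreal_tendsto_cmult) auto
    then have l: "(\<lambda>m. S * (k * wsq \<mu> \<alpha> (h m))) \<longlonglongrightarrow> 0" by simp
    have "(\<lambda>m. wsq lborel \<alpha> (?T (h m))) \<longlonglongrightarrow> 0"
      by (rule tendsto_sandwich[OF always_eventually always_eventually tendsto_const[of 0] l])
         (simp_all only: T_le[OF h] zero_le simp_thms)
    then have "(\<lambda>m. Lp_norm 2 \<alpha> (?T (h m))) \<longlonglongrightarrow> 0"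
      using Lp_norm_tendsto_0_iff[where f = "\<lambda>m. ?T (h m)", OF \<alpha> T_PH[OF h]] by simp
    then have "(\<lambda>m. Lp_norm 2 \<alpha> (\<lambda>z. ?T (f (r m)) z - ?T g z)) \<longlonglongrightarrow> 0"
      unfolding h_def[abs_def] T_diff[OF f g] .
    then show "\<exists>r. \<exists>g\<in>PH 2 \<alpha>. strict_mono (r :: nat \<Rightarrow> nat) \<and> (\<lambda>m. Lp_norm 2 \<alpha> (\<lambda>z. ?T (f (r m)) z - g z)) \<longlonglongrightarrow> 0"
      using r T_PH[OF g] by blast
  qed
  then show ?thesis
    unfolding toeplitz_compact_def by blast
qed

theorem proposition3p2:
  fixes \<alpha> :: real and \<mu> :: "(complex ^ 'n::finite) measure"
  assumes "\<alpha> > 0"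
    and "sets \<mu> = sets borel"
    and "\<And>z. (\<integral>\<^sup>+ w. ennreal ((cmod (K_ph \<alpha> z w))\<^sup>2 * exp (- (norm w)\<^sup>2 / \<alpha>)) \<partial>\<mu>) < \<infinity>"
  shows "toeplitz_compact \<alpha> \<mu> \<longleftrightarrow> vanishing_carleson 2 \<alpha> \<mu>"
proof -
  note \<alpha> = assms(1) and \<mu> = assms(2) and K = assms(3)
  note \<sigma> = finite_on_balls(2)[OF \<alpha> \<mu> K]
  show ?thesis
  proof
    assume T: "toeplitz_compact \<alpha> \<mu>"
    show "vanishing_carleson 2 \<alpha> \<mu>"
      by (rule kap_average_vanishes_if_nker[OF \<alpha> \<mu> K wsq_nker_vanishes_if_compact[OF \<alpha> \<mu> K T]])
         (auto intro: vanishing_carleson_if_average[OF \<alpha> \<mu> \<sigma>])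
  next
    assume V: "vanishing_carleson 2 \<alpha> \<mu>"
    show "toeplitz_compact \<alpha> \<mu>"
      by (rule kap_average_vanishes_if_nker[OF \<alpha> \<mu> K wsq_nker_vanishes_if_carleson[OF \<alpha> V]])
         (auto intro: toeplitz_compact_if_average[OF \<alpha> \<mu> \<sigma>])
  qed
qed

end
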